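(* Let $n\ge 1$ be an integer, let $G_n=\mathrm{Sp}(2n,\mathbb C) * \big(\mathbb C[x_1,\dots,x_n]/\mathbb C\cdot 1\big)$ be the free product of the symplectic group with the additive abelian group of polynomials modulo constants, and let $\rho^A_n: G_n\to \mathrm{Aut}(A_{n,\mathbb C})$ and $\rho^P_n: G_n\to \mathrm{Aut}(P_{n,\mathbb C})$ be the two group homomorphisms defined in the context (sending symplectic matrices to linear automorphisms, and the class of a polynomial $F$ to the transvection $T^A_F$, respectively $T^P_F$). Then $$\ker \rho^A_n=\ker\rho^P_n .$$
   Context: Let $\omega_{ij}=\delta_{i,n+j}-\delta_{n+i,j}$ for $1\le i,j\le 2n$ (Kronecker deltas). The Weyl algebra $A_{n,\mathbb C}$ is the associative unital $\mathbb C$-algebra with generators $\hat x_1,\dots,\hat x_{2n}$ and relations $[\hat x_i,\hat x_j]=\omega_{ij}$, and $\mathrm{Aut}(A_{n,\mathbb C})$ is the group of its $\mathbb C$-algebra automorphisms. The Poisson algebra $P_{n,\mathbb C}$ is the polynomial algebra $\mathbb C[x_1,\dots,x_{2n}]$ with the Poisson bracket determined by $\{x_i,x_j\}=\omega_{ij}$, and $\mathrm{Aut}(P_{n,\mathbb C})$ is the group of $\mathbb C$-algebra automorphisms preserving the Poisson bracket. The group $\mathrm{Sp}(2n,\mathbb C)$ (invertible matrices $g$ with $g^{T}\omega g=\omega$) acts by automorphisms on both algebras through symplectic linear transformations of the generators: $\hat x_j\mapsto\sum_i g_{ij}\hat x_i$ on $A_{n,\mathbb C}$ and $x_j\mapsto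 \sum_i g_{ij}x_i$ on $P_{n,\mathbb C}$. For $F\in\mathbb C[x_1,\dots,x_n]$, with $\partial_iF=\partial F/\partial x_i$, the transvections are the automorphisms given, for $1\le i\le n$, by $$T^P_F(x_i)=x_i,\quad T^P_F(x_{n+i})=x_{n+i}+\partial_iF(x_1,\dots,x_n),$$ $$T^A_F(\hat x_i)=\hat x_i,\quad T^A_F(\hat x_{n+i})=\hat x_{n+i}+\partial_iF(\hat x_1,\dots,\hat x_n)$$ (the $\hat x_1,\dots,\hat x_n$ commute with each other, so the substitution makes sense). The maps $F\mapsto T^A_F$ and $F\mapsto T^P_F$ are group homomorphisms from $\mathbb C[x_1,\dots,x_n]/\mathbb C\cdot 1$ to $\mathrm{Aut}(A_{n,\mathbb C})$ and $\mathrm{Aut}(P_{n,\mathbb C})$. By the universal property of the free product, $\rho_n^A$ (resp. $\rho_n^P$) is the homomorphism on $G_n$ restricting to the linear action on $\mathrm{Sp}(2n,\mathbb C)$ and to $F\mapsto T_F^A$ (resp. $F\mapsto T_F^P$) on the other factor. *)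

theory Defs
  imports
    Complex_Main
    "HOL-Library.Poly_Mapping"
    "HOL-Analysis.Cartesian_Space"
    "HOL-Algebra.Coset"
begin

text \<open>
  The rank \<open>n \<ge> 1\<close> is the cardinality of a finite index type \<open>'n\<close>. The index set
  \<open>{1..2n}\<close> is the type \<open>'n + 'n\<close>: \<open>Inl i\<close> plays the role of \<open>i\<close> and \<open>Inr i\<close> that of
  \<open>n + i\<close>, for \<open>1 \<le> i \<le> n\<close>. Coefficients lie in an arbitrary commutative ring, to be
  instantiated with the complex numbers.
\<close>

section \<open>Monoid algebras\<close>

text \<open>
  For a monoid type \<open>'k\<close>, written additively, the type \<open>'k \<Rightarrow>\<^sub>0 'a\<close> with its convolution product
  is the monoid algebra over \<open>'a\<close>. It is the polynomial algebra with variables in \<open>'v\<close> when \<open>'k\<close>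
  is \<open>'v \<Rightarrow>\<^sub>0 nat\<close>, and the free associative algebra when \<open>'k\<close> is the free monoid on \<open>'v\<close>.
\<close>

type_synonym ('a, 'v) poly_alg = "('v \<Rightarrow>\<^sub>0 nat) \<Rightarrow>\<^sub>0 'a"

datatype 'v free_mon = Word (letters: "'v list")

instantiation free_mon :: (type) monoid_add
begin
definition zero_free_mon :: "'a free_mon" where
  "0 = Word []"
definition plus_free_mon :: "'a free_mon \<Rightarrow> 'a free_mon \<Rightarrow> 'a free_mon" where
  "u + v = Word (letters u @ letters v)"
instance
  by standard (simp_all add: zero_free_mon_def plus_free_mon_def)
end

type_synonym ('a, 'v) free_alg = "'v free_mon \<Rightarrow>\<^sub>0 'a"

definition const :: "'a \<Rightarrow> ('k::monoid_add \<Rightarrow>\<^sub>0 'a::zero)" where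
  "const c = Poly_Mapping.single 0 c"

definition pvar :: "'v \<Rightarrow> ('a::zero_neq_one, 'v) poly_alg" where
  "pvar i = Poly_Mapping.single (Poly_Mapping.single i 1) 1"

definition fvar :: "'v \<Rightarrow> ('a::zero_neq_one, 'v) free_alg" where
  "fvar i = Poly_Mapping.single (Word [i]) 1"

text \<open>
  An algebra over \<open>'a\<close> is a ring \<open>'b\<close> with a central unital ring homomorphism \<open>\<iota> :: 'a \<Rightarrow> 'b\<close>.
  The sort \<open>{ring, monoid_mult}\<close> is that of unital rings in which \<open>0 \<noteq> 1\<close> is not presupposed.
\<close>

definition monoid_eval :: "('a \<Rightarrow> 'b) \<Rightarrow> ('k \<Rightarrow> 'b) \<Rightarrow> ('k \<Rightarrow>\<^sub>0 'a::zero) \<Rightarrow> 'b::{ring, monoid_mult}" where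
  "monoid_eval \<iota> h p = (\<Sum>k\<in>Poly_Mapping.keys p. \<iota> (Poly_Mapping.lookup p k) * h k)"

definition free_eval :: "('a \<Rightarrow> 'b) \<Rightarrow> ('v \<Rightarrow> 'b) \<Rightarrow> ('a::zero, 'v) free_alg \<Rightarrow> 'b::{ring, monoid_mult}" where
  "free_eval \<iota> y = monoid_eval \<iota> (\<lambda>w. prod_list (map y (letters w)))"

text \<open>
  Substitution of a pairwise commuting family in a possibly noncommutative ring. The \<open>fold\<close> is the
  product over all \<open>i\<close> of \<open>y i ^ m i\<close>; it is what \<open>prod\<close> unfolds to in a commutative ring.
\<close>

definition poly_eval :: "('a \<Rightarrow> 'b) \<Rightarrow> ('v \<Rightarrow> 'b) \<Rightarrow> ('a::zero, 'v::finite) poly_alg \<Rightarrow> 'b::{ring, monoid_mult}" where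
  "poly_eval \<iota> y = monoid_eval \<iota>
     (\<lambda>m. Finite_Set.fold ((*) \<circ> (\<lambda>i. y i ^ Poly_Mapping.lookup m i)) 1 UNIV)"

definition partial :: "'v \<Rightarrow> ('a::semiring_1, 'v) poly_alg \<Rightarrow> ('a, 'v) poly_alg" where
  "partial i p = (\<Sum>m\<in>Poly_Mapping.keys p.
     Poly_Mapping.single (m - Poly_Mapping.single i 1)
       (of_nat (Poly_Mapping.lookup m i) * Poly_Mapping.lookup p m))"

definition alg_auts :: "('a \<Rightarrow> 'b) \<Rightarrow> ('b::{ring, monoid_mult} \<Rightarrow> 'b) set" where
  "alg_auts \<iota> = {f. bij f \<and> (\<forall>a b. f (a + b) = f a + f b) \<and> (\<forall>a b. f (a * b) = f a * f b)
     \<and> (\<forall>c. f (\<iota> c) = \<iota> c)}"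

section \<open>The Weyl algebra\<close>

definition omega :: "'n + 'n \<Rightarrow> 'n + 'n \<Rightarrow> 'a::ring_1" where
  "omega i j = of_bool (\<exists>k. i = Inr k \<and> j = Inl k) - of_bool (\<exists>k. i = Inl k \<and> j = Inr k)"

inductive_set two_sided_ideal :: "'b::ring_1 set \<Rightarrow> 'b set" for R where
  zero: "0 \<in> two_sided_ideal R"
| gen: "r \<in> R \<Longrightarrow> a * r * b \<in> two_sided_ideal R"
| add: "x \<in> two_sided_ideal R \<Longrightarrow> y \<in> two_sided_ideal R \<Longrightarrow> x + y \<in> two_sided_ideal R"

lemma two_sided_ideal_mult:
  assumes "x \<in> two_sided_ideal R"
  shows "a * x * b \<in> two_sided_ideal R"
  using assms
proof induction
  case zero
  then show ?case by (simp add: two_sided_ideal.zero)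
next
  case (gen r c d)
  then show ?case
    using two_sided_ideal.gen[of r R "a * c" "d * b"] by (simp add: mult.assoc)
next
  case (add x y)
  then show ?case
    by (simp add: distrib_left distrib_right two_sided_ideal.add)
qed

lemma two_sided_ideal_uminus: "x \<in> two_sided_ideal R \<Longrightarrow> - x \<in> two_sided_ideal R"
  using two_sided_ideal_mult[of x R "- 1" 1] by simp

lemma two_sided_ideal_diff:
  "x \<in> two_sided_ideal R \<Longrightarrow> y \<in> two_sided_ideal R \<Longrightarrow> x - y \<in> two_sided_ideal R"
  using two_sided_ideal.add[of x R "- y"] two_sided_ideal_uminus[of y R] by simp

definition weyl_relators :: "('a::comm_ring_1, 'n + 'n) free_alg set" where
  "weyl_relators = {fvar i * fvar j - fvar j * fvar i - const (omega i j) |i j. True}"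

definition weyl_cong :: "('a::comm_ring_1, 'n + 'n) free_alg \<Rightarrow> ('a, 'n + 'n) free_alg \<Rightarrow> bool" where
  "weyl_cong p q \<longleftrightarrow> p - q \<in> two_sided_ideal weyl_relators"

lemma equivp_weyl_cong: "equivp weyl_cong"
proof (rule equivpI)
  show "reflp weyl_cong"
    by (simp add: reflp_def weyl_cong_def two_sided_ideal.zero)
  show "symp weyl_cong"
    unfolding symp_def weyl_cong_def using two_sided_ideal_uminus by fastforce
  show "transp weyl_cong"
    unfolding transp_def weyl_cong_def using two_sided_ideal.add by fastforce
qed

quotient_type (overloaded) ('a, 'n) weyl = "('a::comm_ring_1, 'n + 'n) free_alg" / weyl_cong
  by (rule equivp_weyl_cong)

instantiation weyl :: (comm_ring_1, type) ring
begin

lift_definition zero_weyl :: "('a, 'b) weyl" is 0 .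

lift_definition plus_weyl :: "('a, 'b) weyl \<Rightarrow> ('a, 'b) weyl \<Rightarrow> ('a, 'b) weyl" is "(+)"
  unfolding weyl_cong_def using two_sided_ideal.add by (fastforce simp: algebra_simps)

lift_definition uminus_weyl :: "('a, 'b) weyl \<Rightarrow> ('a, 'b) weyl" is "uminus"
  unfolding weyl_cong_def using two_sided_ideal_uminus by fastforce

lift_definition minus_weyl :: "('a, 'b) weyl \<Rightarrow> ('a, 'b) weyl \<Rightarrow> ('a, 'b) weyl" is "(-)"
  unfolding weyl_cong_def using two_sided_ideal_diff by (fastforce simp: algebra_simps)

lift_definition times_weyl :: "('a, 'b) weyl \<Rightarrow> ('a, 'b) weyl \<Rightarrow> ('a, 'b) weyl" is "(*)"
proof -
  fix p p' q q' :: "('a, 'b + 'b) free_alg"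
  assume "weyl_cong p p'" "weyl_cong q q'"
  then have "1 * (p - p') * q + p' * (q - q') * 1 \<in> two_sided_ideal weyl_relators"
    unfolding weyl_cong_def by (intro two_sided_ideal.add two_sided_ideal_mult)
  then show "weyl_cong (p * q) (p' * q')"
    by (simp add: weyl_cong_def algebra_simps)
qed

instance
  by standard (transfer; simp add: weyl_cong_def algebra_simps two_sided_ideal.zero)+

end

instantiation weyl :: (comm_ring_1, type) monoid_mult
begin

lift_definition one_weyl :: "('a, 'b) weyl" is 1 .

instance
  by standard (transfer; simp add: weyl_cong_def two_sided_ideal.zero mult.assoc)+

end

lift_definition wconst :: "'a::comm_ring_1 \<Rightarrow> ('a, 'n) weyl" is const .

lift_definition wvar :: "'n + 'n \<Rightarrow> ('a::comm_ring_1, 'n) weyl" is fvar .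

text \<open>
  Meaningful only if the family \<open>y\<close> satisfies the defining relations; the value then does not
  depend on the representative.
\<close>

definition weyl_eval :: "('n + 'n \<Rightarrow> ('a, 'n) weyl) \<Rightarrow> ('a::comm_ring_1, 'n) weyl \<Rightarrow> ('a, 'n) weyl" where
  "weyl_eval y a = free_eval wconst y (rep_weyl a)"

definition weyl_Aut :: "(('a::comm_ring_1, 'n) weyl \<Rightarrow> ('a, 'n) weyl) monoid" where
  "weyl_Aut = \<lparr>carrier = alg_auts wconst, mult = (\<circ>), one = id\<rparr>"

section \<open>The Poisson algebra\<close>

type_synonym ('a, 'n) poisson = "('a, 'n + 'n) poly_alg"

text \<open>The biderivation with \<open>poisson (pvar i) (pvar j) = const (omega i j)\<close>.\<close>

definition poisson ::
  "('a::comm_ring_1, 'n::finite) poisson \<Rightarrow> ('a, 'n) poisson \<Rightarrow> ('a, 'n) poisson" where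
  "poisson p q = (\<Sum>i\<in>UNIV. \<Sum>j\<in>UNIV. const (omega i j) * partial i p * partial j q)"

definition poisson_Aut :: "(('a::comm_ring_1, 'n::finite) poisson \<Rightarrow> ('a, 'n) poisson) monoid" where
  "poisson_Aut = \<lparr>carrier = {f \<in> alg_auts const. \<forall>p q. f (poisson p q) = poisson (f p) (f q)},
     mult = (\<circ>), one = id\<rparr>"

section \<open>The symplectic group and polynomials modulo constants\<close>

definition Sp :: "(('a::comm_ring_1)^('n + 'n)^('n::finite + 'n)) monoid" where
  "Sp = \<lparr>carrier = {g. invertible g \<and>
       transpose g ** (\<chi> i j. omega i j) ** g = (\<chi> i j. omega i j)},
     mult = (**), one = mat 1\<rparr>"

definition add_group :: "'b::ab_group_add monoid" where
  "add_group = \<lparr>carrier = UNIV, mult = (+), one = 0\<rparr>"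

definition polys_mod_consts :: "('a::comm_ring_1, 'n) poly_alg set monoid" where
  "polys_mod_consts = add_group Mod range const"

definition sp_weyl ::
  "('a::comm_ring_1)^('n + 'n)^('n::finite + 'n) \<Rightarrow> ('a, 'n) weyl \<Rightarrow> ('a, 'n) weyl" where
  "sp_weyl g = weyl_eval (\<lambda>j. \<Sum>i\<in>UNIV. wconst (g $ i $ j) * wvar i)"

definition sp_poisson ::
  "('a::comm_ring_1)^('n + 'n)^('n::finite + 'n) \<Rightarrow> ('a, 'n) poisson \<Rightarrow> ('a, 'n) poisson" where
  "sp_poisson g = poly_eval const (\<lambda>j. \<Sum>i\<in>UNIV. const (g $ i $ j) * pvar i)"

definition transv_weyl ::
  "('a::comm_ring_1, 'n::finite) poly_alg \<Rightarrow> ('a, 'n) weyl \<Rightarrow> ('a, 'n) weyl" where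
  "transv_weyl F = weyl_eval (\<lambda>k. case k of
       Inl i \<Rightarrow> wvar (Inl i)
     | Inr i \<Rightarrow> wvar (Inr i) + poly_eval wconst (\<lambda>j. wvar (Inl j)) (partial i F))"

definition transv_poisson ::
  "('a::comm_ring_1, 'n::finite) poly_alg \<Rightarrow> ('a, 'n) poisson \<Rightarrow> ('a, 'n) poisson" where
  "transv_poisson F = poly_eval const (\<lambda>k. case k of
       Inl i \<Rightarrow> pvar (Inl i)
     | Inr i \<Rightarrow> pvar (Inr i) + poly_eval const (\<lambda>j. pvar (Inl j)) (partial i F))"

section \<open>Free products of groups\<close>

definition fp_words :: "('a, 'c) monoid_scheme \<Rightarrow> ('b, 'd) monoid_scheme \<Rightarrow> ('a + 'b) list set" where
  "fp_words G H = lists (carrier G <+> carrier H)"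

inductive fp_step ::
  "('a, 'c) monoid_scheme \<Rightarrow> ('b, 'd) monoid_scheme \<Rightarrow> ('a + 'b) list \<Rightarrow> ('a + 'b) list \<Rightarrow> bool"
  for G H where
  mult_left: "a \<in> carrier G \<Longrightarrow> b \<in> carrier G \<Longrightarrow>
    fp_step G H (u @ [Inl a, Inl b] @ v) (u @ [Inl (a \<otimes>\<^bsub>G\<^esub> b)] @ v)"
| mult_right: "a \<in> carrier H \<Longrightarrow> b \<in> carrier H \<Longrightarrow>
    fp_step G H (u @ [Inr a, Inr b] @ v) (u @ [Inr (a \<otimes>\<^bsub>H\<^esub> b)] @ v)"
| one_left: "fp_step G H (u @ [Inl \<one>\<^bsub>G\<^esub>] @ v) (u @ v)"
| one_right: "fp_step G H (u @ [Inr \<one>\<^bsub>H\<^esub>] @ v) (u @ v)"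

definition fp_rel ::
  "('a, 'c) monoid_scheme \<Rightarrow> ('b, 'd) monoid_scheme \<Rightarrow> (('a + 'b) list \<times> ('a + 'b) list) set" where
  "fp_rel G H = {(u, v). u \<in> fp_words G H \<and> v \<in> fp_words G H \<and> equivclp (fp_step G H) u v}"

definition free_product ::
  "('a, 'c) monoid_scheme \<Rightarrow> ('b, 'd) monoid_scheme \<Rightarrow> ('a + 'b) list set monoid" where
  "free_product G H = \<lparr>carrier = fp_words G H // fp_rel G H,
     mult = (\<lambda>X Y. \<Union>u\<in>X. \<Union>v\<in>Y. fp_rel G H `` {u @ v}),
     one = fp_rel G H `` {[]}\<rparr>"

definition fp_lift ::
  "('k, 'c) monoid_scheme \<Rightarrow> ('a \<Rightarrow> 'k) \<Rightarrow> ('b \<Rightarrow> 'k) \<Rightarrow> ('a + 'b) list set \<Rightarrow> 'k" where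
  "fp_lift K f g X = the_elem ((\<lambda>w. foldr (\<lambda>s z. case_sum f g s \<otimes>\<^bsub>K\<^esub> z) w \<one>\<^bsub>K\<^esub>) ` X)"

section \<open>The two homomorphisms\<close>

type_synonym ('a, 'n) G_elem = "(('a^('n + 'n)^('n + 'n)) + ('a, 'n) poly_alg set) list set"

definition G_group :: "('a::comm_ring_1, 'n::finite) G_elem monoid" where
  "G_group = free_product Sp polys_mod_consts"

definition rho_weyl ::
  "('a::comm_ring_1, 'n::finite) G_elem \<Rightarrow> ('a, 'n) weyl \<Rightarrow> ('a, 'n) weyl" where
  "rho_weyl = fp_lift weyl_Aut sp_weyl (\<lambda>C. the_elem (transv_weyl ` C))"

definition rho_poisson ::
  "('a::comm_ring_1, 'n::finite) G_elem \<Rightarrow> ('a, 'n) poisson \<Rightarrow> ('a, 'n) poisson" where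
  "rho_poisson = fp_lift poisson_Aut sp_poisson (\<lambda>C. the_elem (transv_poisson ` C))"

section \<open>Basic facts\<close>

lemma poly_mapping_sum_single:
  "p = (\<Sum>k\<in>Poly_Mapping.keys p. Poly_Mapping.single k (Poly_Mapping.lookup p k))"
  by (rule poly_mapping_eqI)
    (auto simp: lookup_sum lookup_single when_def sum.delta in_keys_iff)

lemma const_zero: "const 0 = 0"
  by (simp add: const_def)

lemma const_one: "const 1 = (1 :: 'k::monoid_add \<Rightarrow>\<^sub>0 'a::semiring_1)"
  by (simp add: const_def)

lemma const_add: "const (c + d) = (const c + const d :: 'k::monoid_add \<Rightarrow>\<^sub>0 'a::monoid_add)"
  by (simp add: const_def single_add)

lemma const_mult: "const (c * d) = (const c * const d :: 'k::monoid_add \<Rightarrow>\<^sub>0 'a::semiring_0)"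
  by (simp add: const_def mult_single)

lemma const_central: "const c * p = p * (const c :: 'k::monoid_add \<Rightarrow>\<^sub>0 'a::comm_semiring_0)"
  unfolding const_def
  by (subst (1 2) poly_mapping_sum_single[of p])
    (simp add: sum_distrib_left sum_distrib_right mult_single mult.commute)

lemma wconst_simps:
  "wconst 0 = 0" "wconst 1 = 1" "wconst (c + d) = wconst c + wconst d"
  "wconst (c * d) = wconst c * wconst d"
  by (transfer; simp add: const_zero const_one const_add const_mult weyl_cong_def two_sided_ideal.zero)+

lemma wconst_central: "wconst c * a = a * wconst c"
  by transfer (simp add: const_central weyl_cong_def two_sided_ideal.zero)

lemma wvar_commutator: "wvar i * wvar j - wvar j * wvar i = wconst (omega i j)"
proof (transfer, unfold weyl_cong_def)
  fix i j :: "'b + 'b"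
  have "1 * (fvar i * fvar j - fvar j * fvar i - const (omega i j)) * 1
      \<in> two_sided_ideal (weyl_relators :: ('a, 'b + 'b) free_alg set)"
    by (rule two_sided_ideal.gen) (auto simp: weyl_relators_def)
  then show "fvar i * fvar j - fvar j * fvar i - const (omega i j)
      \<in> two_sided_ideal (weyl_relators :: ('a, 'b + 'b) free_alg set)"
    by simp
qed

locale monoid_eval_hom =
  fixes \<iota> :: "'a::comm_ring_1 \<Rightarrow> 'b::{ring, monoid_mult}" and h :: "'k::monoid_add \<Rightarrow> 'b"
  assumes iota_one: "\<iota> 1 = 1"
    and iota_add: "\<iota> (c + d) = \<iota> c + \<iota> d"
    and iota_mult: "\<iota> (c * d) = \<iota> c * \<iota> d"
    and iota_central: "\<iota> c * z = z * \<iota> c"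
    and h_zero: "h 0 = 1"
    and h_add: "h (k + l) = h k * h l"
begin

lemma iota_zero: "\<iota> 0 = 0"
  using iota_add[of 0 0] by simp

lemma monoid_eval_superset:
  assumes "finite A" "Poly_Mapping.keys p \<subseteq> A"
  shows "monoid_eval \<iota> h p = (\<Sum>k\<in>A. \<iota> (Poly_Mapping.lookup p k) * h k)"
  unfolding monoid_eval_def
  by (rule sum.mono_neutral_left) (use assms in \<open>auto simp: in_keys_iff iota_zero\<close>)

lemma monoid_eval_add: "monoid_eval \<iota> h (p + q) = monoid_eval \<iota> h p + monoid_eval \<iota> h q"
proof -
  let ?A = "Poly_Mapping.keys p \<union> Poly_Mapping.keys q"
  have "Poly_Mapping.keys (p + q) \<subseteq> ?A"
    by (rule keys_add)
  then show ?thesis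
    by (subst (1 2 3) monoid_eval_superset[of ?A])
      (auto simp: lookup_add iota_add distrib_right sum.distrib)
qed

lemma monoid_eval_single: "monoid_eval \<iota> h (Poly_Mapping.single k c) = \<iota> c * h k"
  by (subst monoid_eval_superset[of "{k}"]) auto

lemma monoid_eval_zero: "monoid_eval \<iota> h 0 = 0"
  by (simp add: monoid_eval_def)

lemma monoid_eval_const: "monoid_eval \<iota> h (const c) = \<iota> c"
  by (simp add: const_def monoid_eval_single h_zero)

lemma monoid_eval_sum: "monoid_eval \<iota> h (sum f A) = (\<Sum>x\<in>A. monoid_eval \<iota> h (f x))"
  by (induction A rule: infinite_finite_induct) (simp_all add: monoid_eval_zero monoid_eval_add)

lemma monoid_eval_mult: "monoid_eval \<iota> h (p * q) = monoid_eval \<iota> h p * monoid_eval \<iota> h q"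
proof -
  have swap: "\<iota> a * \<iota> b * (h k * h l) = \<iota> a * h k * (\<iota> b * h l)" for a b k l
    by (metis iota_central mult.assoc)
  have "p * q = (\<Sum>k\<in>Poly_Mapping.keys p. \<Sum>l\<in>Poly_Mapping.keys q.
      Poly_Mapping.single (k + l) (Poly_Mapping.lookup p k * Poly_Mapping.lookup q l))"
    by (subst poly_mapping_sum_single[of p], subst poly_mapping_sum_single[of q])
      (simp only: sum_product mult_single)
  then have "monoid_eval \<iota> h (p * q) = (\<Sum>k\<in>Poly_Mapping.keys p. \<Sum>l\<in>Poly_Mapping.keys q.
      (\<iota> (Poly_Mapping.lookup p k) * h k) * (\<iota> (Poly_Mapping.lookup q l) * h l))"
    by (simp add: monoid_eval_sum monoid_eval_single h_add iota_mult swap)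
  then show ?thesis
    by (simp add: monoid_eval_def sum_product)
qed

end

lemma free_eval_hom: "monoid_eval_hom wconst (\<lambda>w. prod_list (map y (letters w)))"
  by unfold_locales
    (simp_all add: wconst_simps zero_free_mon_def plus_free_mon_def, rule wconst_central)

context
  fixes y :: "'n + 'n \<Rightarrow> ('a::comm_ring_1, 'n) weyl"
  assumes rel: "\<And>i j. y i * y j - y j * y i = wconst (omega i j)"
begin

interpretation monoid_eval_hom wconst "\<lambda>w. prod_list (map y (letters w))"
  by (rule free_eval_hom)

lemma free_eval_ideal:
  assumes "p \<in> two_sided_ideal weyl_relators"
  shows "free_eval wconst y p = 0"
  using assms
proof induction
  case (gen r a b)
  then obtain i j where "r = fvar i * fvar j - fvar j * fvar i - const (omega i j)"
    by (auto simp: weyl_relators_def)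
  then have r: "r + const (omega i j) + fvar j * fvar i = fvar i * fvar j"
    by simp
  have "free_eval wconst y r + wconst (omega i j) + y j * y i = y i * y j"
    using arg_cong[OF r, of "free_eval wconst y"]
    by (simp add: free_eval_def monoid_eval_add monoid_eval_mult monoid_eval_const
        fvar_def monoid_eval_single wconst_simps)
  then have "free_eval wconst y r = y i * y j - y j * y i - wconst (omega i j)"
    by (simp add: algebra_simps)
  then show ?case
    by (simp add: rel free_eval_def monoid_eval_mult)
qed (simp_all add: free_eval_def monoid_eval_zero monoid_eval_add)

lemma weyl_eval_abs: "weyl_eval y (abs_weyl p) = free_eval wconst y p"
proof -
  have "weyl_cong (rep_weyl (abs_weyl p)) p"
    by (metis Quotient3_abs_rep Quotient3_rel_abs Quotient3_weyl weyl.abs_eq_iff)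
  then have "free_eval wconst y (rep_weyl (abs_weyl p) - p) = 0"
    by (simp add: weyl_cong_def free_eval_ideal)
  moreover have "free_eval wconst y (rep_weyl (abs_weyl p))
      = free_eval wconst y (rep_weyl (abs_weyl p) - p) + free_eval wconst y p"
    unfolding free_eval_def monoid_eval_add[symmetric] by simp
  ultimately show ?thesis
    by (simp add: weyl_eval_def)
qed

lemma weyl_eval_simps:
  "weyl_eval y (a + b) = weyl_eval y a + weyl_eval y b"
  "weyl_eval y (a * b) = weyl_eval y a * weyl_eval y b"
  "weyl_eval y (wconst c) = wconst c"
  "weyl_eval y (wvar i) = y i"
proof -
  obtain p q where pq: "a = abs_weyl p" "b = abs_weyl q"
    by (metis Quotient3_abs_rep Quotient3_weyl)
  show "weyl_eval y (a + b) = weyl_eval y a + weyl_eval y b"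
    "weyl_eval y (a * b) = weyl_eval y a * weyl_eval y b"
    by (simp_all add: pq plus_weyl.abs_eq times_weyl.abs_eq weyl_eval_abs)
      (simp_all add: free_eval_def monoid_eval_add monoid_eval_mult)
  show "weyl_eval y (wconst c) = wconst c" "weyl_eval y (wvar i) = y i"
    by (simp_all add: wconst.abs_eq wvar.abs_eq weyl_eval_abs)
      (simp_all add: free_eval_def monoid_eval_const fvar_def monoid_eval_single wconst.abs_eq[symmetric] wconst_simps)
qed

end

lemma poly_eval_comm:
  fixes y :: "'v::finite \<Rightarrow> 'b::comm_ring_1"
  shows "poly_eval \<iota> y p = (\<Sum>m\<in>Poly_Mapping.keys p.
    \<iota> (Poly_Mapping.lookup p m) * (\<Prod>i\<in>UNIV. y i ^ Poly_Mapping.lookup m i))"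
  by (simp add: poly_eval_def monoid_eval_def prod.eq_fold)

lemma commuting_fold_eq:
  fixes y :: "'v::finite \<Rightarrow> 'b::{ring, monoid_mult}"
  assumes "\<And>i j. y i * y j = y j * y i"
    and "distinct vs" "set vs = UNIV"
  shows "Finite_Set.fold ((*) \<circ> (\<lambda>i. y i ^ e i)) 1 UNIV = prod_list (map (\<lambda>i. y i ^ e i) vs)"
proof -
  have c: "y i ^ k * y j ^ l = y j ^ l * y i ^ k" for i j k l
    by (intro power_commuting_commutes power_commuting_commutes[symmetric] assms(1))
  interpret comp_fun_commute_on UNIV "(*) \<circ> (\<lambda>i. y i ^ e i)"
    by unfold_locales (simp add: fun_eq_iff c mult.assoc[symmetric])
  have "set us \<subseteq> UNIV \<Longrightarrow> distinct us \<Longrightarrow>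
      Finite_Set.fold ((*) \<circ> (\<lambda>i. y i ^ e i)) 1 (set us) = prod_list (map (\<lambda>i. y i ^ e i) us)" for us
    by (induction us) (simp_all)
  from this[of vs] show ?thesis using assms by simp
qed

lemma partial_single: "partial i (Poly_Mapping.single m c) =
    Poly_Mapping.single (m - Poly_Mapping.single i 1) (of_nat (Poly_Mapping.lookup m i) * c)"
  by (cases "c = 0") (simp_all add: partial_def)

lemma poisson_pvar:
  "poisson (pvar i) (pvar j) = (const (omega i j) :: ('a::comm_ring_1, 'n::finite) poisson)"
proof -
  have *: "partial k (pvar l) = (if k = l then 1 else 0 :: ('a::comm_ring_1, 'n + 'n) poly_alg)" for k l
    by (auto simp: pvar_def partial_single lookup_single simp flip: single_one)
  have "poisson (pvar i) (pvar j) = (\<Sum>k\<in>UNIV. \<Sum>l\<in>UNIV.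
      if l = j then (if k = i then const (omega k l) else 0) else (0 :: ('a, 'n) poisson))"
    unfolding poisson_def * by (intro sum.cong refl) simp
  then show ?thesis
    by (simp add: sum.delta)
qed

lemma fp_step_words:
  assumes "group G" "group H" "fp_step G H u v"
  shows "u \<in> fp_words G H \<longleftrightarrow> v \<in> fp_words G H"
proof -
  interpret G: group G by fact
  interpret H: group H by fact
  from assms(3) show ?thesis
    by cases (auto simp: fp_words_def)
qed

lemma equiv_fp_rel: "equiv (fp_words G H) (fp_rel G H)"
proof (rule equivI)
  show "refl_on (fp_words G H) (fp_rel G H)"
    by (auto simp: refl_on_def fp_rel_def)
  show "sym (fp_rel G H)"
    by (auto simp: sym_def fp_rel_def intro: equivclp_sym)
  show "trans (fp_rel G H)"
    unfolding trans_def fp_rel_def by (blast intro: equivclp_trans)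
qed (auto simp: fp_rel_def)

lemma fp_lift_class:
  fixes G :: "('a, 'c) monoid_scheme" and H :: "('b, 'd) monoid_scheme"
    and K :: "('k, 'e) monoid_scheme"
  assumes G: "group G" and H: "group H" and K: "group K"
    and f: "f \<in> hom G K" and g: "g \<in> hom H K" and w: "w \<in> fp_words G H"
  shows "fp_lift K f g (fp_rel G H `` {w}) = foldr (\<lambda>s z. case_sum f g s \<otimes>\<^bsub>K\<^esub> z) w \<one>\<^bsub>K\<^esub>"
proof -
  interpret K: group K by fact
  define ev where "ev = (\<lambda>w. foldr (\<lambda>s z. case_sum f g s \<otimes>\<^bsub>K\<^esub> z) w \<one>\<^bsub>K\<^esub>)"
  have [simp]: "ev [] = \<one>\<^bsub>K\<^esub>" "ev (s # w) = case_sum f g s \<otimes>\<^bsub>K\<^esub> ev w" for s w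
    by (simp_all add: ev_def)
  have letter: "case_sum f g s \<in> carrier K" if "s \<in> carrier G <+> carrier H" for s
    using that f g by (auto simp: hom_def)
  have ev_closed: "ev u \<in> carrier K" if "u \<in> fp_words G H" for u
    using that unfolding fp_words_def by (induction u) (auto simp: letter)
  have ev_append: "ev (u @ v) = ev u \<otimes>\<^bsub>K\<^esub> ev v"
    if "u \<in> fp_words G H" "v \<in> fp_words G H" for u v
    using that(1) ev_closed[OF that(2)] unfolding fp_words_def
    by (induction u) (auto simp: letter ev_closed fp_words_def K.m_assoc)
  have one: "f \<one>\<^bsub>G\<^esub> = \<one>\<^bsub>K\<^esub>" "g \<one>\<^bsub>H\<^esub> = \<one>\<^bsub>K\<^esub>"
    using hom_one f g G H K by metis+
  have step: "ev u = ev v" if "fp_step G H u v" "u \<in> fp_words G H" for u v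
    using that
  proof cases
    case (mult_left a b x y)
    then have "x \<in> fp_words G H" "y \<in> fp_words G H"
      "[Inl a, Inl b] @ y \<in> fp_words G H" "[Inl (a \<otimes>\<^bsub>G\<^esub> b)] @ y \<in> fp_words G H"
      using that(2) G by (auto simp: fp_words_def group.is_monoid monoid.m_closed)
    then show ?thesis
      using f mult_left ev_closed[of y] by (simp add: ev_append hom_mult hom_in_carrier K.m_assoc)
  next
    case (mult_right a b x y)
    then have "x \<in> fp_words G H" "y \<in> fp_words G H"
      "[Inr a, Inr b] @ y \<in> fp_words G H" "[Inr (a \<otimes>\<^bsub>H\<^esub> b)] @ y \<in> fp_words G H"
      using that(2) H by (auto simp: fp_words_def group.is_monoid monoid.m_closed)
    then show ?thesis
      using g mult_right ev_closed[of y] by (simp add: ev_append hom_mult hom_in_carrier K.m_assoc)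
  next
    case (one_left x y)
    then have "x \<in> fp_words G H" "y \<in> fp_words G H" "[Inl \<one>\<^bsub>G\<^esub>] @ y \<in> fp_words G H"
      using that(2) by (auto simp: fp_words_def)
    then show ?thesis
      using one_left ev_closed[of y] by (simp add: ev_append one)
  next
    case (one_right x y)
    then have "x \<in> fp_words G H" "y \<in> fp_words G H" "[Inr \<one>\<^bsub>H\<^esub>] @ y \<in> fp_words G H"
      using that(2) by (auto simp: fp_words_def)
    then show ?thesis
      using one_right ev_closed[of y] by (simp add: ev_append one)
  qed
  have "equivclp (fp_step G H) w v \<Longrightarrow> v \<in> fp_words G H \<and> ev v = ev w" for v
  proof (induction rule: equivclp_induct)
    case (step y z)
    then show ?case
      using step fp_step_words[OF G H] \<open>\<And>u v. fp_step G H u v \<Longrightarrow> u \<in> fp_words G H \<Longrightarrow> ev u = ev v\<close>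
      by metis
  qed (simp add: w)
  then have "\<And>v. v \<in> fp_rel G H `` {w} \<Longrightarrow> ev v = ev w"
    unfolding fp_rel_def by blast
  moreover have "w \<in> fp_rel G H `` {w}"
    by (rule equiv_class_self[OF equiv_fp_rel w])
  ultimately have "ev ` (fp_rel G H `` {w}) = {ev w}"
    by blast
  then show ?thesis
    by (simp add: fp_lift_def ev_def)
qed

lemma free_product_mult_class:
  assumes "group G" "group H" "u \<in> fp_words G H" "v \<in> fp_words G H"
  shows "fp_rel G H `` {u} \<otimes>\<^bsub>free_product G H\<^esub> fp_rel G H `` {v} = fp_rel G H `` {u @ v}"
proof -
  have step: "fp_step G H (x @ a @ y) (x @ b @ y)" if "fp_step G H a b" for a b x y
    using that
  proof cases
    case (mult_left c d p q)
    then show ?thesis using fp_step.mult_left[of c G d H "x @ p" "q @ y"] by simp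
  next
    case (mult_right c d p q)
    then show ?thesis using fp_step.mult_right[of c H d G "x @ p" "q @ y"] by simp
  next
    case (one_left p q)
    then show ?thesis using fp_step.one_left[of G H "x @ p" "q @ y"] by simp
  next
    case (one_right p q)
    then show ?thesis using fp_step.one_right[of G H "x @ p" "q @ y"] by simp
  qed
  have cong: "equivclp (fp_step G H) (x @ a @ y) (x @ b @ y)" if "equivclp (fp_step G H) a b" for a b x y
    using that
  proof (induction rule: equivclp_induct)
    case (step b c)
    then show ?case
      by (meson \<open>\<And>a b x y. fp_step G H a b \<Longrightarrow> fp_step G H (x @ a @ y) (x @ b @ y)\<close>
          equivclp_into_equivclp)
  qed simp
  have "(u @ v, u' @ v') \<in> fp_rel G H" if "(u, u') \<in> fp_rel G H" "(v, v') \<in> fp_rel G H" for u' v'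
  proof -
    have "equivclp (fp_step G H) (u @ v) (u' @ v)" "equivclp (fp_step G H) (u' @ v) (u' @ v')"
      using that cong[of u u' "[]" v] cong[of v v' u' "[]"] by (simp_all add: fp_rel_def)
    then have "equivclp (fp_step G H) (u @ v) (u' @ v')"
      by (rule equivclp_trans)
    then show ?thesis
      using that by (simp add: fp_rel_def fp_words_def)
  qed
  then have *: "fp_rel G H `` {u' @ v'} = fp_rel G H `` {u @ v}"
    if "u' \<in> fp_rel G H `` {u}" "v' \<in> fp_rel G H `` {v}" for u' v'
    using that equiv_class_eq[OF equiv_fp_rel] by (metis Image_singleton_iff)
  have "u \<in> fp_rel G H `` {u}" "v \<in> fp_rel G H `` {v}"
    using assms equiv_class_self[OF equiv_fp_rel] by auto
  then have "(\<Union>u'\<in>fp_rel G H `` {u}. \<Union>v'\<in>fp_rel G H `` {v}. fp_rel G H `` {u' @ v'})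
      = fp_rel G H `` {u @ v}"
    using * by blast
  then show ?thesis
    by (simp add: free_product_def)
qed

lemma partial_add:
  fixes p q :: "('a::comm_ring_1, 'v) poly_alg"
  shows "partial i (p + q) = partial i p + partial i q"
proof -
  let ?A = "Poly_Mapping.keys p \<union> Poly_Mapping.keys q"
  have *: "partial i r = (\<Sum>m\<in>?A. Poly_Mapping.single (m - Poly_Mapping.single i 1)
       (of_nat (Poly_Mapping.lookup m i) * Poly_Mapping.lookup r m))"
    if "Poly_Mapping.keys r \<subseteq> ?A" for r :: "('a, 'v) poly_alg"
    unfolding partial_def
    by (rule sum.mono_neutral_left) (use that in \<open>auto simp: in_keys_iff\<close>)
  have "Poly_Mapping.keys (p + q) \<subseteq> ?A"
    by (rule keys_add)
  then show ?thesis
    by (simp add: * lookup_add distrib_left single_add sum.distrib)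
qed

lemma coset_consts_image:
  assumes "\<And>c. T (F + const c) = T F"
  shows "the_elem (T ` (range const #>\<^bsub>add_group\<^esub> F)) = T F"
proof -
  have "T ` (range const #>\<^bsub>add_group\<^esub> F) = {T F}"
    unfolding r_coset_def add_group_def
    by (auto simp: add.commute[of _ F] assms image_UN)
  then show ?thesis by simp
qed

lemma partial_add_const:
  "partial i (F + const c) = partial i (F :: ('a::comm_ring_1, 'v) poly_alg)"
  by (simp add: partial_add) (simp add: const_def partial_single)

lemma transv_coset:
  fixes F :: "('a::comm_ring_1, 'n::finite) poly_alg"
  shows "the_elem (transv_weyl ` (range const #>\<^bsub>add_group\<^esub> F)) = transv_weyl F"
    and "the_elem (transv_poisson ` (range const #>\<^bsub>add_group\<^esub> F)) = transv_poisson F"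
  by (rule coset_consts_image;
    simp add: transv_weyl_def transv_poisson_def partial_add_const cong: sum.case_cong)+

end

theory Submission
  imports Defs "HOL-Computational_Algebra.Primes" "HOL-Computational_Algebra.Polynomial"
begin

text \<open>
  The proof is by reduction modulo a prime (Belov-Kanel and Kontsevich). Let \<open>w\<close> be a word and let
  \<open>y\<^sub>j\<close>, \<open>q\<^sub>j\<close> be the images of the \<open>j\<close>-th generators of the Weyl and the Poisson algebra. Modulo \<open>p\<close>
  the \<open>p\<close>-th powers of the generators are central in the Weyl algebra, and, in the
  representation by differential operators on polynomials, \<open>y\<^sub>j\<^sup>p\<close> acts as multiplication by \<open>q\<^sub>j\<^sup>p\<close>.
  This is preserved when a letter is appended to \<open>w\<close> by Jacobson's formula
  \<open>(a + b)\<^sup>p = a\<^sup>p + b\<^sup>p + ad(a)\<^sup>p\<^sup>-\<^sup>1(b)\<close>, valid when the \<open>ad(a)\<^sup>k(b)\<close> commute, since its last term vanishes both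
  for linear substitutions (\<open>p > 2\<close>) and for transvections (it is a \<open>p\<close>-th derivative). If all \<open>y\<^sub>j\<close> are
  the generators, then \<open>q\<^sub>j\<^sup>p = x\<^sub>j\<^sup>p\<close>, so \<open>q\<^sub>j = x\<^sub>j\<close> modulo \<open>p\<close>. Conversely, if \<open>q\<^sub>j = x\<^sub>j\<close>, comparison of leading
  symbols of \<open>p\<close>-th powers shows that \<open>y\<^sub>j\<close> is the generator modulo \<open>p\<close>. This suffices: a finitely generated
  subring of the complex numbers has, for each nonzero \<open>c\<close>, a radical ideal
  containing some prime number but not \<open>c\<close>.
\<close>

section \<open>Jacobson's formula\<close>

text \<open>In characteristic \<open>p\<close> the centre of the Weyl algebra is the polynomial ring
  in the \<open>p\<close>-th powers of the generators. An automorphism acts on it, and for a word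
  this action is the Poisson word with all coefficients raised to the power \<open>p\<close>.
  Radicality of the ideal undoes this Frobenius twist.

  The operators act on polynomials in all \<open>2 n\<close> variables: they are left
  multiplications on the Weyl algebra, written in the basis of ordered monomials. There
  \<open>wvar (Inr i)\<close> becomes \<open>deriv_op (Inl i) + mult_op (pvar (Inr i))\<close>,
  whose \<open>p\<close>-th power is multiplication by \<open>pvar (Inr i) ^ p\<close> modulo
  \<open>p\<close>. On polynomials in \<open>n\<close> variables the \<open>p\<close>-th power of
  the bare derivation would vanish modulo \<open>p\<close>, and the variable would be lost.

  The prime varies while the coefficient type is fixed, so reduction is expressed by congruences
  modulo an ideal \<open>I\<close> of a subring \<open>S\<close>, both given as sets. Adjoining 1/2
  to the coefficients excludes the prime 2, for which the last term of Jacobson's formula is the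
  commutator itself, a scalar that need not vanish.\<close>

lemma of_nat_left_commute: "x * (of_nat k * y) = of_nat k * (x * y :: 'r::semiring_1)"
  by (metis mult.assoc mult_of_nat_commute)

locale unital_subring =
  fixes S :: "'r::ring_1 set"
  assumes one_mem: "1 \<in> S"
    and diff_mem: "a \<in> S \<Longrightarrow> b \<in> S \<Longrightarrow> a - b \<in> S"
    and mult_mem: "a \<in> S \<Longrightarrow> b \<in> S \<Longrightarrow> a * b \<in> S"
begin

lemma zero_mem: "0 \<in> S"
  using diff_mem[OF one_mem one_mem] by simp

lemma uminus_mem: "a \<in> S \<Longrightarrow> - a \<in> S"
  using diff_mem[OF zero_mem, of a] by simp

lemma add_mem: "a \<in> S \<Longrightarrow> b \<in> S \<Longrightarrow> a + b \<in> S"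
  using diff_mem[of a "- b"] uminus_mem by simp

lemma sum_mem: "(\<And>x. x \<in> A \<Longrightarrow> f x \<in> S) \<Longrightarrow> sum f A \<in> S"
  by (induction A rule: infinite_finite_induct) (auto simp: zero_mem add_mem)

lemma power_mem: "a \<in> S \<Longrightarrow> a ^ k \<in> S"
  by (induction k) (auto simp: one_mem mult_mem)

lemma of_nat_mem: "of_nat k \<in> S"
  by (induction k) (auto simp: zero_mem one_mem add_mem)

lemma of_int_mem: "of_int k \<in> S"
  by (cases k rule: int_cases2) (auto simp: of_nat_mem uminus_mem)

end

text \<open>This serves at three levels: for scalars, for polynomials with conditions on their
  coefficients, and for operators. The last of these needs a noncommutative ring and a two-sided
  ideal.\<close>

locale char_p_reduction = unital_subring S for S :: "'r::ring_1 set" +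
  fixes I :: "'r set" and p :: nat
  assumes prime: "prime p"
    and ideal_sub: "I \<subseteq> S"
    and ideal_diff: "a \<in> I \<Longrightarrow> b \<in> I \<Longrightarrow> a - b \<in> I"
    and ideal_left: "a \<in> S \<Longrightarrow> b \<in> I \<Longrightarrow> a * b \<in> I"
    and ideal_right: "a \<in> I \<Longrightarrow> b \<in> S \<Longrightarrow> a * b \<in> I"
    and p_ideal: "of_nat p \<in> I"
begin

lemma ideal_zero: "0 \<in> I"
  using ideal_diff[OF p_ideal p_ideal] by simp

lemma ideal_uminus: "a \<in> I \<Longrightarrow> - a \<in> I"
  using ideal_diff[OF ideal_zero, of a] by simp

lemma ideal_add: "a \<in> I \<Longrightarrow> b \<in> I \<Longrightarrow> a + b \<in> I"
  using ideal_diff[of a "- b"] ideal_uminus by simp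

lemma ideal_sum: "(\<And>x. x \<in> A \<Longrightarrow> f x \<in> I) \<Longrightarrow> sum f A \<in> I"
  by (induction A rule: infinite_finite_induct) (auto simp: ideal_zero ideal_add)

lemma ideal_dvd: "p dvd k \<Longrightarrow> x \<in> S \<Longrightarrow> of_nat k * x \<in> I"
  using ideal_right[OF p_ideal] ideal_left[OF of_nat_mem]
  by (metis dvdE of_nat_mult mult.assoc mult_of_nat_commute)

lemma ideal_coprime_cancel:
  assumes "\<not> p dvd k" "of_nat k * x \<in> I" "x \<in> S"
  shows "x \<in> I"
proof -
  have "coprime (int k) (int p)"
    using assms(1) prime by (metis coprime_commute coprime_int_iff prime_imp_coprime)
  then obtain u v where "u * int k + v * int p = 1"
    using bezout_int[of "int k" "int p"] by (metis coprime_iff_gcd_eq_1)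
  then have "of_int (u * int k + v * int p) = (1 :: 'r)"
    by simp
  then have "x = of_int u * (of_nat k * x) + of_int v * (of_nat p * x)"
    by (metis distrib_right mult.assoc mult_1 of_int_add of_int_mult of_int_of_nat_eq)
  also have "\<dots> \<in> I"
    by (intro ideal_add ideal_left of_int_mem assms(2) ideal_dvd) (auto simp: assms)
  finally show ?thesis .
qed

end

text \<open>
  Partial Bell polynomials in \<open>b, D b, D (D b), \<dots>\<close>: for a derivation \<open>D\<close> with commuting iterates,
  \<open>(D + b)\<^sup>m 1\<close> is the sum over \<open>j\<close> of its parts \<open>bell D b m j\<close> of degree \<open>j\<close> in \<open>b\<close>.
\<close>

fun bell :: "('r::ring_1 \<Rightarrow> 'r) \<Rightarrow> 'r \<Rightarrow> nat \<Rightarrow> nat \<Rightarrow> 'r" where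
  "bell D b 0 0 = 1"
| "bell D b 0 (Suc j) = 0"
| "bell D b (Suc m) 0 = 0"
| "bell D b (Suc m) (Suc j) = D (bell D b m (Suc j)) + b * bell D b m j"

context
  fixes a b :: "'r::ring_1" and D :: "'r \<Rightarrow> 'r"
  defines "D \<equiv> \<lambda>x. a * x - x * a"
  assumes comm: "\<And>k l. (D ^^ k) b * (D ^^ l) b = (D ^^ l) b * (D ^^ k) b"
begin

private lemma D_simps: "D 0 = 0" "D 1 = 0" "D (x + y) = D x + D y" "D (x * y) = D x * y + x * D y"
  "D (of_nat k * x) = of_nat k * D x" "D (of_nat k) = 0" "D (x - y) = D x - D y"
  by (simp_all add: D_def algebra_simps mult_of_nat_commute)

private lemma D_sum: "D (sum f A) = (\<Sum>x\<in>A. D (f x))"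
  by (induction A rule: infinite_finite_induct) (auto simp: D_simps)

text \<open>In terms of exponential generating functions, the polynomials of degree \<open>j\<close>
  form \<open>g ^ j / j!\<close>, where \<open>g\<close> has the coefficients
  \<open>(D ^^ k) b\<close>. The identity is
  \<open>g * g ^ j / j! = (j + 1) * (g ^ (j + 1) / (j + 1)!)\<close>, written without division. For
  \<open>m = p\<close> it makes the binomial coefficients divisible by \<open>p\<close>
  visible.\<close>

lemma bell_euler:
  "of_nat (Suc j) * bell D b m (Suc j) =
    (\<Sum>k<m. of_nat (m choose Suc k) * ((D ^^ k) b * bell D b (m - Suc k) j))"
proof (induction m arbitrary: j)
  case (Suc m)
  let ?C = "\<lambda>k. of_nat (m choose Suc k) :: 'r"
  have D0: "D (bell D b l 0) = 0" for l
    by (cases l) (auto simp: D_simps)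
  \<comment> \<open>The recursion for \<open>bell\<close> at \<open>m - k = Suc (m - Suc k)\<close>
    splits each term in two. The parts with a factor \<open>b\<close> add up by the induction
    hypothesis for the preceding degree, once \<open>b\<close> is moved past
    \<open>(D ^^ k) b\<close>.\<close>
  have tail: "(\<Sum>k<m. ?C k * ((D ^^ k) b * bell D b (m - k) j)) =
    (\<Sum>k<m. ?C k * ((D ^^ k) b * D (bell D b (m - Suc k) j))) + of_nat j * (b * bell D b m j)"
  proof (cases j)
    case 0
    have "bell D b (m - k) j = 0" if "k < m" for k
      using that 0 by (cases "m - k") auto
    then show ?thesis
      using 0 by (simp add: D0)
  next
    case (Suc i)
    have *: "(D ^^ k) b * bell D b (m - k) j = (D ^^ k) b * D (bell D b (m - Suc k) j) + b * ((D ^^ k) b * bell D b (m - Suc k) i)"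
      if "k < m" for k
    proof -
      have "m - k = Suc (m - Suc k)" using that by simp
      then show ?thesis
        using comm[of k 0] mult.assoc[of "(D ^^ k) b" b] mult.assoc[of b "(D ^^ k) b"]
        by (simp add: Suc distrib_left)
    qed
    have "of_nat j * (b * bell D b m j) = b * (of_nat (Suc i) * bell D b m (Suc i))"
      unfolding Suc by (rule of_nat_left_commute[symmetric])
    also have "\<dots> = (\<Sum>k<m. ?C k * (b * ((D ^^ k) b * bell D b (m - Suc k) i)))"
      unfolding Suc.IH sum_distrib_left of_nat_left_commute ..
    finally show ?thesis
      by (simp add: * distrib_left sum.distrib)
  qed
  have "of_nat (Suc j) * bell D b (Suc m) (Suc j) = D (of_nat (Suc j) * bell D b m (Suc j))
      + b * bell D b m j + of_nat j * (b * bell D b m j)"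
    by (simp add: D_simps algebra_simps)
  also have "D (of_nat (Suc j) * bell D b m (Suc j)) = 
      (\<Sum>k<m. ?C k * ((D ^^ Suc k) b * bell D b (m - Suc k) j)) +
      (\<Sum>k<m. ?C k * ((D ^^ k) b * D (bell D b (m - Suc k) j)))"
    unfolding Suc.IH D_sum by (simp add: D_simps distrib_left sum.distrib)
  also have "(\<Sum>k<m. ?C k * ((D ^^ Suc k) b * bell D b (m - Suc k) j)) +
      (\<Sum>k<m. ?C k * ((D ^^ k) b * D (bell D b (m - Suc k) j))) + b * bell D b m j + of_nat j * (b * bell D b m j)
    = (b * bell D b m j + (\<Sum>k<m. ?C k * ((D ^^ Suc k) b * bell D b (m - Suc k) j)))
      + (\<Sum>k<m. ?C k * ((D ^^ k) b * bell D b (m - k) j))"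
    unfolding tail by (simp add: algebra_simps)
  \<comment> \<open>Both sums are brought to the range \<open>k < Suc m\<close>, the first by
    absorbing the term \<open>k = 0\<close> in an index shift, the second by a vanishing binomial
    coefficient. Pascal's rule then merges them.\<close>
  also have "b * bell D b m j + (\<Sum>k<m. ?C k * ((D ^^ Suc k) b * bell D b (m - Suc k) j)) =
      (\<Sum>k<Suc m. of_nat (m choose k) * ((D ^^ k) b * bell D b (m - k) j))"
    unfolding sum.lessThan_Suc_shift by simp
  also have "(\<Sum>k<m. ?C k * ((D ^^ k) b * bell D b (m - k) j)) = (\<Sum>k<Suc m. ?C k * ((D ^^ k) b * bell D b (m - k) j))"
    by (simp add: binomial_eq_0)
  finally show ?case
    by (simp add: distrib_right sum.distrib del: sum.lessThan_Suc)
qed simp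

lemma bell_eq_0: "m < j \<Longrightarrow> bell D b m j = 0"
proof (induction m arbitrary: j)
  case 0 then show ?case by (cases j) auto
next
  case (Suc m) then show ?case by (cases j) (auto simp: D_simps)
qed

lemma bell_diag: "bell D b m m = b ^ m"
  by (induction m) (auto simp: bell_eq_0 D_simps)

text \<open>Left multiplication by \<open>a + b\<close> is the sum of right multiplication by
  \<open>a\<close> and of the operator \<open>D + b\<close>. These two commute because
  \<open>D a = 0\<close>, so this is the binomial theorem for them, applied to 1.\<close>

lemma add_power_bell:
  "(a + b) ^ m = (\<Sum>k\<le>m. of_nat (m choose k) * ((\<Sum>j\<le>m - k. bell D b (m - k) j) * a ^ k))"
proof (induction m)
  case (Suc m)
  define e where "e = (\<lambda>m. \<Sum>j\<le>m. bell D b m j)"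
  have e_Suc: "D (e m) + b * e m = e (Suc m)" for m
  proof -
    have "e (Suc m) = (\<Sum>j\<le>m. D (bell D b m (Suc j))) + b * e m"
      unfolding e_def sum.atMost_Suc_shift by (simp add: sum.distrib sum_distrib_left)
    also have "(\<Sum>j\<le>m. D (bell D b m (Suc j))) = (\<Sum>j\<le>Suc m. D (bell D b m j))"
      unfolding sum.atMost_Suc_shift by (cases m) (auto simp: D_simps)
    also have "\<dots> = D (e m)"
      by (simp add: e_def D_sum bell_eq_0 D_simps)
    finally show ?thesis by simp
  qed
  have shift: "(a + b) * (e l * a ^ k) = e l * a ^ Suc k + e (Suc l) * a ^ k" for l k
  proof -
    have "(a + b) * e l = e l * a + e (Suc l)"
      unfolding e_Suc[symmetric] D_def by (simp add: distrib_right)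
    then have "(a + b) * e l * a ^ k = (e l * a + e (Suc l)) * a ^ k"
      by (rule arg_cong)
    then show ?thesis
      by (simp only: distrib_right[of _ _ "a ^ k"] mult.assoc power_Suc)
  qed
  have "(a + b) ^ Suc m = (\<Sum>k\<le>m. of_nat (m choose k) * ((a + b) * (e (m - k) * a ^ k)))"
    by (simp add: Suc sum_distrib_left e_def of_nat_left_commute)
  also have "\<dots> = (\<Sum>k\<le>m. of_nat (m choose k) * (e (m - k) * a ^ Suc k))
      + (\<Sum>k\<le>m. of_nat (m choose k) * (e (Suc m - k) * a ^ k))"
    by (simp add: shift distrib_left sum.distrib Suc_diff_le del: power_Suc)
  also have "(\<Sum>k\<le>m. of_nat (m choose k) * (e (Suc m - k) * a ^ k))
      = (\<Sum>k\<le>Suc m. of_nat (m choose k) * (e (Suc m - k) * a ^ k))"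
    by (simp add: binomial_eq_0)
  also have "\<dots> = e (Suc m) + (\<Sum>k\<le>m. of_nat (m choose Suc k) * (e (m - k) * a ^ Suc k))"
    unfolding sum.atMost_Suc_shift by (simp add: binomial_eq_0)
  finally have "(a + b) ^ Suc m = e (Suc m) + (\<Sum>k\<le>m. of_nat (Suc m choose Suc k) * (e (m - k) * a ^ Suc k))"
    by (simp add: distrib_right sum.distrib add_ac)
  then show ?case
    unfolding sum.atMost_Suc_shift by (simp add: e_def)
qed simp

end

section \<open>Jacobson's formula and additivity of Frobenius modulo \<open>p\<close>\<close>

context char_p_reduction
begin

text \<open>In \<open>add_power_bell\<close> for \<open>m = p\<close> the terms with
  \<open>0 < k < p\<close> have binomial coefficients divisible by \<open>p\<close>. The term
  \<open>k = p\<close> is \<open>a ^ p\<close>, and \<open>k = 0\<close> is the sum of all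
  \<open>bell D b p j\<close>. Of these, \<open>j = 1\<close> gives the iterated commutator and
  \<open>j = p\<close> gives \<open>b ^ p\<close>. For \<open>1 < j < p\<close>,
  \<open>bell_euler\<close> puts \<open>j\<close> times the polynomial into \<open>I\<close>, and
  \<open>j\<close> can be cancelled modulo \<open>p\<close>.\<close>

theorem jacobson_power:
  fixes a b :: 'r
  defines "D \<equiv> \<lambda>x. a * x - x * a"
  assumes mem: "a \<in> S" "b \<in> S"
    and comm: "\<And>k l. (D ^^ k) b * (D ^^ l) b = (D ^^ l) b * (D ^^ k) b"
  shows "(a + b) ^ p - (a ^ p + b ^ p + (D ^^ (p - 1)) b) \<in> I"
proof -
  note comm = comm[unfolded D_def]
  let ?c = "bell D b"
  have p2: "p \<ge> 2" using prime prime_ge_2_nat by blast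
  have D_mem: "D x \<in> S" if "x \<in> S" for x
    using that mem by (simp add: D_def diff_mem mult_mem)
  have Dk_mem: "(D ^^ k) b \<in> S" for k
    by (induction k) (auto simp: mem D_mem)
  have c_mem: "?c m j \<in> S" for m j
    by (induction m arbitrary: j; case_tac j) (auto simp: one_mem zero_mem D_mem mem mult_mem add_mem)
  have c1: "?c p 1 = (D ^^ (p - 1)) b"
  proof -
    have "?c p 1 = (\<Sum>k<p. of_nat (p choose Suc k) * ((D ^^ k) b * ?c (p - Suc k) 0))"
      using bell_euler[OF comm, of 0 p] by (simp add: D_def)
    also have "\<dots> = (\<Sum>k<p. if k = p - 1 then (D ^^ k) b else 0)"
    proof (intro sum.cong refl)
      fix k assume "k \<in> {..<p}"
      then consider "k = p - 1" | i where "p - Suc k = Suc i"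
        by (metis Suc_diff_Suc Suc_lessI diff_Suc_1 lessThan_iff)
      then show "of_nat (p choose Suc k) * ((D ^^ k) b * ?c (p - Suc k) 0) = (if k = p - 1 then (D ^^ k) b else 0)"
        using p2 by cases auto
    qed
    finally show ?thesis using p2 by simp
  qed
  have cj: "?c p j \<in> I" if "1 < j" "j < p" for j
  proof -
    obtain i where i: "j = Suc i" "i > 0" by (rule that[of "j - 1"]) (use \<open>1 < j\<close> in auto)
    have "of_nat (p choose Suc k) * ((D ^^ k) b * ?c (p - Suc k) i) \<in> I" if "k < p" for k
    proof (cases "Suc k = p")
      case True
      then show ?thesis using i by (cases i) (auto simp: ideal_zero)
    next
      case False
      then have "p dvd (p choose Suc k)"
        using that prime by (intro dvd_choose_prime) auto
      then show ?thesis
        by (intro ideal_dvd mult_mem c_mem Dk_mem)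
    qed
    then have "of_nat j * ?c p j \<in> I"
      using bell_euler[OF comm, of i p] i by (auto intro!: ideal_sum simp flip: D_def simp del: of_nat_Suc)
    moreover have "\<not> p dvd j" using that by (auto dest: dvd_imp_le)
    ultimately show ?thesis by (blast intro: ideal_coprime_cancel c_mem)
  qed
  have "(\<Sum>j\<le>p. ?c p j) - (b ^ p + (D ^^ (p - 1)) b) = (\<Sum>j\<in>{1<..<p}. ?c p j)"
  proof -
    have set: "{..p} = insert 0 (insert 1 (insert p {1<..<p}))" using p2 by auto
    have "?c p 0 = 0" using p2 by (cases p) auto
    moreover have "?c p p = b ^ p" using bell_diag[OF comm] by (simp add: D_def)
    ultimately show ?thesis
      unfolding set using p2 c1 by simp
  qed
  then have e: "(\<Sum>j\<le>p. ?c p j) - (b ^ p + (D ^^ (p - 1)) b) \<in> I"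
    by (auto intro!: ideal_sum cj)
  let ?t = "\<lambda>k. of_nat (p choose k) * ((\<Sum>j\<le>p - k. ?c (p - k) j) * a ^ k)"
  have "?t k \<in> I" if "0 < k" "k < p" for k
  proof -
    have "p dvd (p choose k)"
        using that prime by (intro dvd_choose_prime) auto
    then show ?thesis
      by (intro ideal_dvd mult_mem sum_mem c_mem power_mem mem)
  qed
  then have t: "sum ?t {0<..<p} \<in> I"
    by (intro ideal_sum) auto
  have "(a + b) ^ p = sum ?t {..p}"
    using add_power_bell[OF comm] by (simp add: D_def)
  also have "{..p} = insert 0 (insert p {0<..<p})" using p2 by auto
  also have "sum ?t (insert 0 (insert p {0<..<p})) = (\<Sum>j\<le>p. ?c p j) + a ^ p + sum ?t {0<..<p}"
    using p2 by simp
  finally have "(a + b) ^ p - (a ^ p + b ^ p + (D ^^ (p - 1)) b) =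
     ((\<Sum>j\<le>p. ?c p j) - (b ^ p + (D ^^ (p - 1)) b)) + sum ?t {0<..<p}"
    by (simp add: algebra_simps)
  then show ?thesis
    using ideal_add[OF e t] by presburger
qed

lemma frobenius_add:
  assumes "a \<in> S" "b \<in> S" "a * b = b * a"
  shows "(a + b) ^ p - (a ^ p + b ^ p) \<in> I"
proof -
  let ?D = "\<lambda>x. a * x - x * a"
  have D: "(?D ^^ k) b = 0" if "k > 0" for k
  proof -
    have "(?D ^^ Suc l) b = 0" for l
      by (induction l) (auto simp: assms(3))
    then show ?thesis using that by (cases k) auto
  qed
  have "(?D ^^ k) b * (?D ^^ l) b = (?D ^^ l) b * (?D ^^ k) b" for k l
    using D[of k] D[of l] by (cases "k = 0"; cases "l = 0") auto
  from jacobson_power[OF assms(1,2) this] show ?thesis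
    using D[of "p - 1"] prime_gt_1_nat[OF prime] by simp
qed

end

section \<open>Residue characteristics of finitely generated rings\<close>

definition adjoin :: "'a::comm_ring_1 set \<Rightarrow> 'a \<Rightarrow> 'a set" where
  "adjoin A t = {poly f t |f. \<forall>i. coeff f i \<in> A}"

lemma adjoin_self: "unital_subring A \<Longrightarrow> t \<in> adjoin A t"
  unfolding adjoin_def
  by (intro CollectI exI[of _ "[:0, 1:]"])
    (auto simp: coeff_pCons split: nat.splits intro: unital_subring.zero_mem unital_subring.one_mem)

lemma adjoin_base: "unital_subring A \<Longrightarrow> A \<subseteq> adjoin A t"
  unfolding adjoin_def
  by (intro subsetI CollectI exI[of _ "[:_:]"])
    (auto simp: coeff_pCons split: nat.splits intro: unital_subring.zero_mem)

lemma unital_subring_adjoin: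
  assumes "unital_subring A"
  shows "unital_subring (adjoin A t)"
proof -
  interpret unital_subring A by fact
  show ?thesis
  proof
    show "1 \<in> adjoin A t"
      using adjoin_base[OF assms] one_mem by blast
    fix a b assume "a \<in> adjoin A t" "b \<in> adjoin A t"
    then obtain f g where fg: "a = poly f t" "b = poly g t" "\<forall>i. coeff f i \<in> A" "\<forall>i. coeff g i \<in> A"
      by (auto simp: adjoin_def)
    then show "a - b \<in> adjoin A t"
      unfolding adjoin_def by (auto intro!: exI[of _ "f - g"] diff_mem)
    show "a * b \<in> adjoin A t"
      using fg unfolding adjoin_def
      by (auto intro!: exI[of _ "f * g"] sum_mem mult_mem simp: coeff_mult)
  qed
qed

definition pseudo_remainder_in :: "'a::idom set \<Rightarrow> 'a poly \<Rightarrow> 'a poly \<Rightarrow> nat \<Rightarrow> 'a poly \<Rightarrow> 'a poly \<Rightarrow> bool" where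
  "pseudo_remainder_in A g f k q r \<longleftrightarrow> (\<forall>i. coeff q i \<in> A) \<and> (\<forall>i. coeff r i \<in> A) \<and>
     smult (lead_coeff g ^ k) f = q * g + r \<and> degree r < degree g"

text \<open>Long division in which every step multiplies the dividend by the leading coefficient of
  \<open>g\<close> instead of dividing by it. This is where the power \<open>k\<close> comes from,
  and it keeps all coefficients in \<open>A\<close>.\<close>

lemma pseudo_division_in:
  fixes f g :: "'a::idom poly"
  assumes A: "unital_subring A" and g: "\<And>i. coeff g i \<in> A" "degree g > 0"
    and f: "\<And>i. coeff f i \<in> A"
  shows "\<exists>k q r. pseudo_remainder_in A g f k q r"
  using f
proof (induction "degree f" arbitrary: f rule: less_induct)
  case less
  interpret unital_subring A by fact
  show ?case
  proof (cases "degree f < degree g")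
    case True
    then have "pseudo_remainder_in A g f 0 0 f"
      using less.prems by (auto simp: pseudo_remainder_in_def zero_mem)
    then show ?thesis by blast
  next
    case False
    define a where "a = lead_coeff g"
    define h where "h = monom (lead_coeff f) (degree f - degree g)"
    define f' where "f' = smult a f - h * g"
    have h: "coeff h i \<in> A" for i
      using less.prems by (auto simp: h_def zero_mem)
    have f': "coeff f' i \<in> A" for i
      using less.prems g h by (auto simp: f'_def a_def coeff_mult intro!: diff_mem mult_mem sum_mem)
    have "degree (h * g) \<le> degree f"
      using False degree_mult_le[of h g] degree_monom_le[of "lead_coeff f" "degree f - degree g"]
      unfolding h_def by linarith
    then have "degree f' \<le> degree f"
      unfolding f'_def by (intro degree_diff_le degree_smult_le)
    moreover have "coeff f' (degree f) = 0"
      using False by (simp add: f'_def h_def a_def coeff_monom_mult)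
    ultimately have "degree f' < degree f"
      using False g(2) eq_zero_or_degree_less[of f' "degree f"] by auto
    from less.hyps[OF this f'] obtain k q r where IH: "pseudo_remainder_in A g f' k q r"
      by blast
    have "smult (a ^ Suc k) f = smult (a ^ k) f' + smult (a ^ k) h * g"
      by (simp add: f'_def smult_diff_right mult.commute)
    also have "smult (a ^ k) f' = q * g + r"
      using IH by (simp add: pseudo_remainder_in_def a_def)
    finally have "smult (a ^ Suc k) f = (q + smult (a ^ k) h) * g + r"
      by (simp add: algebra_simps)
    then have "pseudo_remainder_in A g f (Suc k) (q + smult (a ^ k) h) r"
      using IH h g(1) unfolding pseudo_remainder_in_def a_def
      by (auto intro!: add_mem mult_mem power_mem)
    then show ?thesis by blast
  qed
qed

text \<open>For every nonzero \<open>b \<in> A\<close>, some prime \<open>p\<close> is not invertible in \<open>A[1/b]\<close>.\<close>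

definition prime_avoiding :: "'a::comm_ring_1 set \<Rightarrow> bool" where
  "prime_avoiding A \<longleftrightarrow>
     (\<forall>b\<in>A. b \<noteq> 0 \<longrightarrow> (\<exists>p. prime p \<and> (\<forall>N. \<forall>x\<in>A. b ^ N \<noteq> of_nat p * x)))"

lemma prime_avoiding_Ints: "prime_avoiding (\<int> :: 'a::{idom, ring_char_0} set)"
  unfolding prime_avoiding_def
proof (intro ballI impI)
  fix b :: 'a assume "b \<in> \<int>" "b \<noteq> 0"
  then obtain z where z: "b = of_int z" "z \<noteq> 0"
    by (auto elim: Ints_cases)
  \<comment> \<open>A prime larger than the absolute value of \<open>z\<close> divides no power of
    \<open>z\<close>.\<close>
  obtain p where p: "prime p" "nat \<bar>z\<bar> < p"
    using bigger_prime by blast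
  have "b ^ N \<noteq> of_nat p * x" if "x \<in> \<int>" for N x
  proof
    assume eq: "b ^ N = of_nat p * x"
    obtain y where "x = of_int y" using \<open>x \<in> \<int>\<close> by (rule Ints_cases)
    then have "of_int (z ^ N) = (of_int (int p * y) :: 'a)"
      using eq z by simp
    then have "int p dvd z ^ N"
      unfolding of_int_eq_iff by simp
    then have "int p dvd z"
      using p(1) prime_dvd_power[of "int p" z N] by simp
    then show False
      using z(2) p(2) dvd_imp_le_int[of z "int p"] by auto
  qed
  then show "\<exists>p. prime p \<and> (\<forall>N. \<forall>x\<in>\<int>. b ^ N \<noteq> of_nat p * x)"
    using p(1) by blast
qed

text \<open>A prime for the leading coefficient of \<open>f\<close> also works for
  \<open>b = poly f t\<close>: since \<open>t\<close> satisfies no relation over \<open>A\<close>,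
  an equation \<open>b ^ N = of_nat p * x\<close> lifts to polynomials, and leading coefficients can
  be compared.\<close>

lemma prime_avoiding_transcendental:
  fixes A :: "'a::field_char_0 set"
  assumes A: "unital_subring A" "prime_avoiding A"
    and t: "\<And>f. (\<And>i. coeff f i \<in> A) \<Longrightarrow> poly f t = 0 \<Longrightarrow> f = 0"
  shows "prime_avoiding (adjoin A t)"
  unfolding prime_avoiding_def
proof (intro ballI impI)
  interpret unital_subring A by fact
  fix b assume "b \<in> adjoin A t" "b \<noteq> 0"
  then obtain f where "b = poly f t" "\<forall>i. coeff f i \<in> A"
    by (auto simp: adjoin_def)
  with \<open>b \<noteq> 0\<close> have f: "b = poly f t" "\<And>i. coeff f i \<in> A" "f \<noteq> 0"
    by auto
  then obtain p where p: "prime p" "\<And>N x. x \<in> A \<Longrightarrow> lead_coeff f ^ N \<noteq> of_nat p * x"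
    using A(2) unfolding prime_avoiding_def by (metis leading_coeff_0_iff)
  have "b ^ N \<noteq> of_nat p * x" if x: "x \<in> adjoin A t" for N x
  proof
    assume eq: "b ^ N = of_nat p * x"
    obtain g where g: "x = poly g t" "\<And>i. coeff g i \<in> A"
      using x by (auto simp: adjoin_def)
    have fN: "coeff (f ^ N) i \<in> A" for i
      by (induction N arbitrary: i) (auto simp: coeff_mult f one_mem zero_mem intro!: sum_mem mult_mem)
    have "f ^ N - smult (of_nat p) g = 0"
      by (rule t) (use eq f(1) g fN in \<open>auto intro!: diff_mem mult_mem of_nat_mem\<close>)
    then have "coeff (f ^ N) (degree (f ^ N)) = of_nat p * coeff g (degree (f ^ N))"
      by (simp add: eq_iff_diff_eq_0[symmetric])
    then show False
      using p(2)[OF g(2)] by (simp add: lead_coeff_power)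
  qed
  then show "\<exists>p. prime p \<and> (\<forall>N. \<forall>x\<in>adjoin A t. b ^ N \<noteq> of_nat p * x)"
    using p(1) by blast
qed

text \<open>The question is moved from \<open>b\<close> to the element \<open>a * (b * e)\<close> of
  \<open>A\<close>, where \<open>a\<close> is the leading coefficient of a relation of least degree
  for \<open>t\<close> and \<open>b * e\<close> is a nonzero multiple of \<open>b\<close> in
  \<open>A\<close>. Below that degree the powers of \<open>t\<close> are independent over
  \<open>A\<close>, so an equation in \<open>adjoin A t\<close> can be read off in degree 0.\<close>

lemma prime_avoiding_algebraic:
  fixes A :: "'a::field_char_0 set"
  assumes A: "unital_subring A" "prime_avoiding A"
    and t: "\<exists>f. (\<forall>i. coeff f i \<in> A) \<and> poly f t = 0 \<and> f \<noteq> 0"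
  shows "prime_avoiding (adjoin A t)"
  unfolding prime_avoiding_def
proof (intro ballI impI)
  interpret unital_subring A by fact
  interpret At: unital_subring "adjoin A t" by (rule unital_subring_adjoin) fact
  define rel where "rel = (\<lambda>f. (\<forall>i. coeff f i \<in> A) \<and> poly f t = 0 \<and> f \<noteq> 0)"
  obtain \<mu> where "rel \<mu>" and min: "\<And>f. degree f < degree \<mu> \<Longrightarrow> \<not> rel f"
    using exists_least_iff[of "\<lambda>d. \<exists>f. rel f \<and> degree f = d"] t unfolding rel_def by metis
  then have \<mu>: "\<And>i. coeff \<mu> i \<in> A" "poly \<mu> t = 0" "\<mu> \<noteq> 0"
    by (auto simp: rel_def)
  have vanish: "f = 0" if "\<And>i. coeff f i \<in> A" "poly f t = 0" "degree f < degree \<mu>" for f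
    using min[OF that(3)] that by (auto simp: rel_def)
  have d: "degree \<mu> > 0"
    using \<mu>(2,3) by (metis degree_eq_zeroE gr0I mult_zero_right pCons_0_0 poly_0 poly_pCons add.right_neutral)
  define a where "a = lead_coeff \<mu>"
  have a: "a \<in> A" "a \<noteq> 0"
    using \<mu> by (auto simp: a_def)
  have reduce: "\<exists>k r. (\<forall>i. coeff r i \<in> A) \<and> degree r < degree \<mu> \<and> a ^ k * x = poly r t"
    if "x \<in> adjoin A t" for x
  proof -
    obtain f where f: "x = poly f t" "\<And>i. coeff f i \<in> A"
      using \<open>x \<in> adjoin A t\<close> unfolding adjoin_def by blast
    obtain k q r where "pseudo_remainder_in A \<mu> f k q r"
      using pseudo_division_in[OF A(1) \<mu>(1) d f(2)] by blast
    then have *: "smult (a ^ k) f = q * \<mu> + r" "\<forall>i. coeff r i \<in> A" "degree r < degree \<mu>"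
      by (auto simp: pseudo_remainder_in_def a_def)
    have "a ^ k * x = poly r t"
      using arg_cong[OF *(1), of "\<lambda>f. poly f t"] by (simp add: f \<mu>)
    then show ?thesis using * by blast
  qed
  fix b assume b: "b \<in> adjoin A t" "b \<noteq> 0"
  \<comment> \<open>Among the polynomials whose value at \<open>t\<close> is a nonzero multiple of
    \<open>b\<close>, take \<open>g\<close> of least degree. If \<open>g\<close> were not constant,
    pseudo-division of \<open>\<mu>\<close> by \<open>g\<close> would leave a remainder of smaller
    degree whose value is again a multiple of \<open>b\<close>, hence 0. The quotient would then be
    a nonzero relation for \<open>t\<close> of degree less than that of
    \<open>\<mu>\<close>.\<close>
  have "\<exists>e\<in>adjoin A t. b * e \<in> A \<and> b * e \<noteq> 0"
  proof -
    define mult where "mult = (\<lambda>g. (\<forall>i. coeff g i \<in> A) \<and> poly g t \<noteq> 0 \<and> (\<exists>e\<in>adjoin A t. poly g t = b * e))"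
    obtain f where f: "b = poly f t" "\<And>i. coeff f i \<in> A"
      using b by (auto simp: adjoin_def)
    then have "mult f"
      using b At.one_mem by (auto simp: mult_def)
    then obtain g where "mult g" and gmin: "\<And>f. degree f < degree g \<Longrightarrow> \<not> mult f"
      using exists_least_iff[of "\<lambda>d. \<exists>f. mult f \<and> degree f = d"] by metis
    then obtain e where g: "\<And>i. coeff g i \<in> A" "poly g t \<noteq> 0" "e \<in> adjoin A t" "poly g t = b * e"
      by (auto simp: mult_def)
    have gd: "degree g < degree \<mu>"
    proof -
      have "poly g t \<in> adjoin A t"
        using g(1) by (auto simp: adjoin_def)
      from reduce[OF this] obtain k r where r: "\<forall>i. coeff r i \<in> A" "degree r < degree \<mu>" "a ^ k * poly g t = poly r t"
        by blast
      have "poly r t = b * (a ^ k * e)"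
        using r(3) g(4) by (simp add: algebra_simps)
      moreover have "a ^ k * e \<in> adjoin A t"
        using adjoin_base[OF A(1)] a(1) by (intro At.mult_mem At.power_mem g) auto
      moreover have "poly r t \<noteq> 0"
        using r(3) a(2) g(2) by (metis mult_eq_0_iff power_not_zero)
      ultimately have "mult r"
        using r(1) by (auto simp: mult_def)
      then show ?thesis
        using gmin r(2) by (meson leI less_le_trans)
    qed
    have "degree g = 0"
    proof (rule ccontr)
      assume "degree g \<noteq> 0"
      then have g0: "degree g > 0" by simp
      obtain k q r where "pseudo_remainder_in A g \<mu> k q r"
        using pseudo_division_in[OF A(1) g(1) g0 \<mu>(1)] by blast
      then have *: "smult (lead_coeff g ^ k) \<mu> = q * g + r" "\<forall>i. coeff r i \<in> A" "\<forall>i. coeff q i \<in> A" "degree r < degree g"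
        by (auto simp: pseudo_remainder_in_def)
      have qg: "poly q t * poly g t + poly r t = 0"
        using arg_cong[OF *(1), of "\<lambda>f. poly f t"] by (simp add: \<mu>)
      then have "poly r t = b * (- poly q t * e)"
        using g(4) by (simp add: eq_neg_iff_add_eq_0 algebra_simps)
      moreover have "- poly q t * e \<in> adjoin A t"
        using *(3) g(3) by (intro At.mult_mem At.uminus_mem) (auto simp: adjoin_def)
      ultimately have "poly r t = 0"
        using gmin[OF *(4)] *(2) by (auto simp: mult_def)
      then have "poly q t = 0"
        using qg g(2) by simp
      moreover have "lead_coeff g \<noteq> 0" using g(2) by auto
      have "q * g = smult (lead_coeff g ^ k) \<mu> + (- r)"
        using *(1) by simp
      then have "degree (q * g) = degree \<mu>"
        using \<open>lead_coeff g \<noteq> 0\<close> *(4) gd by (simp only:) (subst degree_add_eq_left; simp)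
      then have "degree q < degree \<mu>" "q \<noteq> 0"
        using d g0 by (auto simp: degree_mult_eq_0 degree_mult_eq) (cases "q = 0"; cases "g = 0"; simp add: degree_mult_eq)
      ultimately show False
        using vanish[of q] *(3) by auto
    qed
    then obtain c where "g = [:c:]"
      by (rule degree_eq_zeroE)
    then have "poly g t \<in> A"
      using g(1)[of 0] by simp
    then show ?thesis
      using g by (metis)
  qed
  then obtain e where e: "e \<in> adjoin A t" "b * e \<in> A" "b * e \<noteq> 0"
    by blast
  then have "a * (b * e) \<in> A" "a * (b * e) \<noteq> 0"
    using a by (auto intro: mult_mem)
  then obtain p where p: "prime p" "\<And>N x. x \<in> A \<Longrightarrow> (a * (b * e)) ^ N \<noteq> of_nat p * x"
    using A(2) unfolding prime_avoiding_def by blast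
  have "b ^ N \<noteq> of_nat p * x" if x: "x \<in> adjoin A t" for N x
  proof
    assume eq: "b ^ N = of_nat p * x"
    obtain k r where r: "\<forall>i. coeff r i \<in> A" "degree r < degree \<mu>" "a ^ k * (x * e ^ N) = poly r t"
      using reduce[of "x * e ^ N"] x e(1) At.mult_mem At.power_mem by blast
    define c where "c = a ^ k * (b * e) ^ N"
    have c: "c \<in> A"
      using a e by (auto simp: c_def intro!: mult_mem[of "a ^ k"] power_mem)
    have "[:c:] - smult (of_nat p) r = 0"
    proof (rule vanish)
      show "coeff ([:c:] - smult (of_nat p) r) i \<in> A" for i
        using c r(1) by (auto simp: coeff_pCons split: nat.splits intro!: diff_mem mult_mem of_nat_mem zero_mem uminus_mem)
      have "c = of_nat p * poly r t"
        unfolding r(3)[symmetric] c_def by (simp add: power_mult_distrib eq)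
      then show "poly ([:c:] - smult (of_nat p) r) t = 0"
        by simp
      show "degree ([:c:] - smult (of_nat p) r) < degree \<mu>"
        using d r(2) p(1) by (intro degree_diff_less) (auto simp: prime_gt_0_nat)
    qed
    then have "c = of_nat p * coeff r 0"
      by (metis coeff_pCons_0 coeff_smult eq_iff_diff_eq_0)
    \<comment> \<open>The exponents of \<open>a\<close> and of \<open>b * e\<close> in
      \<open>c\<close> differ; multiplying by \<open>a ^ N * (b * e) ^ k\<close> makes both equal to
      \<open>k + N\<close>.\<close>
    then have "(a * (b * e)) ^ (k + N) = of_nat p * (coeff r 0 * a ^ N * (b * e) ^ k)"
      unfolding power_mult_distrib[of a] power_add c_def by (simp add: algebra_simps)
    moreover have "coeff r 0 * a ^ N * (b * e) ^ k \<in> A"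
      using a e r(1) by (auto intro!: mult_mem[of "coeff r 0 * a ^ N"] mult_mem[of "coeff r 0"] power_mem)
    ultimately show False
      using p(2) by blast
  qed
  then show "\<exists>p. prime p \<and> (\<forall>N. \<forall>x\<in>adjoin A t. b ^ N \<noteq> of_nat p * x)"
    using p(1) by blast
qed

lemma exists_prime_avoiding_subring:
  fixes T :: "'a::field_char_0 set"
  assumes "finite T"
  shows "\<exists>A. unital_subring A \<and> prime_avoiding A \<and> T \<subseteq> A"
  using assms
proof induction
  case empty
  have "unital_subring (\<int> :: 'a set)"
    by unfold_locales auto
  then show ?case using prime_avoiding_Ints by blast
next
  case (insert t T)
  then obtain A where A: "unital_subring A" "prime_avoiding A" "T \<subseteq> A"
    by blast
  then have "prime_avoiding (adjoin A t)"
    using prime_avoiding_algebraic[OF A(1,2), of t] prime_avoiding_transcendental[OF A(1,2), of t] by metis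
  then show ?case
    using unital_subring_adjoin[OF A(1), of t] adjoin_self[OF A(1)] adjoin_base[OF A(1)] A(3) by blast
qed

text \<open>The ideal is the radical of \<open>p A\<close>.\<close>

lemma prime_avoiding_reduction:
  fixes A :: "'a::field_char_0 set"
  assumes A: "unital_subring A" "prime_avoiding A" and c: "c \<in> A" "c \<noteq> 0"
  shows "\<exists>I p. char_p_reduction A I p \<and> (\<forall>b\<in>A. b ^ p \<in> I \<longrightarrow> b \<in> I) \<and> c \<notin> I"
proof -
  interpret unital_subring A by fact
  obtain p where p: "prime p" "\<And>N x. x \<in> A \<Longrightarrow> c ^ N \<noteq> of_nat p * x"
    using A(2) c unfolding prime_avoiding_def by blast
  define J where "J = (*) (of_nat p) ` A"
  interpret J: char_p_reduction A J p
  proof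
    show "J \<subseteq> A" by (auto simp: J_def intro: mult_mem of_nat_mem)
    fix a b
    assume "a \<in> J" "b \<in> J"
    then show "a - b \<in> J"
      unfolding J_def by (auto simp: right_diff_distrib[symmetric] diff_mem)
  next
    fix a b
    assume "a \<in> A" "b \<in> J"
    then show "a * b \<in> J"
      unfolding J_def by (auto simp: mult.left_commute[of a] mult_mem)
  next
    fix a b
    assume "a \<in> J" "b \<in> A"
    then show "a * b \<in> J"
      unfolding J_def by (auto simp: mult.assoc mult_mem)
  qed (use p(1) one_mem in \<open>auto simp: J_def\<close>)
  \<comment> \<open>The exponents \<open>p ^ k\<close> suffice to describe the radical, and they
    make closure under addition a consequence of iterated Frobenius.\<close>
  define I where "I = {b \<in> A. \<exists>k. b ^ (p ^ k) \<in> J}"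
  have frob: "(a + b) ^ (p ^ k) - (a ^ (p ^ k) + b ^ (p ^ k)) \<in> J" if "a \<in> A" "b \<in> A" for a b k
  proof (induction k)
    case (Suc k)
    \<comment> \<open>Frobenius is applied to \<open>s + d\<close> and then to
      \<open>s = x + y\<close>. Here \<open>d\<close> is the error of the preceding stage; it lies
      in \<open>J\<close>, and so does \<open>d ^ p\<close>.\<close>
    define x y where "x = a ^ (p ^ k)" and "y = b ^ (p ^ k)"
    define s d where "s = x + y" and "d = (a + b) ^ (p ^ k) - s"
    have mem: "x \<in> A" "y \<in> A" "s \<in> A" "d \<in> J"
      using Suc.IH by (auto simp: x_def y_def s_def d_def intro!: add_mem power_mem that)
    then have "d \<in> A" using J.ideal_sub by blast
    have "(s + d) ^ p - (s ^ p + d ^ p) \<in> J" "s ^ p - (x ^ p + y ^ p) \<in> J"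
      unfolding s_def using mem \<open>d \<in> A\<close> by (auto intro!: J.frobenius_add mult.commute simp: s_def)
    moreover have "d ^ p \<in> J"
      using J.ideal_right[OF mem(4) power_mem[OF \<open>d \<in> A\<close>, of "p - 1"]] prime_gt_0_nat[OF p(1)]
      by (simp flip: power_Suc)
    ultimately have "((s + d) ^ p - (s ^ p + d ^ p)) + (s ^ p - (x ^ p + y ^ p)) + d ^ p \<in> J"
      by (intro J.ideal_add)
    also have "((s + d) ^ p - (s ^ p + d ^ p)) + (s ^ p - (x ^ p + y ^ p)) + d ^ p = (s + d) ^ p - (x ^ p + y ^ p)"
      by (simp add: algebra_simps)
    finally have "(s + d) ^ p - (x ^ p + y ^ p) \<in> J" .
    moreover have "s + d = (a + b) ^ (p ^ k)"
      by (simp add: d_def)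
    ultimately show ?case
      unfolding x_def y_def by (simp only: power_mult[symmetric] power_Suc mult.commute[of p])
  qed (auto simp: J.ideal_zero)
  have up: "b ^ (p ^ l) \<in> J" if "b ^ (p ^ k) \<in> J" "k \<le> l" "b \<in> A" for b k l
  proof -
    have "p ^ l = p ^ k * Suc (p ^ (l - k) - 1)"
      using that(2) prime_gt_0_nat[OF p(1)] by (simp flip: power_add)
    then have "b ^ (p ^ l) = b ^ (p ^ k) * (b ^ (p ^ k)) ^ (p ^ (l - k) - 1)"
      by (metis power_Suc power_mult)
    then show ?thesis
      using that by (metis J.ideal_right power_mem)
  qed
  have Imult: "a * b \<in> I" if "a \<in> A" "b \<in> I" for a b
    using that by (auto simp: I_def power_mult_distrib intro: mult_mem J.ideal_left power_mem)
  have Iadd: "a + b \<in> I" if "a \<in> I" "b \<in> I" for a b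
  proof -
    from that obtain k l where kl: "a \<in> A" "b \<in> A" "a ^ (p ^ k) \<in> J" "b ^ (p ^ l) \<in> J"
      by (auto simp: I_def)
    have "((a + b) ^ (p ^ max k l) - (a ^ (p ^ max k l) + b ^ (p ^ max k l)))
        + (a ^ (p ^ max k l) + b ^ (p ^ max k l)) \<in> J"
      by (intro J.ideal_add frob kl up[OF kl(3)] up[OF kl(4)] max.cobounded1 max.cobounded2)
    then have "(a + b) ^ (p ^ max k l) \<in> J" by (simp only: diff_add_cancel)
    then show ?thesis
      unfolding I_def using add_mem[OF kl(1,2)] by blast
  qed
  have "char_p_reduction A I p"
  proof
    fix a b assume "a \<in> I" "b \<in> I"
    then show "a - b \<in> I"
      using Iadd[of a "- 1 * b"] Imult[of "- 1" b] uminus_mem[OF one_mem] by simp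
  next
    fix a b assume "a \<in> I" "b \<in> A"
    then show "a * b \<in> I"
      using Imult[of b a] by (simp add: mult.commute)
  next
    show "of_nat p \<in> I"
      using J.p_ideal of_nat_mem by (auto simp: I_def intro!: exI[of _ 0])
  qed (use p(1) Imult in \<open>auto simp: I_def\<close>)
  moreover have "\<forall>b\<in>A. b ^ p \<in> I \<longrightarrow> b \<in> I"
  proof (intro ballI impI)
    fix b assume b: "b \<in> A" "b ^ p \<in> I"
    then obtain k where "(b ^ p) ^ (p ^ k) \<in> J" by (auto simp: I_def)
    then have "b ^ (p ^ Suc k) \<in> J" by (simp flip: power_mult)
    then show "b \<in> I" unfolding I_def using b(1) by blast
  qed
  moreover have "c \<notin> I"
    using p(2) by (auto simp: I_def J_def)
  ultimately show ?thesis by blast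
qed

section \<open>Polynomials and partial derivatives\<close>

lemma single_add_induct [case_names single add]:
  assumes "\<And>k c. P (Poly_Mapping.single k c)" and "\<And>p q. P p \<Longrightarrow> P q \<Longrightarrow> P (p + q)"
  shows "P (p :: 'k \<Rightarrow>\<^sub>0 'a::comm_monoid_add)"
proof -
  have "P (\<Sum>k\<in>A. Poly_Mapping.single k (f k))" for A and f :: "'k \<Rightarrow> 'a"
  proof (induction A rule: infinite_finite_induct)
    case (infinite A)
    then show ?case using assms(1)[of undefined 0] by simp
  next
    case empty
    then show ?case using assms(1)[of undefined 0] by simp
  qed (auto intro: assms)
  then show ?thesis
    by (subst poly_mapping_sum_single)
qed

lemma exponent_induct [case_names zero step]:
  assumes "P 0" and step: "\<And>m i. P m \<Longrightarrow> P (m + Poly_Mapping.single i 1)"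
  shows "P (m :: 'v \<Rightarrow>\<^sub>0 nat)"
proof -
  have P: "P (m + Poly_Mapping.single i k)" if "P m" for m i k
  proof (induction k)
    case (Suc k)
    then show ?case
      using step[of "m + Poly_Mapping.single i k" i]
      by (simp add: add.assoc single_add[symmetric])
  qed (simp add: that)
  have "P (\<Sum>k\<in>A. Poly_Mapping.single k (f k))" for A and f :: "'v \<Rightarrow> nat"
  proof (induction A rule: infinite_finite_induct)
    case (insert x A)
    then show ?case using P[of "\<Sum>k\<in>A. Poly_Mapping.single k (f k)" x "f x"]
      by (simp add: add.commute)
  qed (simp_all add: assms(1))
  then show ?thesis
    by (subst poly_mapping_sum_single)
qed

lemma single_eq_const_mult: "Poly_Mapping.single m c = const c * Poly_Mapping.single m (1::'a::semiring_1)"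
  by (simp add: const_def mult_single)

lemma poly_alg_induct [case_names const var add mult]:
  assumes "\<And>c. P (const c)" "\<And>i. P (pvar i)"
    "\<And>p q. P p \<Longrightarrow> P q \<Longrightarrow> P (p + q)" "\<And>p q. P p \<Longrightarrow> P q \<Longrightarrow> P (p * q)"
  shows "P (p :: ('a::comm_ring_1, 'v) poly_alg)"
proof (induction p rule: single_add_induct)
  case (single m c)
  have "P (Poly_Mapping.single m 1)"
  proof (induction m rule: exponent_induct)
    case zero
    then show ?case using assms(1)[of 1] by (simp add: const_def)
  next
    case (step m i)
    then have "P (Poly_Mapping.single m 1 * pvar i)"
      by (intro assms)
    then show ?case by (simp add: pvar_def mult_single)
  qed
  then show ?case
    by (subst single_eq_const_mult) (intro assms)
qed (rule assms)

lemma partial_zero [simp]: "partial i 0 = 0"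
  by (simp add: partial_def)

lemma partial_const [simp]: "partial i (const c :: ('a::comm_ring_1, 'v) poly_alg) = 0"
  by (simp add: const_def partial_single)

lemma partial_pvar: "partial i (pvar j :: ('a::comm_ring_1, 'v) poly_alg) = of_bool (i = j)"
  by (auto simp: pvar_def partial_single lookup_single simp flip: single_one)

lemma exponent_minus_add:
  assumes "Poly_Mapping.lookup m i > 0"
  shows "m + l - Poly_Mapping.single i 1 = (m - Poly_Mapping.single i 1) + (l :: 'v \<Rightarrow>\<^sub>0 nat)"
  using assms by (intro poly_mapping_eqI) (auto simp: lookup_add lookup_minus lookup_single when_def)

lemma partial_mult:
  fixes p q :: "('a::comm_ring_1, 'v) poly_alg"
  shows "partial i (p * q) = partial i p * q + p * partial i q"
proof (induction p rule: single_add_induct)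
  case (single m c)
  show ?case
  proof (induction q rule: single_add_induct)
    case (single l d)
    let ?e = "Poly_Mapping.single i (1 :: nat)"
    \<comment> \<open>Subtraction of exponents is truncated, so the two exponents may differ when
      \<open>i\<close> does not occur in \<open>m\<close>. The coefficient is 0 in that
      case.\<close>
    have 1: "Poly_Mapping.single (m + l - ?e) (of_nat (Poly_Mapping.lookup m i) * (c * d))
      = Poly_Mapping.single (m - ?e + l) (of_nat (Poly_Mapping.lookup m i) * (c * d))"
      by (cases "Poly_Mapping.lookup m i = 0") (simp_all add: exponent_minus_add del: One_nat_def)
    have 2: "Poly_Mapping.single (m + l - ?e) (of_nat (Poly_Mapping.lookup l i) * (c * d))
      = Poly_Mapping.single (m + (l - ?e)) (of_nat (Poly_Mapping.lookup l i) * (c * d))"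
      by (cases "Poly_Mapping.lookup l i = 0")
        (simp_all add: exponent_minus_add add.commute[of m] del: One_nat_def)
    have "partial i (Poly_Mapping.single m c * Poly_Mapping.single l d) =
      Poly_Mapping.single (m + l - ?e) (of_nat (Poly_Mapping.lookup m i) * (c * d)) +
      Poly_Mapping.single (m + l - ?e) (of_nat (Poly_Mapping.lookup l i) * (c * d))"
      by (simp add: mult_single partial_single lookup_add distrib_right single_add)
    then show ?case
      unfolding 1 2 by (simp add: mult_single partial_single ac_simps)
  qed (simp add: partial_add distrib_left)
qed (simp add: partial_add distrib_right)

lemma partial_commute:
  fixes p :: "('a::comm_ring_1, 'v) poly_alg"
  shows "partial i (partial j p) = partial j (partial i p)"
proof (induction p rule: poly_alg_induct)
  case (var k)
  then show ?case by (simp add: partial_pvar of_bool_def const_one[symmetric])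
qed (simp_all add: partial_add partial_mult)

lemma poisson_add_right: "poisson p (q + r) = poisson p q + poisson p r"
  by (simp add: poisson_def partial_add distrib_left sum.distrib)

lemma poisson_mult_right: "poisson p (q * r) = poisson p q * r + q * poisson p r"
  by (simp add: poisson_def partial_mult distrib_left sum.distrib sum_distrib_left sum_distrib_right ac_simps)

lemma omega_swap: "omega j i = - omega i j"
  by (auto simp: omega_def)

lemma const_uminus: "const (- c) = (- const c :: 'k::monoid_add \<Rightarrow>\<^sub>0 'a::ab_group_add)"
  by (simp add: const_def single_uminus)

lemma poisson_swap: "poisson q p = - poisson p q"
proof -
  have "poisson q p = (\<Sum>j\<in>UNIV. \<Sum>i\<in>UNIV. const (omega i j) * partial i q * partial j p)"
    unfolding poisson_def by (rule sum.swap)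
  also have "\<dots> = (\<Sum>j\<in>UNIV. \<Sum>i\<in>UNIV. - (const (omega j i) * partial j p * partial i q))"
    by (intro sum.cong refl) (subst omega_swap, simp add: const_uminus ac_simps)
  finally show ?thesis
    by (simp add: poisson_def sum_negf)
qed

lemma poisson_const: "poisson p (const c) = 0"
  by (simp add: poisson_def)

section \<open>Substitution of commuting families\<close>

lemma prod_list_power_add:
  fixes z :: "'v \<Rightarrow> 'b::{ring, monoid_mult}"
  assumes "\<And>i j. z i * z j = z j * z i"
  shows "prod_list (map (\<lambda>i. z i ^ (e i + f i)) vs) =
    prod_list (map (\<lambda>i. z i ^ e i) vs) * prod_list (map (\<lambda>i. z i ^ f i) vs)"
proof (induction vs)
  case (Cons k vs)
  have c: "z i ^ l * z j ^ r = z j ^ r * z i ^ l" for i j l r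
    by (intro power_commuting_commutes power_commuting_commutes[symmetric] assms)
  have "prod_list (map (\<lambda>i. z i ^ e i) us) * z k ^ l = z k ^ l * prod_list (map (\<lambda>i. z i ^ e i) us)" for us l
  proof (induction us)
    case (Cons u us)
    have "z u ^ e u * (prod_list (map (\<lambda>i. z i ^ e i) us) * z k ^ l) = z u ^ e u * (z k ^ l * prod_list (map (\<lambda>i. z i ^ e i) us))"
      by (simp only: Cons)
    then show ?case
      by (simp add: mult.assoc) (simp add: c flip: mult.assoc)
  qed simp
  then have "prod_list (map (\<lambda>i. z i ^ e i) vs) * z k ^ f k * x
      = z k ^ f k * prod_list (map (\<lambda>i. z i ^ e i) vs) * x" for x
    by simp
  then have "prod_list (map (\<lambda>i. z i ^ e i) vs) * (z k ^ f k * x)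
      = z k ^ f k * (prod_list (map (\<lambda>i. z i ^ e i) vs) * x)" for x
    by (simp only: mult.assoc)
  moreover have "z k ^ (e k + f k) = z k ^ e k * z k ^ f k"
    by (rule power_add)
  ultimately show ?case
    by (simp only: list.map prod_list.Cons Cons mult.assoc)
qed simp

lemma prod_list_power_unit:
  "distinct vs \<Longrightarrow> k \<in> set vs \<Longrightarrow>
    prod_list (map (\<lambda>i. z i ^ (1 when k = i)) vs) = (z k :: 'b::monoid_mult)"
proof (induction vs)
  case (Cons i vs)
  have "prod_list (map (\<lambda>i. z i ^ (1 when k = i)) us) = 1" if "k \<notin> set us" for us
    using that by (induction us) auto
  then show ?case
    using Cons by (cases "i = k") auto
qed simp

locale central_scalars =
  fixes \<iota> :: "'a::comm_ring_1 \<Rightarrow> 'b::{ring, monoid_mult}"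
  assumes iota_one: "\<iota> 1 = 1"
    and iota_add: "\<iota> (c + d) = \<iota> c + \<iota> d"
    and iota_mult: "\<iota> (c * d) = \<iota> c * \<iota> d"
    and iota_central: "\<iota> c * x = x * \<iota> c"
begin

lemma iota_zero: "\<iota> 0 = 0"
  using iota_add[of 0 0] by simp

lemma iota_sum: "\<iota> (sum f A) = (\<Sum>x\<in>A. \<iota> (f x))"
  by (induction A rule: infinite_finite_induct) (auto simp: iota_zero iota_add)

lemma iota_uminus: "\<iota> (- c) = - \<iota> c"
  using iota_add[of c "- c"] by (simp add: iota_zero eq_neg_iff_add_eq_0 add.commute)

lemma iota_left_commute: "x * (\<iota> c * y) = \<iota> c * (x * y)"
  by (metis iota_central mult.assoc)

context
  fixes z :: "'v::finite \<Rightarrow> 'b"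
  assumes commuting: "\<And>i j. z i * z j = z j * z i"
begin

lemma commuting_eval_hom:
  "monoid_eval_hom \<iota> (\<lambda>m. Finite_Set.fold ((*) \<circ> (\<lambda>i. z i ^ Poly_Mapping.lookup m i)) 1 UNIV)"
proof -
  obtain vs :: "'v list" where vs: "distinct vs" "set vs = UNIV"
    using finite_distinct_list[of "UNIV :: 'v set"] by auto
  have "prod_list (map (\<lambda>i. 1) vs) = (1 :: 'b)"
    by (induction vs) auto
  then show ?thesis
    unfolding commuting_fold_eq[OF commuting vs]
    by unfold_locales
      (simp_all add: iota_one iota_add iota_mult lookup_add prod_list_power_add[OF commuting], rule iota_central)
qed

lemma poly_eval_simps:
  "poly_eval \<iota> z (p + q) = poly_eval \<iota> z p + poly_eval \<iota> z q"
  "poly_eval \<iota> z (p * q) = poly_eval \<iota> z p * poly_eval \<iota> z q"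
  "poly_eval \<iota> z (const c) = \<iota> c"
  "poly_eval \<iota> z (pvar i) = z i"
proof -
  interpret monoid_eval_hom \<iota> "\<lambda>m. Finite_Set.fold ((*) \<circ> (\<lambda>i. z i ^ Poly_Mapping.lookup m i)) 1 UNIV"
    by (rule commuting_eval_hom)
  show "poly_eval \<iota> z (p + q) = poly_eval \<iota> z p + poly_eval \<iota> z q"
    "poly_eval \<iota> z (p * q) = poly_eval \<iota> z p * poly_eval \<iota> z q"
    "poly_eval \<iota> z (const c) = \<iota> c"
    by (simp_all add: poly_eval_def monoid_eval_add monoid_eval_mult monoid_eval_const)
  obtain vs :: "'v list" where vs: "distinct vs" "set vs = UNIV"
    using finite_distinct_list[of "UNIV :: 'v set"] by auto
  show "poly_eval \<iota> z (pvar i) = z i"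
    unfolding poly_eval_def pvar_def monoid_eval_single
    unfolding commuting_fold_eq[OF commuting vs] lookup_single iota_one
    using prod_list_power_unit[OF vs(1), of i z] vs(2) by simp
qed

lemma poly_eval_zero: "poly_eval \<iota> z 0 = 0"
  using poly_eval_simps(1)[of 0 0] by simp

lemma poly_eval_one: "poly_eval \<iota> z 1 = 1"
  using poly_eval_simps(3)[of 1] by (simp add: const_one iota_one)

lemma poly_eval_commute: "poly_eval \<iota> z p * poly_eval \<iota> z q = poly_eval \<iota> z q * poly_eval \<iota> z p"
  by (metis mult.commute poly_eval_simps(2))

end

end

section \<open>Algebras with canonical generators\<close>

text \<open>
  Common interface of the Weyl algebra, whose bracket is the commutator, and the Poisson algebra.
\<close>

locale canonical_algebra = central_scalars \<iota>
  for \<iota> :: "'a::comm_ring_1 \<Rightarrow> 'b::{ring, monoid_mult}" +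
  fixes v :: "'n::finite + 'n \<Rightarrow> 'b" and ev :: "('n + 'n \<Rightarrow> 'b) \<Rightarrow> 'b \<Rightarrow> 'b" and br :: "'b \<Rightarrow> 'b \<Rightarrow> 'b"
  assumes br_add_right: "br x (y + z) = br x y + br x z"
    and br_mult_right: "br x (y * z) = br x y * z + y * br x z"
    and br_swap: "br y x = - br x y"
    and br_const: "br x (\<iota> c) = 0"
    and br_generators: "br (v i) (v j) = \<iota> (omega i j)"
    and br_zero_commute: "\<And>y :: 'n + 'n \<Rightarrow> 'b. (\<And>i j. br (y i) (y j) = \<iota> (omega i j)) \<Longrightarrow>
          y (Inl r) * y (Inl s) = y (Inl s) * y (Inl r)"
    and ev_add: "\<And>y. (\<And>i j. br (y i) (y j) = \<iota> (omega i j)) \<Longrightarrow> ev y (a + b) = ev y a + ev y b"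
    and ev_mult: "\<And>y. (\<And>i j. br (y i) (y j) = \<iota> (omega i j)) \<Longrightarrow> ev y (a * b) = ev y a * ev y b"
    and ev_const: "\<And>y. (\<And>i j. br (y i) (y j) = \<iota> (omega i j)) \<Longrightarrow> ev y (\<iota> c) = \<iota> c"
    and ev_generator: "\<And>y. (\<And>i j. br (y i) (y j) = \<iota> (omega i j)) \<Longrightarrow> ev y (v k) = y k"
    and ev_br: "\<And>y. (\<And>i j. br (y i) (y j) = \<iota> (omega i j)) \<Longrightarrow> ev y (br a b) = br (ev y a) (ev y b)"
    and generated: "\<And>P. (\<And>c. P (\<iota> c)) \<Longrightarrow> (\<And>i. P (v i)) \<Longrightarrow> (\<And>a b. P a \<Longrightarrow> P b \<Longrightarrow> P (a + b)) \<Longrightarrow>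
          (\<And>a b. P a \<Longrightarrow> P b \<Longrightarrow> P (a * b)) \<Longrightarrow> P x"
begin

definition canonical :: "('n + 'n \<Rightarrow> 'b) \<Rightarrow> bool" where
  "canonical y \<longleftrightarrow> (\<forall>i j. br (y i) (y j) = \<iota> (omega i j))"

definition alg_hom :: "('b \<Rightarrow> 'b) \<Rightarrow> bool" where
  "alg_hom f \<longleftrightarrow> (\<forall>a b. f (a + b) = f a + f b) \<and> (\<forall>a b. f (a * b) = f a * f b) \<and> (\<forall>c. f (\<iota> c) = \<iota> c)"

text \<open>The substitutions act on arbitrary families and not only on the generators: if a
  homomorphism sends the generators to \<open>y\<close>, then its composite with the automorphism of
  a letter sends them to the substituted family.\<close>

definition lin_subst :: "('a^('n + 'n)^('n + 'n)) \<Rightarrow> ('n + 'n \<Rightarrow> 'b) \<Rightarrow> 'n + 'n \<Rightarrow> 'b" where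
  "lin_subst g y = (\<lambda>j. \<Sum>i\<in>UNIV. \<iota> (g $ i $ j) * y i)"

definition transv_subst :: "('a, 'n) poly_alg \<Rightarrow> ('n + 'n \<Rightarrow> 'b) \<Rightarrow> 'n + 'n \<Rightarrow> 'b" where
  "transv_subst F y = (\<lambda>k. case k of Inl i \<Rightarrow> y (Inl i)
     | Inr i \<Rightarrow> y (Inr i) + poly_eval \<iota> (\<lambda>j. y (Inl j)) (partial i F))"

lemma alg_homD:
  assumes "alg_hom f"
  shows "f (a + b) = f a + f b" "f (a * b) = f a * f b" "f (\<iota> c) = \<iota> c" "f 0 = 0"
    "f (sum h A) = (\<Sum>x\<in>A. f (h x))"
proof -
  show *: "f (a + b) = f a + f b" "f (a * b) = f a * f b" "f (\<iota> c) = \<iota> c" for a b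
    using assms by (auto simp: alg_hom_def)
  show 0: "f 0 = 0" using *(1)[of 0 0] by simp
  show "f (sum h A) = (\<Sum>x\<in>A. f (h x))"
    by (induction A rule: infinite_finite_induct) (auto simp: 0 *)
qed

lemma alg_hom_comp: "alg_hom f \<Longrightarrow> alg_hom g \<Longrightarrow> alg_hom (f \<circ> g)"
  by (simp add: alg_hom_def)

lemma alg_hom_id: "alg_hom id"
  by (simp add: alg_hom_def)

lemma alg_hom_ext:
  assumes "alg_hom f" "alg_hom g" "\<And>i. f (v i) = g (v i)"
  shows "f = g"
proof
  fix x show "f x = g x"
    by (induction x rule: generated) (simp_all add: assms alg_homD[OF assms(1)] alg_homD[OF assms(2)])
qed

lemma canonicalD: "canonical y \<Longrightarrow> br (y i) (y j) = \<iota> (omega i j)"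
  by (simp add: canonical_def)

lemma canonical_generators: "canonical v"
  by (simp add: canonical_def br_generators)

lemma alg_hom_ev: "canonical y \<Longrightarrow> alg_hom (ev y)"
  unfolding canonical_def alg_hom_def by (simp add: ev_add ev_mult ev_const)

lemma ev_v: "canonical y \<Longrightarrow> ev y (v k) = y k"
  by (simp add: canonical_def ev_generator)

lemma canonical_commuting: "canonical y \<Longrightarrow> y (Inl i) * y (Inl j) = y (Inl j) * y (Inl i)"
  unfolding canonical_def using br_zero_commute[where y = y] by blast

lemma br_add_left: "br (x + y) z = br x z + br y z"
  by (metis add.commute br_add_right br_swap minus_add)

lemma br_zero_right: "br x 0 = 0"
  using br_add_right[of x 0 0] by simp

lemma br_zero_left: "br 0 x = 0"
  using br_add_left[of 0 0 x] by simp

lemma br_sum_right: "br x (sum f A) = (\<Sum>i\<in>A. br x (f i))"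
  by (induction A rule: infinite_finite_induct) (auto simp: br_zero_right br_add_right)

lemma br_sum_left: "br (sum f A) x = (\<Sum>i\<in>A. br (f i) x)"
  by (induction A rule: infinite_finite_induct) (auto simp: br_zero_left br_add_left)

lemma br_scale_right: "br x (\<iota> c * y) = \<iota> c * br x y"
  by (simp add: br_mult_right br_const)

lemma br_scale_left: "br (\<iota> c * x) y = \<iota> c * br x y"
  by (metis br_scale_right br_swap mult_minus_right)

text \<open>\<open>br x\<close> is a derivation, and on the \<open>z j\<close> it takes the same
  values as \<open>partial i\<close> on the variables. This gives the canonical relations for
  transvections and later turns iterated commutators into iterated derivatives.\<close>

lemma br_poly_eval_right:
  assumes z: "\<And>i j. z i * z j = z j * z i" and x: "\<And>j. br x (z j) = \<iota> (of_bool (i = j))"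
  shows "br x (poly_eval \<iota> z F) = poly_eval \<iota> z (partial i F)"
proof (induction F rule: poly_alg_induct)
  case (var j)
  then show ?case
    by (auto simp: poly_eval_simps[OF z] x partial_pvar poly_eval_zero[OF z] poly_eval_one[OF z] iota_one iota_zero)
qed (simp_all add: poly_eval_simps[OF z] partial_add partial_mult br_const poly_eval_zero[OF z] br_add_right br_mult_right)

lemma br_poly_eval_zero:
  assumes z: "\<And>i j. z i * z j = z j * z i" and x: "\<And>j. br x (z j) = 0"
  shows "br x (poly_eval \<iota> z F) = 0"
  by (induction F rule: poly_alg_induct)
    (simp_all add: poly_eval_simps[OF z] x br_const br_add_right br_mult_right)

lemma canonical_lin_subst:
  assumes "canonical y" "g \<in> carrier Sp"
  shows "canonical (lin_subst g y)"
  unfolding canonical_def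
proof (intro allI)
  fix i j
  let ?w = "\<chi> i j. (omega i j :: 'a)"
  have "(transpose g ** ?w ** g) $ i $ j = ?w $ i $ j"
    using assms(2) by (simp add: Sp_def)
  then have g: "(\<Sum>k\<in>UNIV. (\<Sum>l\<in>UNIV. g $ l $ i * omega l k) * g $ k $ j) = omega i j"
    by (simp add: matrix_matrix_mult_def transpose_def)
  have "br (lin_subst g y i) (lin_subst g y j) =
      (\<Sum>k\<in>UNIV. \<Sum>l\<in>UNIV. \<iota> (g $ k $ j) * (\<iota> (g $ l $ i) * \<iota> (omega l k)))"
    unfolding lin_subst_def
    by (simp add: br_sum_right br_sum_left br_scale_right br_scale_left canonicalD[OF assms(1)])
      (simp add: sum_distrib_left)
  also have "\<dots> = \<iota> (\<Sum>k\<in>UNIV. (\<Sum>l\<in>UNIV. g $ l $ i * omega l k) * g $ k $ j)"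
    by (simp add: iota_sum iota_mult sum_distrib_right mult.assoc[symmetric])
      (simp add: iota_mult[symmetric] mult.commute mult.left_commute)
  finally show "br (lin_subst g y i) (lin_subst g y j) = \<iota> (omega i j)"
    by (simp add: g)
qed

text \<open>The bracket of two \<open>Inr\<close> images is the difference of two mixed second
  derivatives of \<open>F\<close>, evaluated at the commuting \<open>Inl\<close> members, and
  vanishes by \<open>partial_commute\<close>. All other brackets are those of
  \<open>y\<close>.\<close>

lemma canonical_transv_subst:
  assumes "canonical y"
  shows "canonical (transv_subst F y)"
  unfolding canonical_def
proof (intro allI)
  fix i j
  note y = canonicalD[OF assms] canonical_commuting[OF assms]
  have omega: "omega (Inl k) (Inl l) = (0::'a)" "omega (Inr k) (Inr l) = (0::'a)"
    "omega (Inr k) (Inl l) = (of_bool (k = l) :: 'a)" "omega (Inl k) (Inr l) = (- of_bool (k = l) :: 'a)" for k l :: 'n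
    by (auto simp: omega_def)
  have r: "br (y (Inr k)) (poly_eval \<iota> (\<lambda>j. y (Inl j)) G) = poly_eval \<iota> (\<lambda>j. y (Inl j)) (partial k G)" for k G
    by (rule br_poly_eval_right) (auto simp: y omega)
  have l: "br (y (Inl k)) (poly_eval \<iota> (\<lambda>j. y (Inl j)) G) = 0" for k G
    by (rule br_poly_eval_zero) (auto simp: y omega iota_zero)
  have p: "br (poly_eval \<iota> (\<lambda>j. y (Inl j)) G) (poly_eval \<iota> (\<lambda>j. y (Inl j)) H) = 0" for G H
    by (rule br_poly_eval_zero) (auto simp: y br_swap[of _ "y (Inl _)"] l)
  have l': "br (poly_eval \<iota> (\<lambda>j. y (Inl j)) G) (y (Inl k)) = 0" for k G
    by (subst br_swap) (simp add: l)
  have r': "br (poly_eval \<iota> (\<lambda>j. y (Inl j)) G) (y (Inr k)) = - poly_eval \<iota> (\<lambda>j. y (Inl j)) (partial k G)" for k G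
    by (subst br_swap) (simp add: r)
  show "br (transv_subst F y i) (transv_subst F y j) = \<iota> (omega i j)"
    by (cases i; cases j)
      (simp_all add: transv_subst_def br_add_left br_add_right y r l p l' r' partial_commute)
qed

lemma alg_hom_poly_eval:
  assumes f: "alg_hom f" and z: "\<And>i j. z i * z j = z j * z i"
  shows "f (poly_eval \<iota> z F) = poly_eval \<iota> (\<lambda>i. f (z i)) F"
proof -
  have z': "f (z i) * f (z j) = f (z j) * f (z i)" for i j
    by (metis alg_homD(2)[OF f] z)
  show ?thesis
    by (induction F rule: poly_alg_induct)
      (simp_all add: poly_eval_simps[OF z] poly_eval_simps[OF z'] alg_homD[OF f])
qed

lemma alg_hom_lin_subst: "alg_hom f \<Longrightarrow> f (lin_subst g y j) = lin_subst g (\<lambda>i. f (y i)) j"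
  by (simp add: lin_subst_def alg_homD)

lemma alg_hom_transv_subst:
  "alg_hom f \<Longrightarrow> canonical y \<Longrightarrow> f (transv_subst F y j) = transv_subst F (\<lambda>i. f (y i)) j"
  by (cases j) (simp_all add: transv_subst_def alg_homD alg_hom_poly_eval canonical_commuting)

lemma lin_subst_mult: "lin_subst h (lin_subst g y) = lin_subst (g ** h) y"
proof
  fix j
  have "lin_subst h (lin_subst g y) j = (\<Sum>i\<in>UNIV. \<Sum>l\<in>UNIV. \<iota> (g $ l $ i * h $ i $ j) * y l)"
    unfolding lin_subst_def sum_distrib_left mult.assoc[symmetric] iota_mult[symmetric]
    by (simp only: mult.commute)
  also have "\<dots> = lin_subst (g ** h) y j"
    by (subst sum.swap) (simp add: lin_subst_def matrix_matrix_mult_def iota_sum sum_distrib_right)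
  finally show "lin_subst h (lin_subst g y) j = lin_subst (g ** h) y j" .
qed

lemma lin_subst_one: "lin_subst (mat 1) y = y"
proof
  fix j
  have "lin_subst (mat 1) y j = (\<Sum>i\<in>UNIV. if i = j then y i else 0)"
    unfolding lin_subst_def by (intro sum.cong) (auto simp: mat_def iota_one iota_zero)
  then show "lin_subst (mat 1) y j = y j" by simp
qed

lemma transv_subst_add:
  assumes "canonical y"
  shows "transv_subst G (transv_subst F y) = transv_subst (F + G) y"
proof
  fix j show "transv_subst G (transv_subst F y) j = transv_subst (F + G) y j"
    by (cases j) (simp_all add: transv_subst_def partial_add
        poly_eval_simps[where z="\<lambda>j. y (Inl j)", OF canonical_commuting[OF assms]] add.assoc)
qed

definition Aut :: "('b \<Rightarrow> 'b) monoid" where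
  "Aut = \<lparr>carrier = {f \<in> alg_auts \<iota>. \<forall>p q. f (br p q) = br (f p) (f q)}, monoid.mult = (\<circ>), one = id\<rparr>"

lemma carrier_Aut: "f \<in> carrier Aut \<longleftrightarrow> bij f \<and> alg_hom f \<and> (\<forall>p q. f (br p q) = br (f p) (f q))"
  by (auto simp: Aut_def alg_auts_def alg_hom_def)

lemma group_Aut: "group Aut"
proof (rule groupI)
  show "x \<otimes>\<^bsub>Aut\<^esub> y \<in> carrier Aut" if "x \<in> carrier Aut" "y \<in> carrier Aut" for x y
    using that bij_comp[of y x] alg_hom_comp[of x y] by (simp add: carrier_Aut) (simp add: Aut_def)
  show "\<one>\<^bsub>Aut\<^esub> \<in> carrier Aut"
    by (simp add: carrier_Aut) (simp add: Aut_def alg_hom_id bij_id[unfolded id_def[symmetric]])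
  fix f assume f: "f \<in> carrier Aut"
  define h where "h = inv_into UNIV f"
  have inv: "f (h x) = x" "h (f x) = x" for x
    using f by (auto simp: h_def carrier_Aut bij_is_surj surj_f_inv_f bij_is_inj)
  have "h \<in> carrier Aut"
    unfolding carrier_Aut alg_hom_def
  proof (intro conjI allI)
    show "bij (h)" using f by (simp add: h_def carrier_Aut bij_imp_bij_inv)
    show "h (a + b) = h a + h b" "h (a * b) = h a * h b"
      "h (br a b) = br (h a) (h b)" "h (\<iota> c) = \<iota> c" for a b c
      using f inv by (metis alg_homD carrier_Aut)+
  qed
  moreover have "h \<circ> f = id" using inv by auto
  ultimately show "\<exists>y\<in>carrier Aut. y \<otimes>\<^bsub>Aut\<^esub> f = \<one>\<^bsub>Aut\<^esub>"
    by (auto simp: Aut_def intro!: bexI[of _ "h"])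
qed (simp_all add: Aut_def comp_assoc)

lemma ev_comp:
  assumes "canonical y" "canonical z" "\<And>i. ev y (z i) = x i" "canonical x"
  shows "ev y \<circ> ev z = ev x"
  by (rule alg_hom_ext) (simp_all add: assms alg_hom_ev alg_hom_comp ev_v)

lemma ev_generators: "ev v = id"
  by (rule alg_hom_ext) (simp_all add: canonical_generators alg_hom_ev alg_hom_id ev_v)

lemma ev_Aut:
  assumes "canonical y" "canonical z" "\<And>i. ev y (z i) = v i" "\<And>i. ev z (y i) = v i"
  shows "ev y \<in> carrier Aut"
proof -
  have "ev y \<circ> ev z = id" "ev z \<circ> ev y = id"
    using ev_comp[OF assms(1-3) canonical_generators] ev_comp[OF assms(2,1,4) canonical_generators]
    by (simp_all add: ev_generators)
  then have "bij (ev y)"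
    by (rule o_bij[rotated])
  then show ?thesis
    using assms(1) alg_hom_ev by (simp add: carrier_Aut) (simp add: canonical_def ev_br)
qed

end

section \<open>The two factors of the free product are groups\<close>

lemma Sp_simps: "g \<in> carrier Sp \<longleftrightarrow> invertible g \<and> transpose g ** (\<chi> i j. omega i j) ** g = (\<chi> i j. omega i j)"
  "g \<otimes>\<^bsub>Sp\<^esub> h = g ** h" "\<one>\<^bsub>Sp\<^esub> = mat 1"
  by (simp_all add: Sp_def)

lemma Sp_inverse:
  fixes g :: "('a::comm_ring_1)^('n::finite + 'n)^('n + 'n)"
  assumes "g \<in> carrier Sp"
  obtains h where "h \<in> carrier Sp" "g ** h = mat 1" "h ** g = mat 1"
proof -
  let ?w = "\<chi> i j. (omega i j :: 'a)"
  obtain h where h: "g ** h = mat 1" "h ** g = mat 1"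
    using assms by (auto simp: Sp_simps invertible_def)
  have "transpose h ** ?w ** h = transpose h ** (transpose g ** ?w ** g) ** h"
    using assms by (simp add: Sp_simps)
  also have "\<dots> = transpose (g ** h) ** ?w ** (g ** h)"
    by (simp add: matrix_transpose_mul matrix_mul_assoc)
  also have "\<dots> = ?w"
    by (simp add: h transpose_mat)
  finally have "h \<in> carrier Sp"
    using h by (auto simp: Sp_simps invertible_def)
  then show ?thesis using h that by blast
qed

lemma group_Sp: "group (Sp :: (('a::comm_ring_1)^('n::finite + 'n)^('n + 'n)) monoid)"
proof (rule groupI)
  fix g h :: "'a^('n + 'n)^('n + 'n)"
  assume gh: "g \<in> carrier Sp" "h \<in> carrier Sp"
  let ?w = "\<chi> i j. (omega i j :: 'a)"
  have "transpose (g ** h) ** ?w ** (g ** h) = transpose h ** (transpose g ** ?w ** g) ** h"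
    by (simp only: matrix_transpose_mul matrix_mul_assoc)
  also have "\<dots> = ?w"
    using gh by (simp add: Sp_simps)
  finally show "g \<otimes>\<^bsub>Sp\<^esub> h \<in> carrier Sp"
    using gh by (simp add: Sp_simps invertible_mult)
next
  show "\<one>\<^bsub>Sp\<^esub> \<in> carrier (Sp :: ('a^('n + 'n)^('n + 'n)) monoid)"
    by (auto simp: Sp_simps transpose_mat invertible_def intro: exI[of _ "mat 1"])
next
  fix g :: "'a^('n + 'n)^('n + 'n)"
  assume "g \<in> carrier Sp"
  then obtain h where "h \<in> carrier Sp" "g ** h = mat 1" "h ** g = mat 1"
    by (rule Sp_inverse)
  then show "\<exists>h\<in>carrier Sp. h \<otimes>\<^bsub>Sp\<^esub> g = \<one>\<^bsub>Sp\<^esub>"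
    by (intro bexI[of _ h]) (simp_all only: Sp_simps(2,3))
qed (simp_all add: Sp_simps(2,3) matrix_mul_assoc)

lemma group_add_group: "group (add_group :: 'b::ab_group_add monoid)"
  by (rule groupI) (auto simp: add_group_def add.assoc intro: exI[of _ "- _"])

lemma normal_consts:
  "range const \<lhd> (add_group :: ('a::comm_ring_1, 'n) poly_alg monoid)"
proof -
  interpret group "add_group :: ('a, 'n) poly_alg monoid" by (rule group_add_group)
  have inv: "inv\<^bsub>add_group\<^esub> a = - a" for a :: "('a, 'n) poly_alg"
    by (rule inv_equality) (auto simp: add_group_def)
  have "subgroup (range const) (add_group :: ('a, 'n) poly_alg monoid)"
  proof (rule subgroupI)
    fix a assume "a \<in> range (const :: 'a \<Rightarrow> ('a, 'n) poly_alg)"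
    then obtain c where c: "a = const c" by blast
    show "inv\<^bsub>add_group\<^esub> a \<in> range const"
      by (simp add: inv c flip: const_uminus)
  qed (auto simp: add_group_def const_add[symmetric])
  then show ?thesis
    by (rule normal_inv_iff[THEN iffD2, OF conjI]) (simp add: inv, auto simp: add_group_def)
qed

lemma group_polys_mod_consts: "group (polys_mod_consts :: ('a::comm_ring_1, 'n) poly_alg set monoid)"
  unfolding polys_mod_consts_def by (rule normal.factorgroup_is_group[OF normal_consts])

lemma carrier_polys_mod_consts:
  "C \<in> carrier polys_mod_consts \<longleftrightarrow> (\<exists>F. C = range const #>\<^bsub>add_group\<^esub> F)"
  by (auto simp: polys_mod_consts_def carrier_FactGroup add_group_def)

section \<open>Words in the free product\<close>

context canonical_algebra
begin

lemma alg_hom_lin_ev: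
  "canonical y \<Longrightarrow> ev y (lin_subst g v j) = lin_subst g y j"
  by (simp add: alg_hom_lin_subst alg_hom_ev ev_v)

lemma alg_hom_transv_ev:
  "canonical y \<Longrightarrow> ev y (transv_subst F v j) = transv_subst F y j"
  by (simp add: alg_hom_transv_subst alg_hom_ev ev_v canonical_generators)

lemma canonical_lin: "g \<in> carrier Sp \<Longrightarrow> canonical (lin_subst g v)"
  by (simp add: canonical_lin_subst canonical_generators)

lemma canonical_transv: "canonical (transv_subst F v)"
  by (simp add: canonical_transv_subst canonical_generators)

lemma lin_ev_hom: "(\<lambda>g. ev (lin_subst g v)) \<in> hom Sp Aut"
proof (rule homI)
  fix g :: "'a^('n + 'n)^('n + 'n)" assume g: "g \<in> carrier Sp"
  then obtain h where h: "h \<in> carrier Sp" "g ** h = mat 1" "h ** g = mat 1"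
    by (rule Sp_inverse)
  show "ev (lin_subst g v) \<in> carrier Aut"
    by (rule ev_Aut[OF canonical_lin[OF g] canonical_lin[OF h(1)]])
      (simp_all add: alg_hom_lin_ev canonical_lin g h lin_subst_mult lin_subst_one)
next
  fix g h :: "'a^('n + 'n)^('n + 'n)" assume gh: "g \<in> carrier Sp" "h \<in> carrier Sp"
  then have "g ** h \<in> carrier Sp"
    using monoid.m_closed[OF group.is_monoid[OF group_Sp] gh] by (simp add: Sp_simps(2))
  then have "ev (lin_subst g v) \<circ> ev (lin_subst h v) = ev (lin_subst (g ** h) v)"
    using gh by (intro ev_comp) (simp_all add: canonical_lin alg_hom_lin_ev lin_subst_mult)
  then show "ev (lin_subst (g \<otimes>\<^bsub>Sp\<^esub> h) v) = ev (lin_subst g v) \<otimes>\<^bsub>Aut\<^esub> ev (lin_subst h v)"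
    by (simp add: Sp_simps(2)) (simp add: Aut_def)
qed

lemma transv_subst_zero: "transv_subst 0 v = v"
  by (rule ext, case_tac x)
    (simp_all add: transv_subst_def poly_eval_zero[where z="\<lambda>j. v (Inl j)", OF canonical_commuting[OF canonical_generators]])

lemma transv_ev_Aut: "ev (transv_subst F v) \<in> carrier Aut"
  by (rule ev_Aut[OF canonical_transv canonical_transv[of "- F"]])
    (simp_all add: alg_hom_transv_ev canonical_transv transv_subst_add canonical_generators transv_subst_zero)

lemma transv_ev_mult: "ev (transv_subst F v) \<circ> ev (transv_subst G v) = ev (transv_subst (F + G) v)"
  by (intro ev_comp) (simp_all add: canonical_transv alg_hom_transv_ev transv_subst_add canonical_generators)

lemma transv_subst_add_const: "transv_subst (F + const c) y = transv_subst F y"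
  by (simp add: transv_subst_def partial_add_const cong: sum.case_cong)

definition coset_transv :: "('a, 'n) poly_alg set \<Rightarrow> 'b \<Rightarrow> 'b" where
  "coset_transv C = the_elem ((\<lambda>F. ev (transv_subst F v)) ` C)"

lemma coset_transv_eq: "coset_transv (range const #>\<^bsub>add_group\<^esub> F) = ev (transv_subst F v)"
  unfolding coset_transv_def by (rule coset_consts_image) (simp add: transv_subst_add_const)

lemma coset_transv_hom: "coset_transv \<in> hom polys_mod_consts Aut"
proof (rule homI)
  fix C :: "('a, 'n) poly_alg set" assume "C \<in> carrier polys_mod_consts"
  then show "coset_transv C \<in> carrier Aut"
    by (auto simp: carrier_polys_mod_consts coset_transv_eq transv_ev_Aut)
next
  fix C D :: "('a, 'n) poly_alg set"
  assume "C \<in> carrier polys_mod_consts" "D \<in> carrier polys_mod_consts"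
  then obtain F G where FG: "C = range const #>\<^bsub>add_group\<^esub> F" "D = range const #>\<^bsub>add_group\<^esub> G"
    by (auto simp: carrier_polys_mod_consts)
  then have "C \<otimes>\<^bsub>polys_mod_consts\<^esub> D = range const #>\<^bsub>add_group\<^esub> (F + G)"
    using normal.rcos_sum[OF normal_consts, of F G] by (simp add: polys_mod_consts_def FactGroup_def add_group_def)
  then show "coset_transv (C \<otimes>\<^bsub>polys_mod_consts\<^esub> D) = coset_transv C \<otimes>\<^bsub>Aut\<^esub> coset_transv D"
    by (simp add: FG coset_transv_eq) (simp add: Aut_def transv_ev_mult)
qed

text \<open>A single representative of each coset is fixed, so that a word involves finitely many
  scalars, the same ones for both algebras. By \<open>transv_subst_add_const\<close> the choice does
  not affect the substitution.\<close>

definition letter_subst ::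
  "('a^('n + 'n)^('n + 'n)) + ('a, 'n) poly_alg set \<Rightarrow> ('n + 'n \<Rightarrow> 'b) \<Rightarrow> 'n + 'n \<Rightarrow> 'b" where
  "letter_subst s = (case s of Inl g \<Rightarrow> lin_subst g | Inr C \<Rightarrow> transv_subst (SOME F. F \<in> C))"

definition word_images ::
  "(('a^('n + 'n)^('n + 'n)) + ('a, 'n) poly_alg set) list \<Rightarrow> 'n + 'n \<Rightarrow> 'b" where
  "word_images w = foldl (\<lambda>y s. letter_subst s y) v w"

lemma word_images_simps: "word_images [] = v" "word_images (w @ [s]) = letter_subst s (word_images w)"
  by (simp_all add: word_images_def)

lemma canonical_letter_subst:
  "canonical y \<Longrightarrow> s \<in> carrier Sp <+> carrier polys_mod_consts \<Longrightarrow> canonical (letter_subst s y)"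
  by (auto simp: letter_subst_def canonical_lin_subst canonical_transv_subst)

lemma canonical_word_images:
  "w \<in> fp_words Sp polys_mod_consts \<Longrightarrow> canonical (word_images w)"
  by (induction w rule: rev_induct)
    (auto simp: word_images_simps canonical_generators fp_words_def intro!: canonical_letter_subst)

lemma coset_transv_SOME:
  assumes "C \<in> carrier polys_mod_consts"
  shows "coset_transv C = ev (transv_subst (SOME F. F \<in> C) v)"
proof -
  obtain F where F: "C = range const #>\<^bsub>add_group\<^esub> F"
    using assms by (auto simp: carrier_polys_mod_consts)
  then have "C = {const c + F |c. True}"
    by (auto simp: r_coset_def add_group_def)
  moreover from this have "(SOME F. F \<in> C) \<in> C"
    by (auto intro: someI)
  ultimately obtain c where "(SOME F. F \<in> C) = F + const c"
    by (auto simp: add.commute)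
  then show ?thesis
    by (simp add: F coset_transv_eq transv_subst_add_const)
qed

lemma letter_ev:
  assumes "s \<in> carrier Sp <+> carrier polys_mod_consts"
  shows "case_sum (\<lambda>g. ev (lin_subst g v)) coset_transv s = ev (letter_subst s v)"
  using assms by (auto simp: letter_subst_def coset_transv_SOME)

lemma alg_hom_letter_subst:
  "alg_hom f \<Longrightarrow> canonical y \<Longrightarrow> f (letter_subst s y j) = letter_subst s (\<lambda>i. f (y i)) j"
  by (cases s) (simp_all add: letter_subst_def alg_hom_lin_subst alg_hom_transv_subst)

definition word_aut :: "(('a^('n + 'n)^('n + 'n)) + ('a, 'n) poly_alg set) list set \<Rightarrow> 'b \<Rightarrow> 'b" where
  "word_aut = fp_lift Aut (\<lambda>g. ev (lin_subst g v)) coset_transv"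

text \<open>Composing \<open>ev y\<close> with the automorphism of a letter \<open>s\<close> gives
  \<open>ev (letter_subst s y)\<close>, so the product is computed by reading the word from the
  left. \<open>fp_lift\<close> folds from the right; the fact \<open>split\<close> inside the proof
  reconciles the two directions.\<close>

lemma word_aut_class:
  assumes "w \<in> fp_words Sp polys_mod_consts"
  shows "word_aut (fp_rel Sp polys_mod_consts `` {w}) = ev (word_images w)"
proof -
  let ?\<phi> = "case_sum (\<lambda>g. ev (lin_subst g v)) coset_transv"
  have "word_aut (fp_rel Sp polys_mod_consts `` {w}) = foldr (\<lambda>s. (\<circ>) (?\<phi> s)) w id"
    using fp_lift_class[OF group_Sp group_polys_mod_consts group_Aut lin_ev_hom coset_transv_hom assms]
    by (simp add: word_aut_def Aut_def)
  also have "\<dots> = ev (word_images w)"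
    using assms
  proof (induction w rule: rev_induct)
    case Nil
    then show ?case by (simp add: word_images_simps ev_generators)
  next
    case (snoc s w)
    then have w: "w \<in> fp_words Sp polys_mod_consts" and s: "s \<in> carrier Sp <+> carrier polys_mod_consts"
      by (auto simp: fp_words_def)
    have split: "foldr (\<lambda>s. (\<circ>) (?\<phi> s)) us z = foldr (\<lambda>s. (\<circ>) (?\<phi> s)) us id \<circ> z" for us z
      by (induction us) auto
    have "foldr (\<lambda>s. (\<circ>) (?\<phi> s)) (w @ [s]) id = foldr (\<lambda>s. (\<circ>) (?\<phi> s)) w (?\<phi> s)"
      by (simp only: foldr_append foldr.simps o_apply id_apply comp_id)
    also have "\<dots> = ev (word_images w) \<circ> ev (letter_subst s v)"
      unfolding split[of w "?\<phi> s"] by (simp only: snoc.IH[OF w] letter_ev[OF s])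
    also have "\<dots> = ev (letter_subst s (word_images w))"
      using canonical_word_images[OF w] canonical_letter_subst[OF _ s]
      by (intro ev_comp) (simp_all add: alg_hom_letter_subst alg_hom_ev ev_v canonical_generators)
    finally show ?case
      by (simp only: word_images_simps)
  qed
  finally show ?thesis .
qed

lemma word_aut_eq_id:
  assumes "w \<in> fp_words Sp polys_mod_consts"
  shows "word_aut (fp_rel Sp polys_mod_consts `` {w}) = id \<longleftrightarrow> word_images w = v"
  unfolding word_aut_class[OF assms]
  using ev_v[OF canonical_word_images[OF assms]] ev_generators by (metis eq_id_iff ext)

end

section \<open>The two instances\<close>

lemma weyl_induct [case_names const var add mult]:
  assumes "\<And>c. P (wconst c)" "\<And>i. P (wvar i)"
    "\<And>a b. P a \<Longrightarrow> P b \<Longrightarrow> P (a + b)" "\<And>a b. P a \<Longrightarrow> P b \<Longrightarrow> P (a * b)"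
  shows "P (a :: ('a::comm_ring_1, 'n) weyl)"
proof -
  obtain p where a: "a = abs_weyl p"
    by (metis Quotient3_abs_rep Quotient3_weyl)
  have "P (abs_weyl p)"
  proof (induction p rule: single_add_induct)
    case (single w c)
    have "P (abs_weyl (Poly_Mapping.single (Word us) c))" for us
    proof (induction us)
      case Nil
      then show ?case
        using assms(1)[of c] by (simp add: wconst.abs_eq const_def zero_free_mon_def)
    next
      case (Cons u us)
      have "Poly_Mapping.single (Word (u # us)) c = fvar u * Poly_Mapping.single (Word us) c"
        by (simp add: fvar_def mult_single plus_free_mon_def)
      then show ?case
        using assms(4)[OF assms(2) Cons, of u] by (simp add: wvar.abs_eq times_weyl.abs_eq)
    qed
    then show ?case by (metis free_mon.exhaust)
  next
    case (add p q)
    then show ?case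
      using assms(3) by (simp add: plus_weyl.abs_eq[symmetric])
  qed
  then show ?thesis by (simp add: a)
qed

lemma omega_Inl: "omega (Inl i) (Inl j) = 0"
  by (simp add: omega_def)

interpretation weyl: canonical_algebra "wconst :: 'a::comm_ring_1 \<Rightarrow> ('a, 'n::finite) weyl"
  wvar weyl_eval "\<lambda>a b. a * b - b * a"
proof
  show "x * (y * z) - y * z * x = (x * y - y * x) * z + y * (x * z - z * x)" for x y z :: "('a, 'n) weyl"
    by (simp add: algebra_simps)
next
  fix y :: "'n + 'n \<Rightarrow> ('a, 'n) weyl" and r s a b c k
  assume rel: "\<And>i j. y i * y j - y j * y i = wconst (omega i j)"
  show "y (Inl r) * y (Inl s) = y (Inl s) * y (Inl r)"
    using rel[of "Inl r" "Inl s"] by (simp add: omega_Inl wconst_simps)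
  show "weyl_eval y (a + b) = weyl_eval y a + weyl_eval y b"
    "weyl_eval y (a * b) = weyl_eval y a * weyl_eval y b"
    "weyl_eval y (wconst c) = wconst c" "weyl_eval y (wvar k) = y k"
    by (rule weyl_eval_simps[OF rel])+
  have *: "weyl_eval y (p - q) = weyl_eval y p - weyl_eval y q" for p q
    using weyl_eval_simps(1)[OF rel, of "p - q" q] by (simp add: algebra_simps)
  show "weyl_eval y (a * b - b * a) = weyl_eval y a * weyl_eval y b - weyl_eval y b * weyl_eval y a"
    unfolding * weyl_eval_simps(2)[OF rel] ..
qed (auto simp: wconst_simps wvar_commutator algebra_simps intro: wconst_central wconst_central[symmetric] weyl_induct)

interpretation poly: central_scalars "const :: 'a::comm_ring_1 \<Rightarrow> ('a, 'v) poly_alg"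
  by unfold_locales (simp_all add: const_one const_add const_mult mult.commute)

text \<open>The bracket is a derivation in each argument, so comparison on generators is enough:
  first in \<open>q\<close> with \<open>p\<close> a generator, then in \<open>p\<close>.\<close>

lemma poisson_poly_eval:
  fixes y :: "'n::finite + 'n \<Rightarrow> ('a::comm_ring_1, 'n) poisson"
  assumes y: "\<And>i j. poisson (y i) (y j) = const (omega i j)"
  shows "poly_eval const y (poisson p q) = poisson (poly_eval const y p) (poly_eval const y q)"
proof -
  note ev = poly.poly_eval_simps[where z=y, OF mult.commute] poly.poly_eval_zero[where z=y, OF mult.commute]
  have neg: "poly_eval const y (- p) = - poly_eval const y p" for p
    using ev(1)[of p "- p"] by (simp add: ev(5) eq_neg_iff_add_eq_0 add.commute)
  have zero: "poisson 0 r = 0" "poisson r 0 = 0" for r :: "('a, 'n) poisson"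
    by (simp_all add: poisson_def)
  have left: "poisson (const c) r = 0" "poisson (r + s) t = poisson r t + poisson s t"
    "poisson (r * s) t = poisson r t * s + r * poisson s t" for c and r s t :: "('a, 'n) poisson"
    by (subst poisson_swap, simp add: poisson_const)
      (subst (1 2 3) poisson_swap, simp add: poisson_add_right poisson_mult_right)+
  have var: "poly_eval const y (poisson (pvar i) q) = poisson (y i) (poly_eval const y q)" for i
    by (induction q rule: poly_alg_induct)
      (simp_all add: ev poisson_pvar y poisson_const poisson_add_right poisson_mult_right)
  show ?thesis
    by (induction p rule: poly_alg_induct)
      (simp_all add: ev var left)
qed

interpretation poisson: canonical_algebra "const :: 'a::comm_ring_1 \<Rightarrow> ('a, 'n::finite) poisson"
  pvar "poly_eval const" poisson
  by unfold_locales
    (simp_all add: poisson_add_right poisson_mult_right poisson_const poisson_pvar poisson_poly_eval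
      poly.poly_eval_simps[OF mult.commute] mult.commute, rule poisson_swap, rule poly_alg_induct)

text \<open>The carrier of \<open>weyl.Aut\<close> asks for compatibility with the bracket. The
  bracket is the commutator, which every ring homomorphism preserves.\<close>

lemma weyl_Aut_eq: "weyl_Aut = weyl.Aut"
proof -
  have "f (p * q - q * p) = f p * f q - f q * f p" if "f \<in> alg_auts wconst" for f :: "('a, 'b) weyl \<Rightarrow> ('a, 'b) weyl" and p q
  proof -
    have add: "f (a + b) = f a + f b" and mult: "f (a * b) = f a * f b" for a b
      using that by (simp_all add: alg_auts_def)
    have "f (p * q - q * p) + f (q * p) = f (p * q)"
      by (simp flip: add)
    then show ?thesis
      by (simp add: mult eq_diff_eq)
  qed
  then show ?thesis
    by (auto simp: weyl_Aut_def weyl.Aut_def)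
qed

lemma poisson_Aut_eq: "poisson_Aut = poisson.Aut"
  by (simp add: poisson_Aut_def poisson.Aut_def)

lemma rho_weyl_eq: "rho_weyl = weyl.word_aut"
  unfolding rho_weyl_def weyl.word_aut_def weyl_Aut_eq sp_weyl_def transv_weyl_def[abs_def] weyl.coset_transv_def[abs_def]
    weyl.lin_subst_def weyl.transv_subst_def ..

lemma rho_poisson_eq: "rho_poisson = poisson.word_aut"
  unfolding rho_poisson_def poisson.word_aut_def poisson_Aut_eq sp_poisson_def transv_poisson_def[abs_def] poisson.coset_transv_def[abs_def]
    poisson.lin_subst_def poisson.transv_subst_def ..

section \<open>The Weyl algebra as an algebra of differential operators\<close>

typedef (overloaded) ('a, 'n) diffop =
  "{f :: ('a::comm_ring_1, 'n) poisson \<Rightarrow> ('a, 'n) poisson.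
     (\<forall>p q. f (p + q) = f p + f q) \<and> (\<forall>c p. f (const c * p) = const c * f p)}"
  morphisms apply_op Op
  by (rule exI[of _ "\<lambda>_. 0"]) simp

setup_lifting type_definition_diffop

lemma apply_op_add_right: "apply_op T (p + q) = apply_op T p + apply_op T q"
  using apply_op[of T] by simp

lemma apply_op_scale: "apply_op T (const c * p) = const c * apply_op T p"
  using apply_op[of T] by simp

instantiation diffop :: (comm_ring_1, type) ring_1
begin

lift_definition zero_diffop :: "('a, 'b) diffop" is "\<lambda>_. 0" by simp
lift_definition one_diffop :: "('a, 'b) diffop" is "\<lambda>p. p" by simp
lift_definition plus_diffop :: "('a, 'b) diffop \<Rightarrow> ('a, 'b) diffop \<Rightarrow> ('a, 'b) diffop"
  is "\<lambda>f g p. f p + g p" by (simp add: algebra_simps)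
lift_definition uminus_diffop :: "('a, 'b) diffop \<Rightarrow> ('a, 'b) diffop"
  is "\<lambda>f p. - f p" by simp
lift_definition minus_diffop :: "('a, 'b) diffop \<Rightarrow> ('a, 'b) diffop \<Rightarrow> ('a, 'b) diffop"
  is "\<lambda>f g p. f p - g p" by (simp add: algebra_simps)
lift_definition times_diffop :: "('a, 'b) diffop \<Rightarrow> ('a, 'b) diffop \<Rightarrow> ('a, 'b) diffop"
  is "\<lambda>f g p. f (g p)" by simp

instance
proof
  show "(0 :: ('a, 'b) diffop) \<noteq> 1"
  proof
    assume "(0 :: ('a, 'b) diffop) = 1"
    then have "apply_op (0 :: ('a, 'b) diffop) 1 = apply_op 1 1" by simp
    then show False by (simp add: zero_diffop.rep_eq one_diffop.rep_eq)
  qed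
qed (transfer; simp add: fun_eq_iff algebra_simps)+

end

lemmas apply_op_simps = zero_diffop.rep_eq one_diffop.rep_eq plus_diffop.rep_eq uminus_diffop.rep_eq
  minus_diffop.rep_eq times_diffop.rep_eq

lemma diffop_eqI: "(\<And>p. apply_op T p = apply_op U p) \<Longrightarrow> T = U"
  by (simp add: apply_op_inject[symmetric] fun_eq_iff)

definition mult_op :: "('a::comm_ring_1, 'n) poisson \<Rightarrow> ('a, 'n) diffop" where
  "mult_op f = Op (\<lambda>p. f * p)"

definition deriv_op :: "'n + 'n \<Rightarrow> ('a::comm_ring_1, 'n) diffop" where
  "deriv_op i = Op (partial i)"

lemma apply_mult_op: "apply_op (mult_op f) p = f * p"
  by (simp add: mult_op_def Op_inverse distrib_left mult.left_commute)

lemma apply_deriv_op: "apply_op (deriv_op i) p = partial i p"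
  by (simp add: deriv_op_def Op_inverse partial_add partial_mult)

lemma mult_op_simps: "mult_op 0 = 0" "mult_op 1 = 1" "mult_op (f + g) = mult_op f + mult_op g"
  "mult_op (f - g) = mult_op f - mult_op g" "mult_op (f * g) = mult_op f * mult_op g"
  by (rule diffop_eqI; simp add: apply_mult_op apply_op_simps algebra_simps)+

lemma mult_op_power: "mult_op (f ^ k) = mult_op f ^ k"
  by (induction k) (simp_all add: mult_op_simps)

lemma deriv_op_commutator: "deriv_op i * mult_op f - mult_op f * deriv_op i = mult_op (partial i f)"
  by (rule diffop_eqI) (simp add: apply_op_simps apply_mult_op apply_deriv_op partial_mult)

definition scal_op :: "'a::comm_ring_1 \<Rightarrow> ('a, 'n) diffop" where
  "scal_op c = mult_op (const c)"

interpretation scal_op: central_scalars "scal_op :: 'a::comm_ring_1 \<Rightarrow> ('a, 'n) diffop"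
proof
  show "scal_op c * T = T * scal_op c" for c and T :: "('a, 'n) diffop"
    by (rule diffop_eqI) (simp add: scal_op_def apply_op_simps apply_mult_op apply_op_scale)
qed (simp_all add: scal_op_def const_one const_add const_mult mult_op_simps)

text \<open>This is left multiplication by \<open>wvar k\<close> on ordered monomials, as
  \<open>ordered_weyl_gen_op\<close> confirms. The summand \<open>mult_op (pvar k)\<close> commutes
  with the derivation and supplies the \<open>p\<close>-th power, that of the derivation being 0
  modulo \<open>p\<close>.\<close>

definition gen_op :: "'n + 'n \<Rightarrow> ('a::comm_ring_1, 'n) diffop" where
  "gen_op k = (case k of Inl i \<Rightarrow> mult_op (pvar k) | Inr i \<Rightarrow> deriv_op (Inl i) + mult_op (pvar k))"

lemma gen_op_commutator:
  "gen_op i * gen_op j - gen_op j * gen_op i = (scal_op (omega i j) :: ('a::comm_ring_1, 'n) diffop)"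
proof -
  have d: "deriv_op k * mult_op (pvar l) =
      (mult_op (pvar l) * deriv_op k + scal_op (of_bool (k = l)) :: ('a, 'n) diffop)" for k l
    using deriv_op_commutator[of k "pvar l :: ('a, 'n) poisson"]
    by (cases "k = l") (simp_all add: partial_pvar algebra_simps mult_op_simps scal_op.iota_zero scal_op.iota_one)
  have dd: "deriv_op k * deriv_op l = (deriv_op l * deriv_op k :: ('a, 'n) diffop)" for k l
    by (rule diffop_eqI) (simp add: apply_op_simps apply_deriv_op partial_commute)
  have mm: "mult_op f * mult_op g = mult_op g * (mult_op f :: ('a, 'n) diffop)" for f g
    by (simp add: mult.commute flip: mult_op_simps)
  show ?thesis
    by (cases i; cases j)
      (auto simp: gen_op_def omega_def distrib_left distrib_right d dd mm scal_op.iota_zero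
        scal_op.iota_one scal_op.iota_uminus)
qed

section \<open>Universal property of the Weyl algebra for arbitrary target algebras\<close>

context central_scalars
begin

definition weyl_lift :: "('n + 'n \<Rightarrow> 'b) \<Rightarrow> ('a, 'n) weyl \<Rightarrow> 'b" where
  "weyl_lift y a = free_eval \<iota> y (rep_weyl a)"

context
  fixes y :: "'n + 'n \<Rightarrow> 'b"
  assumes rel: "\<And>i j. y i * y j - y j * y i = \<iota> (omega i j)"
begin

interpretation monoid_eval_hom \<iota> "\<lambda>w. prod_list (map y (letters w))"
  by unfold_locales
    (simp_all add: iota_one iota_add iota_mult zero_free_mon_def plus_free_mon_def, rule iota_central)

lemma free_eval_relations:
  assumes "p \<in> two_sided_ideal weyl_relators"
  shows "free_eval \<iota> y p = 0"
  using assms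
proof induction
  case (gen r a b)
  then obtain i j where "r = fvar i * fvar j - fvar j * fvar i - const (omega i j)"
    by (auto simp: weyl_relators_def)
  then have r: "r + const (omega i j) + fvar j * fvar i = fvar i * fvar j"
    by simp
  have "free_eval \<iota> y r + \<iota> (omega i j) + y j * y i = y i * y j"
    using arg_cong[OF r, of "free_eval \<iota> y"]
    by (simp add: free_eval_def monoid_eval_add monoid_eval_mult monoid_eval_const
        fvar_def monoid_eval_single iota_one)
  then have "free_eval \<iota> y r = y i * y j - y j * y i - \<iota> (omega i j)"
    by (simp add: algebra_simps)
  then show ?case
    by (simp add: rel free_eval_def monoid_eval_mult)
qed (simp_all add: free_eval_def monoid_eval_zero monoid_eval_add)

lemma weyl_lift_abs: "weyl_lift y (abs_weyl p) = free_eval \<iota> y p"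
proof -
  have "weyl_cong (rep_weyl (abs_weyl p)) p"
    by (metis Quotient3_abs_rep Quotient3_rel_abs Quotient3_weyl weyl.abs_eq_iff)
  then have "free_eval \<iota> y (rep_weyl (abs_weyl p) - p) = 0"
    by (simp add: weyl_cong_def free_eval_relations)
  moreover have "free_eval \<iota> y (rep_weyl (abs_weyl p))
      = free_eval \<iota> y (rep_weyl (abs_weyl p) - p) + free_eval \<iota> y p"
    unfolding free_eval_def monoid_eval_add[symmetric] by simp
  ultimately show ?thesis
    by (simp add: weyl_lift_def)
qed

lemma weyl_lift_simps:
  "weyl_lift y (a + b) = weyl_lift y a + weyl_lift y b"
  "weyl_lift y (a * b) = weyl_lift y a * weyl_lift y b"
  "weyl_lift y (wconst c) = \<iota> c"
  "weyl_lift y (wvar i) = y i"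
proof -
  obtain p q where pq: "a = abs_weyl p" "b = abs_weyl q"
    by (metis Quotient3_abs_rep Quotient3_weyl)
  show "weyl_lift y (a + b) = weyl_lift y a + weyl_lift y b"
    "weyl_lift y (a * b) = weyl_lift y a * weyl_lift y b"
    by (simp_all add: pq plus_weyl.abs_eq times_weyl.abs_eq weyl_lift_abs)
      (simp_all add: free_eval_def monoid_eval_add monoid_eval_mult)
  show "weyl_lift y (wconst c) = \<iota> c" "weyl_lift y (wvar i) = y i"
    by (simp_all add: wconst.abs_eq wvar.abs_eq weyl_lift_abs)
      (simp_all add: free_eval_def monoid_eval_const fvar_def monoid_eval_single iota_one)
qed

end

end

definition weyl_op :: "('a::comm_ring_1, 'n) weyl \<Rightarrow> ('a, 'n) diffop" where
  "weyl_op = scal_op.weyl_lift gen_op"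

lemma weyl_op_simps:
  "weyl_op (a + b) = weyl_op a + weyl_op b"
  "weyl_op (a * b) = weyl_op a * weyl_op b"
  "weyl_op (wconst c) = scal_op c"
  "weyl_op (wvar i) = gen_op i"
  unfolding weyl_op_def by (rule scal_op.weyl_lift_simps[OF gen_op_commutator])+

lemma weyl_op_one: "weyl_op 1 = 1"
  using weyl_op_simps(3)[of 1] by (simp add: wconst_simps scal_op.iota_one)

lemma weyl_op_zero: "weyl_op 0 = 0"
  using weyl_op_simps(3)[of 0] by (simp add: wconst_simps scal_op.iota_zero)

lemma weyl_op_sum: "weyl_op (sum f A) = (\<Sum>x\<in>A. weyl_op (f x))"
  by (induction A rule: infinite_finite_induct) (simp_all add: weyl_op_zero weyl_op_simps)

lemma weyl_op_diff: "weyl_op (a - b) = weyl_op a - weyl_op b"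
  using weyl_op_simps(1)[of "a - b" b] by (simp add: eq_diff_eq)

lemma weyl_op_poly_eval:
  fixes z :: "'v::finite \<Rightarrow> ('a::comm_ring_1, 'n::finite) weyl"
  assumes z: "\<And>i j. z i * z j = z j * z i"
  shows "weyl_op (poly_eval wconst z F) = poly_eval scal_op (\<lambda>i. weyl_op (z i)) F"
proof -
  have z': "weyl_op (z i) * weyl_op (z j) = weyl_op (z j) * weyl_op (z i)" for i j
    by (simp add: z flip: weyl_op_simps)
  show ?thesis
    by (induction F rule: poly_alg_induct)
      (simp_all add: weyl.poly_eval_simps[OF z] scal_op.poly_eval_simps[OF z'] weyl_op_simps)
qed

text \<open>The symbol of \<open>a\<close> with all \<open>wvar (Inl i)\<close> ordered to the left of all \<open>wvar (Inr j)\<close>.\<close>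

definition weyl_symbol :: "('a::comm_ring_1, 'n) weyl \<Rightarrow> ('a, 'n) poisson" where
  "weyl_symbol a = apply_op (weyl_op a) 1"

definition ordered_monomial :: "('n + 'n \<Rightarrow>\<^sub>0 nat) \<Rightarrow> ('a::comm_ring_1, 'n::finite) weyl" where
  "ordered_monomial m =
     poly_eval wconst (\<lambda>i. wvar (Inl i)) (Poly_Mapping.single (Poly_Mapping.map_key Inl m) 1) *
     poly_eval wconst (\<lambda>i. wvar (Inr i)) (Poly_Mapping.single (Poly_Mapping.map_key Inr m) 1)"

text \<open>Normal ordering, which turns out to be a left inverse of
  \<open>weyl_symbol\<close>.\<close>

definition ordered_weyl :: "('a::comm_ring_1, 'n::finite) poisson \<Rightarrow> ('a, 'n) weyl" where
  "ordered_weyl p = (\<Sum>m\<in>Poly_Mapping.keys p. wconst (Poly_Mapping.lookup p m) * ordered_monomial m)"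

section \<open>Ordered monomials and faithfulness of the operator representation\<close>

lemma wvar_commute:
  "wvar (Inl i) * wvar (Inl j) = wvar (Inl j) * wvar (Inl i)"
  "wvar (Inr i) * wvar (Inr j) = wvar (Inr j) * wvar (Inr i)"
  using wvar_commutator[of "Inl i" "Inl j"] wvar_commutator[of "Inr i" "Inr j"]
  by (simp_all add: omega_def wconst_simps)

lemma map_key_sum_simps:
  "Poly_Mapping.map_key Inl (m + l) = Poly_Mapping.map_key Inl m + Poly_Mapping.map_key Inl (l :: 'a + 'b \<Rightarrow>\<^sub>0 nat)"
  "Poly_Mapping.map_key Inr (m + l) = Poly_Mapping.map_key Inr m + Poly_Mapping.map_key Inr l"
  "Poly_Mapping.map_key Inl (m - l) = Poly_Mapping.map_key Inl m - Poly_Mapping.map_key Inl l"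
  "Poly_Mapping.map_key Inr (m - l) = Poly_Mapping.map_key Inr m - Poly_Mapping.map_key Inr l"
  "Poly_Mapping.map_key Inl (Poly_Mapping.single (Inl i) k) = Poly_Mapping.single i (k :: nat)"
  "Poly_Mapping.map_key Inl (Poly_Mapping.single (Inr j) k) = 0"
  "Poly_Mapping.map_key Inr (Poly_Mapping.single (Inr j) k) = Poly_Mapping.single j (k :: nat)"
  "Poly_Mapping.map_key Inr (Poly_Mapping.single (Inl i) k) = 0"
  by (rule poly_mapping_eqI;
      simp add: map_key.rep_eq lookup_add lookup_minus lookup_single when_def)+

lemma ordered_monomial_simps:
  "ordered_monomial 0 = (1 :: ('a::comm_ring_1, 'b::finite) weyl)"
  "ordered_monomial (m + Poly_Mapping.single (Inl i) 1) = wvar (Inl i) * (ordered_monomial m :: ('a, 'b) weyl)"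
  "ordered_monomial (m + Poly_Mapping.single (Inr j) 1) = (ordered_monomial m :: ('a, 'b) weyl) * wvar (Inr j)"
proof -
  note ev = weyl.poly_eval_simps[OF wvar_commute(1)] weyl.poly_eval_simps[OF wvar_commute(2)]
    weyl.poly_eval_one[OF wvar_commute(1)] weyl.poly_eval_one[OF wvar_commute(2)]
  have s: "Poly_Mapping.single (m + Poly_Mapping.single i 1) 1 = pvar i * Poly_Mapping.single m (1 :: 'a)"
    "Poly_Mapping.single (m + Poly_Mapping.single i 1) 1 = Poly_Mapping.single m (1 :: 'a) * pvar i"
    for m :: "'v \<Rightarrow>\<^sub>0 nat" and i
    by (simp_all add: pvar_def mult_single add.commute)
  show "ordered_monomial 0 = (1 :: ('a, 'b) weyl)"
    by (simp add: ordered_monomial_def ev)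
  show "ordered_monomial (m + Poly_Mapping.single (Inl i) 1) = wvar (Inl i) * (ordered_monomial m :: ('a, 'b) weyl)"
    unfolding ordered_monomial_def map_key_sum_simps add_0_right s(1) ev by (simp only: mult.assoc)
  show "ordered_monomial (m + Poly_Mapping.single (Inr j) 1) = (ordered_monomial m :: ('a, 'b) weyl) * wvar (Inr j)"
    unfolding ordered_monomial_def map_key_sum_simps add_0_right s(2) ev by (simp only: mult.assoc)
qed

text \<open>Moving \<open>wvar (Inr i)\<close> to the right past the \<open>Inl\<close> factors
  costs a commutator, which \<open>br_poly_eval_right\<close> identifies as a derivative. If
  \<open>Inl i\<close> does not occur in \<open>m\<close>, the truncated exponent is multiplied by
  0.\<close>

lemma wvar_Inr_ordered_monomial:
  "wvar (Inr i) * (ordered_monomial m :: ('b::comm_ring_1, 'a::finite) weyl) = ordered_monomial (m + Poly_Mapping.single (Inr i) 1) +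
    wconst (of_nat (Poly_Mapping.lookup m (Inl i))) * ordered_monomial (m - Poly_Mapping.single (Inl i) 1)"
proof -
  let ?x = "\<lambda>p. poly_eval wconst (\<lambda>i. wvar (Inl i)) p :: ('b, 'a) weyl"
  let ?\<xi> = "\<lambda>p. poly_eval wconst (\<lambda>i. wvar (Inr i)) p :: ('b, 'a) weyl"
  let ?a = "Poly_Mapping.map_key Inl m" and ?b = "Poly_Mapping.map_key Inr m"
  let ?s = "\<lambda>a. Poly_Mapping.single a (1 :: 'b)"
  have "wvar (Inr i) * wvar (Inl j) - wvar (Inl j) * wvar (Inr i) = (wconst (of_bool (i = j)) :: ('b, 'a) weyl)" for j
    by (simp add: wvar_commutator omega_def)
  then have "wvar (Inr i) * ?x (?s ?a) - ?x (?s ?a) * wvar (Inr i) = ?x (partial i (?s ?a))"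
    using weyl.br_poly_eval_right[where z="\<lambda>i. wvar (Inl i)" and x="wvar (Inr i)", OF wvar_commute(1)] by blast
  also have "partial i (?s ?a) = const (of_nat (Poly_Mapping.lookup m (Inl i))) * ?s (?a - Poly_Mapping.single i 1)"
    by (simp add: partial_single map_key.rep_eq single_eq_const_mult[symmetric])
  finally have "wvar (Inr i) * ?x (?s ?a) = ?x (?s ?a) * wvar (Inr i)
      + wconst (of_nat (Poly_Mapping.lookup m (Inl i))) * ?x (?s (?a - Poly_Mapping.single i 1))"
    by (simp add: weyl.poly_eval_simps[OF wvar_commute(1)] algebra_simps)
  then have "wvar (Inr i) * (?x (?s ?a) * ?\<xi> (?s ?b)) = ?x (?s ?a) * (wvar (Inr i) * ?\<xi> (?s ?b))
      + wconst (of_nat (Poly_Mapping.lookup m (Inl i))) * (?x (?s (?a - Poly_Mapping.single i 1)) * ?\<xi> (?s ?b))"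
    by (simp only: distrib_right mult.assoc[symmetric])
  moreover have "wvar (Inr i) * ?\<xi> (?s ?b) = ?\<xi> (?s (?b + Poly_Mapping.single i 1))"
  proof -
    have "?s (?b + Poly_Mapping.single i 1) = pvar i * ?s ?b"
      by (simp add: pvar_def mult_single add.commute)
    then show ?thesis by (simp only: weyl.poly_eval_simps[OF wvar_commute(2)])
  qed
  ultimately show ?thesis
    by (simp only: ordered_monomial_def map_key_sum_simps add_0_right diff_zero)
qed

lemma ordered_weyl_superset:
  assumes "finite A" "Poly_Mapping.keys p \<subseteq> A"
  shows "ordered_weyl p = (\<Sum>m\<in>A. wconst (Poly_Mapping.lookup p m) * ordered_monomial m)"
  unfolding ordered_weyl_def
  by (rule sum.mono_neutral_left) (use assms in \<open>auto simp: in_keys_iff wconst_simps\<close>)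

lemma ordered_weyl_add: "ordered_weyl (p + q) = ordered_weyl p + ordered_weyl q"
proof -
  let ?A = "Poly_Mapping.keys p \<union> Poly_Mapping.keys q"
  have "Poly_Mapping.keys (p + q) \<subseteq> ?A"
    by (rule keys_add)
  then show ?thesis
    by (subst (1 2 3) ordered_weyl_superset[of ?A])
      (auto simp: lookup_add wconst_simps distrib_right sum.distrib)
qed

lemma ordered_weyl_single: "ordered_weyl (Poly_Mapping.single m c) = wconst c * ordered_monomial m"
  by (subst ordered_weyl_superset[of "{m}"]) auto

lemma ordered_weyl_const_mult: "ordered_weyl (const c * p) = wconst c * ordered_weyl p"
  by (induction p rule: single_add_induct)
    (simp_all add: distrib_left ordered_weyl_add ordered_weyl_single const_def mult_single wconst_simps mult.assoc)

lemma ordered_weyl_gen_op: "ordered_weyl (apply_op (gen_op k) p) = wvar k * ordered_weyl p"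
proof (induction p rule: single_add_induct)
  case (single m c)
  have s: "pvar k * Poly_Mapping.single m c = Poly_Mapping.single (m + Poly_Mapping.single k 1) c" for k
    by (simp add: pvar_def mult_single add.commute)
  show ?case
  proof (cases k)
    case (Inl i)
    then have "ordered_weyl (apply_op (gen_op k) (Poly_Mapping.single m c)) = wconst c * (wvar k * ordered_monomial m)"
      by (simp only: gen_op_def sum.case apply_mult_op s ordered_weyl_single ordered_monomial_simps)
    then show ?thesis
      by (simp add: ordered_weyl_single weyl.iota_left_commute)
  next
    case (Inr i)
    have "ordered_weyl (apply_op (gen_op k) (Poly_Mapping.single m c)) =
      wconst (of_nat (Poly_Mapping.lookup m (Inl i)) * c) * ordered_monomial (m - Poly_Mapping.single (Inl i) 1) +
      wconst c * ordered_monomial (m + Poly_Mapping.single (Inr i) 1)"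
      by (simp only: Inr gen_op_def sum.case apply_mult_op apply_deriv_op plus_diffop.rep_eq s
          partial_single ordered_weyl_add ordered_weyl_single)
    also have "\<dots> = wconst c * (wvar k * ordered_monomial m)"
      unfolding Inr wvar_Inr_ordered_monomial
      by (simp add: wconst_simps distrib_left mult.commute[of _ c] mult.assoc add.commute)
    finally show ?thesis
      by (simp add: ordered_weyl_single weyl.iota_left_commute)
  qed
qed (simp add: apply_op_add_right ordered_weyl_add distrib_left)

lemma ordered_weyl_apply: "ordered_weyl (apply_op (weyl_op a) p) = a * ordered_weyl p"
proof (induction a arbitrary: p rule: weyl_induct)
  case (const c)
  then show ?case
    by (simp add: weyl_op_simps scal_op_def apply_mult_op ordered_weyl_const_mult)
qed (simp_all add: weyl_op_simps ordered_weyl_gen_op apply_op_simps ordered_weyl_add distrib_right mult.assoc)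

text \<open>Normal ordering intertwines the operators with left multiplication and sends 1 to 1, so
  \<open>ordered_weyl_apply\<close> at \<open>p = 1\<close> recovers \<open>a\<close>. In particular
  an element of the Weyl algebra is determined by its symbol.\<close>

lemma ordered_weyl_symbol: "ordered_weyl (weyl_symbol a) = a"
proof -
  have "ordered_weyl 1 = (1 :: ('a, 'b) weyl)"
    unfolding single_one[symmetric] ordered_weyl_single by (simp add: wconst_simps ordered_monomial_simps)
  then show ?thesis
    by (simp add: weyl_symbol_def ordered_weyl_apply)
qed

lemma weyl_op_expansion:
  "weyl_op a = (\<Sum>m\<in>Poly_Mapping.keys (weyl_symbol a).
     scal_op (Poly_Mapping.lookup (weyl_symbol a) m) * weyl_op (ordered_monomial m))"
  by (subst (1) ordered_weyl_symbol[of a, symmetric]) (simp add: ordered_weyl_def weyl_op_sum weyl_op_simps)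

lemma weyl_symbol_wvar: "weyl_symbol (wvar k) = pvar k"
  by (cases k) (simp_all add: weyl_symbol_def weyl_op_simps gen_op_def apply_op_simps
      apply_mult_op apply_deriv_op partial_const[of _ 1, unfolded const_one])

lemma weyl_symbol_add: "weyl_symbol (a + b) = weyl_symbol a + weyl_symbol b"
  by (simp add: weyl_symbol_def weyl_op_simps apply_op_simps)

lemma weyl_symbol_diff: "weyl_symbol (a - b) = weyl_symbol a - weyl_symbol b"
  by (simp add: weyl_symbol_def weyl_op_diff apply_op_simps)

lemma weyl_symbol_wconst: "weyl_symbol (wconst c) = const c"
  by (simp add: weyl_symbol_def weyl_op_simps scal_op_def apply_mult_op)

section \<open>Conditions on coefficients\<close>

text \<open>The admissible set may depend on the exponent. One notion thus covers integrality,
  congruence modulo the ideal, and bounds on the degree modulo the ideal.\<close>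

definition coeffs_in :: "('k \<Rightarrow> 'a set) \<Rightarrow> ('k \<Rightarrow>\<^sub>0 'a::zero) set" where
  "coeffs_in W = {f. \<forall>m. Poly_Mapping.lookup f m \<in> W m}"

definition additive_family :: "('k \<Rightarrow> 'a::ab_group_add set) \<Rightarrow> bool" where
  "additive_family W \<longleftrightarrow> (\<forall>m. 0 \<in> W m \<and> (\<forall>a\<in>W m. \<forall>b\<in>W m. a - b \<in> W m))"

lemma coeffs_inD: "f \<in> coeffs_in W \<Longrightarrow> Poly_Mapping.lookup f m \<in> W m"
  by (simp add: coeffs_in_def)

lemma coeffs_in_mono: "f \<in> coeffs_in W \<Longrightarrow> (\<And>m. W m \<subseteq> V m) \<Longrightarrow> f \<in> coeffs_in V"
  by (auto simp: coeffs_in_def)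

context
  fixes W :: "'k \<Rightarrow> 'a::ab_group_add set"
  assumes W: "additive_family W"
begin

lemma coeffs_in_zero: "0 \<in> coeffs_in W"
  using W by (simp add: coeffs_in_def additive_family_def)

lemma coeffs_in_diff: "f \<in> coeffs_in W \<Longrightarrow> g \<in> coeffs_in W \<Longrightarrow> f - g \<in> coeffs_in W"
  using W by (simp add: coeffs_in_def additive_family_def lookup_minus)

lemma coeffs_in_add: "f \<in> coeffs_in W \<Longrightarrow> g \<in> coeffs_in W \<Longrightarrow> f + g \<in> coeffs_in W"
  using coeffs_in_diff[of f "0 - g"] coeffs_in_diff[of 0 g] coeffs_in_zero by simp

lemma coeffs_in_sum: "(\<And>x. x \<in> A \<Longrightarrow> h x \<in> coeffs_in W) \<Longrightarrow> sum h A \<in> coeffs_in W"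
  by (induction A rule: infinite_finite_induct) (auto simp: coeffs_in_zero coeffs_in_add)

lemma coeffs_in_single: "c \<in> W m \<Longrightarrow> Poly_Mapping.single m c \<in> coeffs_in W"
  using W by (auto simp: coeffs_in_def additive_family_def lookup_single when_def)

lemma coeffs_in_map:
  assumes "\<And>p q. h (p + q) = h p + h q"
    and "\<And>m c. c \<in> V m \<Longrightarrow> h (Poly_Mapping.single m c) \<in> coeffs_in W" and "f \<in> coeffs_in V"
  shows "h (f :: 'l \<Rightarrow>\<^sub>0 'b::ab_group_add) \<in> coeffs_in W"
proof -
  have "h 0 = 0" using assms(1)[of 0 0] by simp
  then have "h (sum g A) = (\<Sum>x\<in>A. h (g x))" for A and g :: "'l \<Rightarrow> 'l \<Rightarrow>\<^sub>0 'b"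
    by (induction A rule: infinite_finite_induct) (simp_all add: assms(1))
  then have "h f = (\<Sum>m\<in>Poly_Mapping.keys f. h (Poly_Mapping.single m (Poly_Mapping.lookup f m)))"
    by (subst poly_mapping_sum_single[of f]) simp
  then show ?thesis
    using assms(2,3) by (auto intro!: coeffs_in_sum dest: coeffs_inD)
qed

end

lemma coeffs_in_mult:
  fixes f g :: "'k::monoid_add \<Rightarrow>\<^sub>0 'a::ring"
  assumes W: "additive_family W" and "f \<in> coeffs_in U" "g \<in> coeffs_in V"
    and *: "\<And>m l a b. a \<in> U m \<Longrightarrow> b \<in> V l \<Longrightarrow> a * b \<in> W (m + l)"
  shows "f * g \<in> coeffs_in W"
proof (rule coeffs_in_map[OF W, of "\<lambda>f. f * g"])
  fix m c assume c: "c \<in> U m"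
  show "Poly_Mapping.single m c * g \<in> coeffs_in W"
    by (rule coeffs_in_map[OF W, of "\<lambda>g. Poly_Mapping.single m c * g"])
      (use c assms(3) in \<open>auto simp: distrib_left mult_single intro!: coeffs_in_single[OF W] *\<close>)
qed (use assms(2) in \<open>auto simp: distrib_right\<close>)

lemma const_of_nat: "const (of_nat k) = (of_nat k :: 'k::monoid_add \<Rightarrow>\<^sub>0 'a::semiring_1)"
  by (induction k) (simp_all add: const_zero const_one const_add)

definition exponent_degree :: "('v::finite \<Rightarrow>\<^sub>0 nat) \<Rightarrow> nat" where
  "exponent_degree m = (\<Sum>i\<in>UNIV. Poly_Mapping.lookup m i)"

lemma exponent_degree_add: "exponent_degree (m + l) = exponent_degree m + exponent_degree l"
  by (simp add: exponent_degree_def lookup_add sum.distrib)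

lemma exponent_degree_single: "exponent_degree (Poly_Mapping.single i k) = k"
  by (simp add: exponent_degree_def lookup_single when_def)

lemma exponent_degree_minus: "exponent_degree (m - l) \<le> exponent_degree m"
  by (auto simp: exponent_degree_def lookup_minus intro!: sum_mono)

lemma exponent_degree_zero: "exponent_degree m = 0 \<longleftrightarrow> m = 0"
  by (auto simp: exponent_degree_def intro!: poly_mapping_eqI)

lemma single_power: "Poly_Mapping.single m c ^ k = Poly_Mapping.single (\<Sum>i<k. m) (c ^ k)"
  for m :: "'k::comm_monoid_add" and c :: "'a::comm_semiring_1"
  by (induction k) (simp_all add: mult_single add.commute)

lemma lookup_sum_const: "Poly_Mapping.lookup (\<Sum>i<k. m) j = k * Poly_Mapping.lookup m j"
  for m :: "'v \<Rightarrow>\<^sub>0 nat"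
  by (simp add: lookup_sum)

text \<open>The coefficient is a falling factorial; truncated subtraction makes it 0 once
  \<open>k\<close> exceeds the exponent of \<open>i\<close>. Of the new exponent only the entry at
  \<open>i\<close> is recorded, which is what the induction needs.\<close>

lemma partial_funpow_single:
  "\<exists>l. Poly_Mapping.lookup l i = Poly_Mapping.lookup m i - k \<and>
     (partial i ^^ k) (Poly_Mapping.single m c) =
       Poly_Mapping.single l (of_nat (\<Prod>r<k. Poly_Mapping.lookup m i - r) * (c :: 'a::comm_ring_1))"
proof (induction k)
  case (Suc k)
  then obtain l where l: "Poly_Mapping.lookup l i = Poly_Mapping.lookup m i - k"
     "(partial i ^^ k) (Poly_Mapping.single m c) =
       Poly_Mapping.single l (of_nat (\<Prod>r<k. Poly_Mapping.lookup m i - r) * c)"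
    by blast
  then show ?case
    by (intro exI[of _ "l - Poly_Mapping.single i 1"])
      (simp add: partial_single lookup_minus lookup_single ac_simps)
qed auto

lemma partial_funpow_add:
  "(partial i ^^ k) (p + q) = (partial i ^^ k) p + (partial i ^^ k) (q :: ('a::comm_ring_1, 'v) poly_alg)"
  by (induction k) (simp_all add: partial_add)

lemma dvd_falling_product: "0 < p \<Longrightarrow> p dvd (\<Prod>r<p. a - r)" for a p :: nat
proof -
  assume p: "0 < p"
  \<comment> \<open>The factor with \<open>r = a mod p\<close> is a multiple of \<open>p\<close>; it
    is 0 if \<open>a < p\<close>.\<close>
  have "a - a mod p dvd (\<Prod>r<p. a - r)"
    using p by (intro dvd_prodI) auto
  moreover have "p dvd a - a mod p"
    by (rule dvd_minus_mod)
  ultimately show ?thesis by (rule dvd_trans[rotated])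
qed

lemma apply_op_of_nat: "apply_op (of_nat k) f = of_nat k * f"
  by (induction k) (simp_all add: apply_op_simps distrib_right)

lemma apply_op_power: "apply_op (T ^ k) f = (apply_op T ^^ k) f"
  by (induction k) (simp_all add: apply_op_simps)

section \<open>Reduction modulo a radical ideal\<close>

lemma (in char_p_reduction) ideal_power_cong:
  assumes "a \<in> S" "b \<in> S" "a - b \<in> I"
  shows "a ^ k - b ^ k \<in> I"
proof (induction k)
  case (Suc k)
  have "a ^ Suc k - b ^ Suc k = a * (a ^ k - b ^ k) + (a - b) * b ^ k"
    by (simp add: algebra_simps)
  then show ?case
    using Suc assms by (simp add: ideal_add ideal_left ideal_right power_mem del: power_Suc)
qed (simp add: ideal_zero)

text \<open>The assumption \<open>radical\<close> says that Frobenius is injective on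
  \<open>B / M\<close>, so that congruences between \<open>p\<close>-th powers descend to their
  bases. The exclusion of 2 enters through \<open>tracks_add\<close>.\<close>

locale radical_reduction = char_p_reduction B M p
  for B :: "'a::comm_ring_1 set" and M p +
  assumes radical: "b \<in> B \<Longrightarrow> b ^ p \<in> M \<Longrightarrow> b \<in> M"
    and odd_char: "p \<noteq> 2"
begin

abbreviation int_polys :: "('k \<Rightarrow>\<^sub>0 'a) set" where "int_polys \<equiv> coeffs_in (\<lambda>_. B)"

abbreviation null_polys :: "('k \<Rightarrow>\<^sub>0 'a) set" where "null_polys \<equiv> coeffs_in (\<lambda>_. M)"

text \<open>Modulo \<open>M\<close>, the degree is strictly less than \<open>k\<close>. With this
  strict bound the case \<open>k = 0\<close> is exactly \<open>null_polys\<close>, which lets the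
  statements about degrees also yield congruences.\<close>

abbreviation low_polys :: "nat \<Rightarrow> ('a, 'v::finite) poly_alg set" where
  "low_polys k \<equiv> coeffs_in (\<lambda>m. if k \<le> exponent_degree m then M else B)"

lemma p_gt_2: "p > 2"
  using prime_ge_2_nat[OF prime] odd_char by simp

lemma additive_families: "additive_family (\<lambda>_. B)" "additive_family (\<lambda>_. M)"
  "additive_family (\<lambda>m. if Q m then M else B)"
  by (auto simp: additive_family_def zero_mem ideal_zero diff_mem ideal_diff)

lemma poly_reduction:
  "char_p_reduction (int_polys :: ('a, 'v) poly_alg set) null_polys p"
proof
  have "const 1 \<in> (int_polys :: ('a, 'v) poly_alg set)"
    by (simp add: const_def coeffs_in_single[OF additive_families(1)] one_mem del: single_one)
  then show "1 \<in> (int_polys :: ('a, 'v) poly_alg set)"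
    by (simp only: const_one)
  show "of_nat p \<in> (null_polys :: ('a, 'v) poly_alg set)"
    unfolding const_of_nat[symmetric] const_def by (rule coeffs_in_single[OF additive_families(2) p_ideal])
  show "null_polys \<subseteq> (int_polys :: ('a, 'v) poly_alg set)"
    using ideal_sub by (auto simp: coeffs_in_def)
next
  fix f g :: "('a, 'v) poly_alg"
  show "f \<in> int_polys \<Longrightarrow> g \<in> int_polys \<Longrightarrow> f - g \<in> int_polys"
    "f \<in> null_polys \<Longrightarrow> g \<in> null_polys \<Longrightarrow> f - g \<in> null_polys"
    by (rule coeffs_in_diff[OF additive_families(1)] coeffs_in_diff[OF additive_families(2)]; assumption)+
  show "f \<in> int_polys \<Longrightarrow> g \<in> int_polys \<Longrightarrow> f * g \<in> int_polys"
    by (rule coeffs_in_mult[OF additive_families(1)]) (auto simp: mult_mem)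
  show "f \<in> int_polys \<Longrightarrow> g \<in> null_polys \<Longrightarrow> f * g \<in> null_polys"
    by (rule coeffs_in_mult[OF additive_families(2)]) (auto simp: ideal_left)
  show "f \<in> null_polys \<Longrightarrow> g \<in> int_polys \<Longrightarrow> f * g \<in> null_polys"
    by (rule coeffs_in_mult[OF additive_families(2)]) (auto simp: ideal_right)
qed (rule prime)

end

context radical_reduction
begin

interpretation P: char_p_reduction "int_polys :: ('a, 'v) poly_alg set" null_polys p
  by (rule poly_reduction)

lemma const_int_polys: "c \<in> B \<Longrightarrow> const c \<in> int_polys"
  by (simp add: const_def coeffs_in_single[OF additive_families(1)])

lemma pvar_int_polys: "pvar i \<in> int_polys"
  by (simp add: pvar_def coeffs_in_single[OF additive_families(1)] one_mem)

lemma partial_int_polys: "f \<in> int_polys \<Longrightarrow> partial i f \<in> int_polys"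
  by (rule coeffs_in_map[OF additive_families(1)])
    (auto simp: partial_add partial_single mult_mem of_nat_mem intro!: coeffs_in_single[OF additive_families(1)])

lemma partial_null_polys: "f \<in> null_polys \<Longrightarrow> partial i f \<in> null_polys"
  by (rule coeffs_in_map[OF additive_families(2)])
    (auto simp: partial_add partial_single ideal_left of_nat_mem intro!: coeffs_in_single[OF additive_families(2)])

lemma partial_funpow_p:
  fixes f :: "('a, 'v) poly_alg"
  assumes "f \<in> int_polys"
  shows "(partial i ^^ p) f \<in> null_polys"
proof (rule coeffs_in_map[OF additive_families(2) partial_funpow_add _ assms])
  fix m :: "'v \<Rightarrow>\<^sub>0 nat" and c :: 'a assume c: "c \<in> B"
  obtain l where "(partial i ^^ p) (Poly_Mapping.single m c) =
      Poly_Mapping.single l (of_nat (\<Prod>r<p. Poly_Mapping.lookup m i - r) * c)"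
    using partial_funpow_single[of i m p c] by blast
  moreover have "of_nat (\<Prod>r<p. Poly_Mapping.lookup m i - r) * c \<in> M"
    by (intro ideal_dvd dvd_falling_product c prime_gt_0_nat prime)
  ultimately show "(partial i ^^ p) (Poly_Mapping.single m c) \<in> null_polys"
    by (simp add: coeffs_in_single[OF additive_families(2)])
qed

section \<open>Degree modulo the ideal and extraction of \<open>p\<close>-th roots\<close>

lemma low_polys_mono: "f \<in> low_polys k \<Longrightarrow> k \<le> l \<Longrightarrow> f \<in> low_polys l"
  by (erule coeffs_in_mono) (use ideal_sub in auto)

lemma null_low_polys: "f \<in> null_polys \<Longrightarrow> f \<in> low_polys k"
  by (erule coeffs_in_mono) (use ideal_sub in auto)

lemma low_int_polys: "f \<in> low_polys k \<Longrightarrow> f \<in> int_polys"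
  using ideal_sub by (auto simp: coeffs_in_def split: if_splits)

text \<open>The bounds are strict: degrees at most \<open>k - 1\<close> and \<open>l - 1\<close> add
  up to at most \<open>k + l - 2\<close>, which explains the \<open>Suc\<close>.\<close>

lemma low_polys_mult:
  fixes f g :: "('a, 'v::finite) poly_alg"
  assumes "f \<in> low_polys k" "g \<in> low_polys l" "k + l \<le> Suc r"
  shows "f * g \<in> low_polys r"
proof (rule coeffs_in_mult[OF additive_families(3) assms(1,2)])
  fix m n :: "'v \<Rightarrow>\<^sub>0 nat" and a b :: 'a
  assume a: "a \<in> (if k \<le> exponent_degree m then M else B)"
    and b: "b \<in> (if l \<le> exponent_degree n then M else B)"
  then have "a \<in> B" "b \<in> B" using ideal_sub by (auto split: if_splits)
  moreover have "k \<le> exponent_degree m \<or> l \<le> exponent_degree n" if "r \<le> exponent_degree (m + n)"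
    using that assms(3) by (simp add: exponent_degree_add) linarith
  ultimately show "a * b \<in> (if r \<le> exponent_degree (m + n) then M else B)"
    using a b by (auto simp: mult_mem ideal_left ideal_right)
qed

lemma partial_low_polys:
  fixes f :: "('a, 'v::finite) poly_alg"
  assumes "f \<in> low_polys k"
  shows "partial i f \<in> low_polys k"
proof (rule coeffs_in_map[OF additive_families(3) partial_add _ assms])
  fix m :: "'v \<Rightarrow>\<^sub>0 nat" and c :: 'a assume c: "c \<in> (if k \<le> exponent_degree m then M else B)"
  let ?m = "m - Poly_Mapping.single i 1"
  have "of_nat (Poly_Mapping.lookup m i) * c \<in> (if k \<le> exponent_degree ?m then M else B)"
    using c exponent_degree_minus[of m "Poly_Mapping.single i 1"] ideal_sub
    by (auto simp: mult_mem of_nat_mem ideal_left split: if_splits)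
  then show "partial i (Poly_Mapping.single m c) \<in> low_polys k"
    unfolding partial_single by (rule coeffs_in_single[OF additive_families(3)])
qed

text \<open>Additivity of Frobenius, applied monomial by monomial. The exponent
  \<open>\<Sum>i<p. m\<close> is the \<open>p\<close>-fold multiple of \<open>m\<close>.\<close>

lemma frobenius_expansion:
  fixes f :: "('a, 'v) poly_alg"
  assumes "f \<in> int_polys"
  shows "f ^ p - (\<Sum>m\<in>Poly_Mapping.keys f. Poly_Mapping.single (\<Sum>i<p. m) (Poly_Mapping.lookup f m ^ p)) \<in> null_polys"
proof -
  have "(\<Sum>m\<in>A. Poly_Mapping.single m (h m)) ^ p - (\<Sum>m\<in>A. Poly_Mapping.single (\<Sum>i<p. m) (h m ^ p)) \<in> null_polys"
    if "finite A" "\<And>m. h m \<in> B" for A and h :: "('v \<Rightarrow>\<^sub>0 nat) \<Rightarrow> 'a"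
    using that(1)
  proof induction
    case empty
    then show ?case using p_gt_2 by (simp add: coeffs_in_zero[OF additive_families(2)] power_0_left)
  next
    case (insert x A)
    let ?s = "\<Sum>m\<in>A. Poly_Mapping.single m (h m)" and ?t = "Poly_Mapping.single x (h x)"
    have "?s \<in> int_polys" "?t \<in> int_polys"
      by (auto intro!: coeffs_in_sum[OF additive_families(1)] coeffs_in_single[OF additive_families(1)] that)
    then have "(?t + ?s) ^ p - (?t ^ p + ?s ^ p) \<in> null_polys"
      by (intro P.frobenius_add mult.commute)
    from P.ideal_add[OF this insert.IH] show ?case
      using insert.hyps by (simp add: single_power algebra_simps)
  qed
  from this[OF finite_keys, of "Poly_Mapping.lookup f" f] show ?thesis
    using coeffs_inD[OF assms] by (simp flip: poly_mapping_sum_single)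
qed

text \<open>Multiplication of exponents by \<open>p\<close> is injective, so modulo \<open>M\<close>
  the coefficient of \<open>f ^ p\<close> at the multiple of \<open>m\<close> is the
  \<open>p\<close>-th power of the coefficient of \<open>f\<close> at \<open>m\<close>, without
  cross terms. Radicality then applies to each coefficient.\<close>

lemma low_polys_root:
  fixes f :: "('a, 'v::finite) poly_alg"
  assumes f: "f \<in> int_polys" "f ^ p \<in> low_polys (p * d)"
  shows "f \<in> low_polys d"
proof -
  let ?p = "\<lambda>m :: 'v \<Rightarrow>\<^sub>0 nat. \<Sum>i<p. m"
  let ?g = "\<Sum>m\<in>Poly_Mapping.keys f. Poly_Mapping.single (?p m) (Poly_Mapping.lookup f m ^ p)"
  have inj: "?p m = ?p l \<longleftrightarrow> m = l" for m l
  proof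
    assume "?p m = ?p l"
    then have "p * Poly_Mapping.lookup m i = p * Poly_Mapping.lookup l i" for i
      by (metis lookup_sum_const)
    then show "m = l"
      using p_gt_2 by (intro poly_mapping_eqI) auto
  qed simp
  have deg: "exponent_degree (?p m) = p * exponent_degree m" for m
    by (simp add: exponent_degree_def lookup_sum_const sum_distrib_left)
  have "f ^ p - (f ^ p - ?g) \<in> low_polys (p * d)"
    by (rule coeffs_in_diff[OF additive_families(3) f(2) null_low_polys[OF frobenius_expansion[OF f(1)]]])
  then have g: "?g \<in> low_polys (p * d)" by simp
  have "Poly_Mapping.lookup f m \<in> M" if "d \<le> exponent_degree m" for m
  proof (cases "m \<in> Poly_Mapping.keys f")
    case True
    have "Poly_Mapping.lookup ?g (?p m) = (\<Sum>l\<in>Poly_Mapping.keys f. if l = m then Poly_Mapping.lookup f l ^ p else 0)"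
      unfolding lookup_sum by (intro sum.cong refl) (auto simp: lookup_single when_def inj)
    also have "\<dots> = Poly_Mapping.lookup f m ^ p"
      using True by simp
    finally have "Poly_Mapping.lookup f m ^ p \<in> M"
      using coeffs_inD[OF g, of "?p m"] that by (simp add: deg)
    then show ?thesis
      using radical coeffs_inD[OF f(1)] by blast
  qed (simp add: in_keys_iff ideal_zero)
  then show ?thesis
    using coeffs_inD[OF f(1)] by (simp add: coeffs_in_def)
qed

text \<open>Modulo the ideal, \<open>(f - g) ^ p\<close> is \<open>f ^ p - g ^ p\<close>. For
  \<open>d = 0\<close> the result says that \<open>p\<close>-th roots are unique modulo
  \<open>M\<close>.\<close>

lemma frobenius_diff_root:
  fixes f g :: "('a, 'v::finite) poly_alg"
  assumes "f \<in> int_polys" "g \<in> int_polys" "f ^ p - g ^ p \<in> low_polys (p * d)"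
  shows "f - g \<in> low_polys d"
proof (rule low_polys_root)
  show "f - g \<in> int_polys" by (intro P.diff_mem assms)
  then have "((f - g) + g) ^ p - ((f - g) ^ p + g ^ p) \<in> null_polys"
    by (intro P.frobenius_add mult.commute assms)
  then have "f ^ p - ((f - g) ^ p + g ^ p) \<in> low_polys (p * d)"
    by (simp add: null_low_polys)
  from coeffs_in_diff[OF additive_families(3) assms(3) this]
  show "(f - g) ^ p \<in> low_polys (p * d)" by simp
qed

text \<open>These operators induce maps on polynomials over \<open>B / M\<close>, and
  \<open>null_ops\<close> are those inducing 0. Stability of the null polynomials makes
  \<open>null_ops\<close> closed under multiplication by \<open>int_ops\<close> from the
  left.\<close>

definition int_ops :: "('a, 'n) diffop set" where
  "int_ops = {T. (\<forall>f\<in>int_polys. apply_op T f \<in> int_polys) \<and> (\<forall>f\<in>null_polys. apply_op T f \<in> null_polys)}"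

definition null_ops :: "('a, 'n) diffop set" where
  "null_ops = {T \<in> int_ops. \<forall>f\<in>int_polys. apply_op T f \<in> null_polys}"

lemma op_reduction: "char_p_reduction (int_ops :: ('a, 'n) diffop set) null_ops p"
proof
  show "1 \<in> (int_ops :: ('a, 'n) diffop set)"
    by (simp add: int_ops_def apply_op_simps)
  show "of_nat p \<in> (null_ops :: ('a, 'n) diffop set)"
    by (simp add: null_ops_def int_ops_def apply_op_of_nat P.mult_mem P.of_nat_mem P.ideal_left
        P.ideal_right[OF P.p_ideal])
next
  fix T U :: "('a, 'n) diffop"
  show "T \<in> int_ops \<Longrightarrow> U \<in> int_ops \<Longrightarrow> T - U \<in> int_ops"
    "T \<in> null_ops \<Longrightarrow> U \<in> null_ops \<Longrightarrow> T - U \<in> null_ops"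
    by (auto simp: int_ops_def null_ops_def apply_op_simps P.diff_mem P.ideal_diff)
  show "T \<in> int_ops \<Longrightarrow> U \<in> int_ops \<Longrightarrow> T * U \<in> int_ops"
    "T \<in> int_ops \<Longrightarrow> U \<in> null_ops \<Longrightarrow> T * U \<in> null_ops"
    "T \<in> null_ops \<Longrightarrow> U \<in> int_ops \<Longrightarrow> T * U \<in> null_ops"
    by (auto simp: int_ops_def null_ops_def apply_op_simps)
qed (auto simp: prime null_ops_def)

end

section \<open>Operators compared with polynomials through their \<open>p\<close>-th powers\<close>

context radical_reduction
begin

interpretation P: char_p_reduction "int_polys :: ('a, 'v) poly_alg set" null_polys p
  by (rule poly_reduction)

interpretation O: char_p_reduction "int_ops :: ('a, 'n) diffop set" null_ops p
  by (rule op_reduction)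

lemma mult_op_int: "f \<in> int_polys \<Longrightarrow> mult_op f \<in> int_ops"
  by (auto simp: int_ops_def apply_mult_op P.mult_mem P.ideal_left)

lemma mult_op_null: "f \<in> null_polys \<Longrightarrow> mult_op f \<in> null_ops"
  using P.ideal_sub by (auto simp: null_ops_def mult_op_int apply_mult_op P.ideal_right)

lemma null_opsD: "T \<in> null_ops \<Longrightarrow> apply_op T 1 \<in> null_polys"
  using P.one_mem by (auto simp: null_ops_def)

lemma scal_op_null: "c \<in> M \<Longrightarrow> scal_op c \<in> null_ops"
  by (simp add: scal_op_def mult_op_null const_def coeffs_in_single[OF additive_families(2)])

lemma deriv_op_int: "deriv_op i \<in> int_ops"
  by (simp add: int_ops_def apply_deriv_op partial_int_polys partial_null_polys)

lemma deriv_op_p: "(deriv_op i :: ('a, 'n) diffop) ^ p \<in> null_ops"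
proof -
  have "apply_op (deriv_op i :: ('a, 'n) diffop) = partial i"
    by (rule ext) (rule apply_deriv_op)
  then show ?thesis
    using O.power_mem[OF deriv_op_int, of i p]
    by (simp add: null_ops_def apply_op_power partial_funpow_p)
qed

text \<open>
  In characteristic \<open>p\<close> the operator \<open>T ^ p\<close> is central, and \<open>q\<close> is the commutative shadow of \<open>T\<close>.
\<close>

definition tracks :: "('a, 'n) diffop \<Rightarrow> ('a, 'n) poisson \<Rightarrow> bool" where
  "tracks T q \<longleftrightarrow> T \<in> int_ops \<and> q \<in> int_polys \<and> T ^ p - mult_op (q ^ p) \<in> null_ops"

lemma tracks_mult_op: "q \<in> int_polys \<Longrightarrow> tracks (mult_op q) q"
  by (simp add: tracks_def mult_op_int mult_op_power O.ideal_zero)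

lemma tracks_scal_op: "c \<in> B \<Longrightarrow> tracks (scal_op c) (const c)"
  by (simp add: scal_op_def tracks_mult_op const_int_polys)

lemma tracks_mult:
  assumes "tracks T q" "tracks U r" "T * U = U * T"
  shows "tracks (T * U) (q * r)"
proof -
  have "T ^ k * U = U * T ^ k" for k
    using assms(3) by (rule power_commuting_commutes)
  then have "(T * U) ^ k = T ^ k * U ^ k" for k
    by (induction k) (simp_all add: mult.assoc, simp flip: mult.assoc)
  then have "(T * U) ^ p - mult_op ((q * r) ^ p) =
      T ^ p * (U ^ p - mult_op (r ^ p)) + (T ^ p - mult_op (q ^ p)) * mult_op (r ^ p)"
    by (simp add: power_mult_distrib mult_op_simps algebra_simps)
  also have "\<dots> \<in> null_ops"
    using assms by (intro O.ideal_add O.ideal_left O.ideal_right)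
      (auto simp: tracks_def O.power_mem mult_op_int P.power_mem)
  finally show ?thesis
    using assms by (auto simp: tracks_def O.mult_mem P.mult_mem)
qed

text \<open>Jacobson's formula expands the power of the operator, and additivity of Frobenius that
  of the polynomial. The iterated commutator is the only discrepancy.\<close>

lemma tracks_add_jacobson:
  fixes T U :: "('a, 'n) diffop"
  defines "D \<equiv> \<lambda>X. T * X - X * T"
  assumes T: "tracks T q" and U: "tracks U r"
    and comm: "\<And>k l. (D ^^ k) U * (D ^^ l) U = (D ^^ l) U * (D ^^ k) U"
    and null: "(D ^^ (p - 1)) U \<in> null_ops"
  shows "tracks (T + U) (q + r)"
proof -
  have "(q + r) ^ p - (q ^ p + r ^ p) \<in> null_polys"
    using T U by (intro P.frobenius_add mult.commute) (auto simp: tracks_def)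
  note q = mult_op_null[OF this]
  have TU: "(T + U) ^ p - (T ^ p + U ^ p + (D ^^ (p - 1)) U) \<in> null_ops"
    unfolding D_def by (rule O.jacobson_power) (use T U comm in \<open>auto simp: tracks_def D_def\<close>)
  have TU': "T ^ p - mult_op (q ^ p) \<in> null_ops" "U ^ p - mult_op (r ^ p) \<in> null_ops"
    using T U by (auto simp: tracks_def)
  have "((T + U) ^ p - (T ^ p + U ^ p + (D ^^ (p - 1)) U)) + (D ^^ (p - 1)) U +
     (T ^ p - mult_op (q ^ p)) + (U ^ p - mult_op (r ^ p)) - mult_op ((q + r) ^ p - (q ^ p + r ^ p)) \<in> null_ops"
    by (rule O.ideal_diff[OF O.ideal_add[OF O.ideal_add[OF O.ideal_add[OF TU null] TU'(1)] TU'(2)] q])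
  also have "((T + U) ^ p - (T ^ p + U ^ p + (D ^^ (p - 1)) U)) + (D ^^ (p - 1)) U +
     (T ^ p - mult_op (q ^ p)) + (U ^ p - mult_op (r ^ p)) - mult_op ((q + r) ^ p - (q ^ p + r ^ p))
     = (T + U) ^ p - mult_op ((q + r) ^ p)"
    by (simp add: mult_op_simps algebra_simps)
  finally show ?thesis
    using T U by (simp add: tracks_def O.add_mem P.add_mem)
qed

text \<open>With a central commutator the iterates of \<open>D\<close> on \<open>U\<close> are
  \<open>U\<close>, the commutator, and 0 from the second one on. The Jacobson term is the iterate
  of order \<open>p - 1\<close>, which is at least 2 because \<open>p\<close> is odd.\<close>

lemma tracks_add:
  assumes T: "tracks T q" and U: "tracks U r" and G: "\<And>X. (T * U - U * T) * X = X * (T * U - U * T)"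
  shows "tracks (T + U) (q + r)"
proof (rule tracks_add_jacobson[OF T U])
  let ?D = "\<lambda>X. T * X - X * T"
  let ?G = "T * U - U * T"
  have D2: "(?D ^^ Suc (Suc k)) U = 0" for k
    by (induction k) (simp_all add: G)
  have cases: "(?D ^^ k) U \<in> {U, ?G, 0}" for k
  proof -
    consider "k = 0" | "k = 1" | l where "k = Suc (Suc l)"
      by (metis One_nat_def not0_implies_Suc)
    then show ?thesis
      using D2 by cases auto
  qed
  show "(?D ^^ k) U * (?D ^^ l) U = (?D ^^ l) U * (?D ^^ k) U" for k l
  proof -
    have "X * Y = Y * X" if "X \<in> {U, ?G, 0}" "Y \<in> {U, ?G, 0}" for X Y
      using that G[of X] G[of Y] by auto
    then show ?thesis using cases by blast
  qed
  have "p - 1 = Suc (Suc (p - 3))"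
    using p_gt_2 by simp
  then show "(?D ^^ (p - 1)) U \<in> null_ops"
    using D2[of "p - 3"] by (simp only: O.ideal_zero)
qed

lemma tracks_add_commuting: "tracks T q \<Longrightarrow> tracks U r \<Longrightarrow> T * U = U * T \<Longrightarrow> tracks (T + U) (q + r)"
  by (rule tracks_add) auto

text \<open>For \<open>Inr i\<close> the derivation tracks 0, since \<open>p\<close>-th derivatives
  of integral polynomials are null, and it commutes with multiplication by the other variable
  \<open>pvar (Inr i)\<close>.\<close>

lemma tracks_gen_op: "tracks (gen_op k) (pvar k)"
proof (cases k)
  case (Inl i)
  then show ?thesis by (simp add: gen_op_def tracks_mult_op pvar_int_polys)
next
  case (Inr i)
  have "tracks (deriv_op (Inl i)) 0"
    using p_gt_2 by (simp add: tracks_def deriv_op_int deriv_op_p P.zero_mem mult_op_simps power_0_left)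
  then have "tracks (deriv_op (Inl i) + mult_op (pvar k)) (0 + pvar k)"
    by (rule tracks_add_commuting)
      (use deriv_op_commutator[of "Inl i" "pvar k"] in \<open>simp_all add: tracks_mult_op pvar_int_polys Inr partial_pvar mult_op_simps\<close>)
  then show ?thesis by (simp add: Inr gen_op_def)
qed

context
  fixes Z :: "'v::finite \<Rightarrow> ('a, 'n::finite) diffop" and q :: "'v \<Rightarrow> ('a, 'n) poisson"
  assumes commuting: "\<And>i j. Z i * Z j = Z j * Z i"
begin

lemma poly_eval_int: 
  assumes "\<And>i. Z i \<in> int_ops"
  shows "poly_eval scal_op Z (Poly_Mapping.single m 1) \<in> int_ops"
proof (induction m rule: exponent_induct)
  case (step m i)
  have "Poly_Mapping.single (m + Poly_Mapping.single i 1) 1 = Poly_Mapping.single m 1 * (pvar i :: ('a, 'v) poly_alg)"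
    by (simp add: pvar_def mult_single)
  then show ?case
    using step assms by (simp add: scal_op.poly_eval_simps[OF commuting] O.mult_mem)
qed (simp add: scal_op.poly_eval_one[OF commuting] O.one_mem)

text \<open>For the Jacobson term of a transvection, which is a substitution into a
  \<open>p\<close>-th derivative of \<open>F\<close>.\<close>

lemma poly_eval_null:
  assumes "\<And>i. Z i \<in> int_ops" "F \<in> null_polys"
  shows "poly_eval scal_op Z F \<in> null_ops"
proof -
  have "poly_eval scal_op Z (\<Sum>m\<in>A. Poly_Mapping.single m (Poly_Mapping.lookup F m)) \<in> null_ops" for A
  proof (induction A rule: infinite_finite_induct)
    case (insert m A)
    have "poly_eval scal_op Z (Poly_Mapping.single m (Poly_Mapping.lookup F m)) \<in> null_ops"
      by (subst single_eq_const_mult)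
        (auto simp: scal_op.poly_eval_simps[OF commuting] intro!: O.ideal_right poly_eval_int assms
          scal_op_null coeffs_inD[OF assms(2)])
    then show ?case
      using insert by (simp add: scal_op.poly_eval_simps[OF commuting] O.ideal_add)
  qed (simp_all add: scal_op.poly_eval_zero[OF commuting] O.ideal_zero)
  from this[of "Poly_Mapping.keys F"] show ?thesis
    by (simp flip: poly_mapping_sum_single)
qed

lemma tracks_poly_eval:
  assumes Z: "\<And>i. tracks (Z i) (q i)" and F: "F \<in> int_polys"
  shows "tracks (poly_eval scal_op Z F) (poly_eval const q F)"
proof -
  note q = poly.poly_eval_simps[where z=q, OF mult.commute]
    poly.poly_eval_zero[where z=q, OF mult.commute] poly.poly_eval_one[where z=q, OF mult.commute]
  note z = scal_op.poly_eval_simps[OF commuting] scal_op.poly_eval_zero[OF commuting] scal_op.poly_eval_one[OF commuting]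
  have mono: "tracks (poly_eval scal_op Z (Poly_Mapping.single m 1)) (poly_eval const q (Poly_Mapping.single m 1))" for m
  proof (induction m rule: exponent_induct)
    case zero
    then show ?case
      using tracks_mult_op[OF P.one_mem] by (simp add: q z mult_op_simps)
  next
    case (step m i)
    have s: "Poly_Mapping.single (m + Poly_Mapping.single i 1) 1 = Poly_Mapping.single m 1 * (pvar i :: ('a, 'v) poly_alg)"
      by (simp add: pvar_def mult_single)
    have "poly_eval scal_op Z (Poly_Mapping.single m 1) * Z i = Z i * poly_eval scal_op Z (Poly_Mapping.single m 1)"
      using scal_op.poly_eval_commute[where z = Z and q = "pvar i", OF commuting] by (simp add: z)
    then show ?case
      unfolding s q z by (intro tracks_mult step Z)
  qed
  have single: "tracks (poly_eval scal_op Z (Poly_Mapping.single m c)) (poly_eval const q (Poly_Mapping.single m c))"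
    if "c \<in> B" for m c
    unfolding single_eq_const_mult[of m c] q z
    by (intro tracks_mult tracks_scal_op mono that scal_op.iota_central)
  have "tracks (poly_eval scal_op Z (\<Sum>m\<in>A. Poly_Mapping.single m (Poly_Mapping.lookup F m)))
      (poly_eval const q (\<Sum>m\<in>A. Poly_Mapping.single m (Poly_Mapping.lookup F m)))" for A
  proof (induction A rule: infinite_finite_induct)
    case (insert m A)
    then show ?case
      unfolding sum.insert[OF insert.hyps] q z
      by (intro tracks_add_commuting single coeffs_inD[OF F] scal_op.poly_eval_commute commuting)
  qed (use tracks_mult_op[OF P.zero_mem] in \<open>simp_all add: q z mult_op_simps\<close>)
  from this[of "Poly_Mapping.keys F"] show ?thesis
    by (simp flip: poly_mapping_sum_single)
qed

end

text \<open>Scalar pairwise commutators survive rescaling and summation. Each new summand therefore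
  has a scalar, hence central, commutator with the sum of the others, and \<open>tracks_add\<close>
  applies.\<close>

lemma tracks_sum:
  fixes Z :: "'v \<Rightarrow> ('a, 'n) diffop"
  assumes Z: "\<And>i. tracks (Z i) (q i)" and c: "\<And>i. c i \<in> B"
    and rel: "\<And>i j. \<exists>d. Z i * Z j - Z j * Z i = scal_op d"
  shows "tracks (\<Sum>i\<in>A. scal_op (c i) * Z i) (\<Sum>i\<in>A. const (c i) * q i)"
proof (induction A rule: infinite_finite_induct)
  case (insert x A)
  have scaled: "tracks (scal_op (c i) * Z i) (const (c i) * q i)" for i
    by (intro tracks_mult tracks_scal_op c Z scal_op.iota_central)
  have br: "\<exists>d. (scal_op a * X) * (scal_op b * Y) - (scal_op b * Y) * (scal_op a * X) = scal_op d"
    if ex: "\<exists>d. X * Y - Y * X = scal_op d" for a b and X Y :: "('a, 'n) diffop"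
  proof -
    obtain d where d: "X * Y - Y * X = scal_op d" using ex by blast
    have "(scal_op a * X) * (scal_op b * Y) - (scal_op b * Y) * (scal_op a * X) =
        scal_op a * (scal_op b * (X * Y)) - scal_op b * (scal_op a * (Y * X))"
      by (simp add: mult.assoc scal_op.iota_left_commute[of X] scal_op.iota_left_commute[of Y])
    also have "\<dots> = scal_op a * (scal_op b * (X * Y - Y * X))"
      by (simp add: right_diff_distrib scal_op.iota_left_commute[of "scal_op a" b])
    finally show ?thesis
      by (auto simp: d simp flip: scal_op.iota_mult)
  qed
  have "\<exists>d. (scal_op (c x) * Z x) * (\<Sum>i\<in>A'. scal_op (c i) * Z i) - (\<Sum>i\<in>A'. scal_op (c i) * Z i) * (scal_op (c x) * Z x) = scal_op d" for A'
  proof (induction A' rule: infinite_finite_induct)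
    case (insert y A')
    obtain d where d: "(scal_op (c x) * Z x) * (\<Sum>i\<in>A'. scal_op (c i) * Z i) - (\<Sum>i\<in>A'. scal_op (c i) * Z i) * (scal_op (c x) * Z x) = scal_op d"
      using insert.IH by blast
    obtain e where e: "(scal_op (c x) * Z x) * (scal_op (c y) * Z y) - (scal_op (c y) * Z y) * (scal_op (c x) * Z x) = scal_op e"
      using br[OF rel] by blast
    have "(scal_op (c x) * Z x) * (\<Sum>i\<in>insert y A'. scal_op (c i) * Z i) - (\<Sum>i\<in>insert y A'. scal_op (c i) * Z i) * (scal_op (c x) * Z x)
      = scal_op e + scal_op d"
      unfolding d[symmetric] e[symmetric] sum.insert[OF insert.hyps] distrib_left distrib_right by (simp only: add_diff_add)
    then show ?case
      by (metis scal_op.iota_add)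
  qed (auto intro: exI[of _ 0] simp: scal_op.iota_zero)
  then obtain d where "(scal_op (c x) * Z x) * (\<Sum>i\<in>A. scal_op (c i) * Z i) - (\<Sum>i\<in>A. scal_op (c i) * Z i) * (scal_op (c x) * Z x) = scal_op d"
    by blast
  then show ?case
    unfolding sum.insert[OF insert.hyps]
    by (intro tracks_add scaled insert.IH) (simp only: scal_op.iota_central)
qed (use tracks_mult_op[OF P.zero_mem] in \<open>simp_all add: mult_op_simps\<close>)

lemma tracks_lin_subst:
  assumes y: "weyl.canonical y" and t: "\<And>j. tracks (weyl_op (y j)) (q j)" and g: "\<And>i j. g $ i $ j \<in> B"
  shows "tracks (weyl_op (weyl.lin_subst g y j)) (poisson.lin_subst g q j)"
proof -
  have "\<exists>d. weyl_op (y i) * weyl_op (y k) - weyl_op (y k) * weyl_op (y i) = scal_op d" for i k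
    using arg_cong[OF weyl.canonicalD[OF y, of i k], of weyl_op] by (auto simp: weyl_op_simps weyl_op_diff)
  then show ?thesis
    unfolding weyl.lin_subst_def poisson.lin_subst_def weyl_op_sum weyl_op_simps
    by (intro tracks_sum t g)
qed

text \<open>The commutator with \<open>y (Inr i)\<close> acts on polynomials in the
  \<open>y (Inl j)\<close> as \<open>partial i\<close>. The iterates of \<open>partial i F\<close>
  therefore commute, and the Jacobson term comes from the \<open>p\<close>-th derivative of
  \<open>F\<close>, whose coefficients lie in \<open>M\<close>.\<close>

lemma tracks_transv_subst:
  fixes y :: "'n::finite + 'n \<Rightarrow> ('a, 'n) weyl"
  assumes y: "weyl.canonical y" and t: "\<And>j. tracks (weyl_op (y j)) (q j)" and F: "F \<in> int_polys"
  shows "tracks (weyl_op (weyl.transv_subst F y j)) (poisson.transv_subst F q j)"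
proof (cases j)
  case (Inl i)
  then show ?thesis
    using t by (simp add: weyl.transv_subst_def poisson.transv_subst_def)
next
  case (Inr i)
  let ?e = "\<lambda>G. poly_eval wconst (\<lambda>j. y (Inl j)) G"
  note c = weyl.canonical_commuting[OF y]
  have c': "weyl_op (y (Inl k)) * weyl_op (y (Inl l)) = weyl_op (y (Inl l)) * weyl_op (y (Inl k))" for k l
    by (simp add: c flip: weyl_op_simps)
  have ev: "weyl_op (?e G) = poly_eval scal_op (\<lambda>j. weyl_op (y (Inl j))) G" for G
    by (rule weyl_op_poly_eval[OF c])
  let ?D = "\<lambda>X. weyl_op (y (Inr i)) * X - X * weyl_op (y (Inr i))"
  have D: "?D (weyl_op (?e G)) = weyl_op (?e (partial i G))" for G
  proof -
    have "y (Inr i) * ?e G - ?e G * y (Inr i) = ?e (partial i G)"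
      by (rule weyl.br_poly_eval_right[OF c]) (simp add: weyl.canonicalD[OF y] omega_def)
    from arg_cong[OF this, of weyl_op] show ?thesis
      by (simp add: weyl_op_simps weyl_op_diff)
  qed
  have Dk: "(?D ^^ k) (weyl_op (?e G)) = weyl_op (?e ((partial i ^^ k) G))" for k G
    by (induction k) (simp_all add: D)
  have "tracks (weyl_op (y (Inr i)) + weyl_op (?e (partial i F))) (q (Inr i) + poly_eval const (\<lambda>j. q (Inl j)) (partial i F))"
  proof (rule tracks_add_jacobson[OF t])
    show "tracks (weyl_op (?e (partial i F))) (poly_eval const (\<lambda>j. q (Inl j)) (partial i F))"
      unfolding ev by (rule tracks_poly_eval[OF c' t partial_int_polys[OF F]])
    show "(?D ^^ k) (weyl_op (?e (partial i F))) * (?D ^^ l) (weyl_op (?e (partial i F))) =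
      (?D ^^ l) (weyl_op (?e (partial i F))) * (?D ^^ k) (weyl_op (?e (partial i F)))" for k l
      unfolding Dk weyl_op_simps(2)[symmetric] by (rule arg_cong[OF weyl.poly_eval_commute[OF c]])
    have "(partial i ^^ (p - 1)) (partial i F) = (partial i ^^ p) F"
      using p_gt_2 by (cases p) (simp_all add: funpow_swap1)
    then show "(?D ^^ (p - 1)) (weyl_op (?e (partial i F))) \<in> null_ops"
      unfolding Dk unfolding ev
      using poly_eval_null[where Z = "\<lambda>j. weyl_op (y (Inl j))", OF c', where F = "(partial i ^^ p) F"] t partial_funpow_p[OF F] by (simp add: tracks_def)
  qed
  then show ?thesis
    by (simp add: Inr weyl.transv_subst_def poisson.transv_subst_def weyl_op_simps)
qed

end

definition letter_coeffs :: "('a::comm_ring_1^('n::finite + 'n)^('n + 'n)) + ('a, 'n) poly_alg set \<Rightarrow> 'a set" where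
  "letter_coeffs s = (case s of Inl g \<Rightarrow> (\<lambda>(i, j). g $ i $ j) ` UNIV
     | Inr C \<Rightarrow> Poly_Mapping.lookup (SOME F. F \<in> C) ` Poly_Mapping.keys (SOME F. F \<in> C))"

lemma finite_letter_coeffs: "finite (letter_coeffs s)"
  by (cases s) (simp_all add: letter_coeffs_def)

lemma (in radical_reduction) tracks_word_images:
  assumes "w \<in> fp_words Sp polys_mod_consts" "\<And>s. s \<in> set w \<Longrightarrow> letter_coeffs s \<subseteq> B"
  shows "tracks (weyl_op (weyl.word_images w j)) (poisson.word_images w j)"
  using assms
proof (induction w arbitrary: j rule: rev_induct)
  case Nil
  then show ?case
    by (simp add: weyl.word_images_simps poisson.word_images_simps weyl_op_simps tracks_gen_op)
next
  case (snoc s w)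
  then have w: "w \<in> fp_words Sp polys_mod_consts" and B: "letter_coeffs s \<subseteq> B"
    by (auto simp: fp_words_def)
  have IH: "tracks (weyl_op (weyl.word_images w i)) (poisson.word_images w i)" for i
    using snoc.prems by (intro snoc.IH w) auto
  note can = weyl.canonical_word_images[OF w]
  show ?case
  proof (cases s)
    case (Inl g)
    have "g $ i $ k \<in> B" for i k
      using B unfolding letter_coeffs_def Inl by auto
    then show ?thesis
      unfolding weyl.word_images_simps poisson.word_images_simps weyl.letter_subst_def poisson.letter_subst_def Inl sum.case
      by (intro tracks_lin_subst can IH)
  next
    case (Inr C)
    have "(SOME F. F \<in> C) \<in> int_polys"
      unfolding coeffs_in_def
    proof (intro CollectI allI)
      fix m show "Poly_Mapping.lookup (SOME F. F \<in> C) m \<in> B"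
        using B zero_mem unfolding letter_coeffs_def Inr by (cases "m \<in> Poly_Mapping.keys (SOME F. F \<in> C)") (auto simp: in_keys_iff)
    qed
    then show ?thesis
      unfolding weyl.word_images_simps poisson.word_images_simps weyl.letter_subst_def poisson.letter_subst_def Inr sum.case
      by (intro tracks_transv_subst can IH)
  qed
qed

section \<open>Leading symbols\<close>

context radical_reduction
begin

interpretation P: char_p_reduction "int_polys :: ('a, 'v) poly_alg set" null_polys p
  by (rule poly_reduction)

interpretation O: char_p_reduction "int_ops :: ('a, 'n) diffop set" null_ops p
  by (rule op_reduction)

text \<open>
  Filtration by total degree: modulo the ideal, \<open>T\<close> has filtration degree at most \<open>d\<close>, and only
  the part of \<open>s\<close> of degree \<open>d\<close>, the leading symbol of \<open>T\<close>, matters.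
\<close>

definition symbolic :: "nat \<Rightarrow> ('a, 'n::finite) diffop \<Rightarrow> ('a, 'n) poisson \<Rightarrow> bool" where
  "symbolic d T s \<longleftrightarrow> T \<in> int_ops \<and> s \<in> low_polys (Suc d) \<and>
     (\<forall>e. \<forall>f\<in>low_polys (Suc e). apply_op T f - s * f \<in> low_polys (d + e))"

lemma symbolic_mono:
  assumes T: "symbolic d T s" and le: "d \<le> e"
  shows "symbolic e T s"
  unfolding symbolic_def
proof (intro conjI allI ballI)
  show "T \<in> int_ops" "s \<in> low_polys (Suc e)"
    using T le low_polys_mono[of s "Suc d" "Suc e"] by (auto simp: symbolic_def)
  fix k and f :: "('a, 'b) poisson" assume "f \<in> low_polys (Suc k)"
  then have "apply_op T f - s * f \<in> low_polys (d + k)"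
    using T by (simp add: symbolic_def)
  then show "apply_op T f - s * f \<in> low_polys (e + k)"
    by (rule low_polys_mono) (use le in simp)
qed

lemma symbolic_mult_op: "f \<in> low_polys (Suc d) \<Longrightarrow> symbolic d (mult_op f) f"
  by (simp add: symbolic_def mult_op_int low_int_polys apply_mult_op coeffs_in_zero[OF additive_families(3)])

lemma symbolic_add:
  assumes "symbolic d T s" "symbolic d U t"
  shows "symbolic d (T + U) (s + t)"
proof -
  have "apply_op (T + U) f - (s + t) * f = (apply_op T f - s * f) + (apply_op U f - t * f)" for f
    by (simp add: apply_op_simps algebra_simps)
  then show ?thesis
    using assms unfolding symbolic_def
    by (auto intro!: O.add_mem coeffs_in_add[OF additive_families(3)])
qed

lemma symbolic_null:
  fixes T :: "('a, 'n::finite) diffop"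
  assumes "T \<in> null_ops" "s \<in> null_polys"
  shows "symbolic d T s"
  unfolding symbolic_def
proof (intro conjI allI ballI)
  show "T \<in> int_ops" using assms O.ideal_sub by blast
  show "s \<in> low_polys (Suc d)" using assms null_low_polys by blast
  fix e and f :: "('a, 'n) poisson" assume "f \<in> low_polys (Suc e)"
  then have "f \<in> int_polys" by (rule low_int_polys)
  then have "apply_op T f - s * f \<in> null_polys"
    using assms by (intro P.ideal_diff P.ideal_right) (auto simp: null_ops_def)
  then show "apply_op T f - s * f \<in> low_polys (d + e)"
    by (rule null_low_polys)
qed

lemma symbolic_sum:
  "(\<And>x. x \<in> A \<Longrightarrow> symbolic d (T x) (s x)) \<Longrightarrow> symbolic d (\<Sum>x\<in>A. T x) (\<Sum>x\<in>A. s x)"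
  by (induction A rule: infinite_finite_induct)
    (simp_all add: symbolic_add symbolic_null O.ideal_zero P.ideal_zero)

lemma symbolic_mult:
  fixes T U :: "('a, 'n::finite) diffop"
  assumes T: "symbolic d T s" and U: "symbolic e U t"
  shows "symbolic (d + e) (T * U) (s * t)"
  unfolding symbolic_def
proof (intro conjI allI ballI)
  show "T * U \<in> int_ops" using T U by (auto simp: symbolic_def O.mult_mem)
  show "s * t \<in> low_polys (Suc (d + e))"
    by (rule low_polys_mult[of s "Suc d" t "Suc e"]) (use T U in \<open>auto simp: symbolic_def\<close>)
  fix k and f :: "('a, 'n) poisson" assume f: "f \<in> low_polys (Suc k)"
  have s: "s \<in> low_polys (Suc d)" and t: "t \<in> low_polys (Suc e)"
    using T U by (auto simp: symbolic_def)
  have Uf: "apply_op U f - t * f \<in> low_polys (e + k)"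
    using U f by (auto simp: symbolic_def)
  have "t * f \<in> low_polys (Suc (e + k))"
    by (rule low_polys_mult[OF t f]) simp
  from coeffs_in_add[OF additive_families(3) low_polys_mono[OF Uf, of "Suc (e + k)"] this]
  have "apply_op U f \<in> low_polys (Suc (e + k))" by simp
  then have "apply_op T (apply_op U f) - s * apply_op U f \<in> low_polys (d + (e + k))"
    using T by (auto simp: symbolic_def)
  moreover have "s * (apply_op U f - t * f) \<in> low_polys (d + (e + k))"
    by (rule low_polys_mult[OF s Uf]) simp
  ultimately have "(apply_op T (apply_op U f) - s * apply_op U f) + s * (apply_op U f - t * f) \<in> low_polys (d + (e + k))"
    by (rule coeffs_in_add[OF additive_families(3)])
  then show "apply_op (T * U) f - s * t * f \<in> low_polys (d + e + k)"
    by (simp add: apply_op_simps algebra_simps)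
qed

lemma symbolic_one: "symbolic 0 1 1"
proof -
  have "(1 :: ('a, 'n::finite) poisson) \<in> low_polys (Suc 0)"
    unfolding const_one[symmetric] const_def
    by (rule coeffs_in_single[OF additive_families(3)]) (simp add: exponent_degree_def one_mem)
  from symbolic_mult_op[OF this] show ?thesis by (simp add: mult_op_simps)
qed

lemma symbolic_power: "symbolic d T s \<Longrightarrow> symbolic (k * d) (T ^ k) (s ^ k)"
  by (induction k) (simp_all add: symbolic_one symbolic_mult)

lemma pvar_low: "pvar k \<in> low_polys (Suc 1)"
  unfolding pvar_def
  by (rule coeffs_in_single[OF additive_families(3)]) (simp add: exponent_degree_single one_mem)

lemma symbolic_gen_op: "symbolic 1 (gen_op k) (pvar k :: ('a, 'n::finite) poisson)"
proof (cases k)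
  case (Inl i)
  then show ?thesis
    using symbolic_mult_op[OF pvar_low] by (simp add: gen_op_def)
next
  case (Inr i)
  then have "apply_op (gen_op k) f - pvar k * f = partial (Inl i) f" for f :: "('a, 'n) poisson"
    by (simp add: gen_op_def apply_op_simps apply_mult_op apply_deriv_op)
  moreover have "(gen_op k :: ('a, 'n) diffop) \<in> int_ops"
    using tracks_gen_op[of k] by (simp add: tracks_def)
  ultimately show ?thesis
    using pvar_low partial_low_polys by (auto simp: symbolic_def)
qed

lemma symbolic_ordered_monomial:
  "symbolic (exponent_degree m) (weyl_op (ordered_monomial m)) (Poly_Mapping.single m 1)"
proof (induction m rule: exponent_induct)
  case zero
  then show ?case
    using symbolic_one by (simp add: ordered_monomial_simps weyl_op_one exponent_degree_def)
next
  case (step m i)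
  have s: "Poly_Mapping.single (m + Poly_Mapping.single i 1) 1 = Poly_Mapping.single m (1 :: 'a) * pvar i"
    by (simp add: pvar_def mult_single)
  have deg: "exponent_degree (m + Poly_Mapping.single i 1) = exponent_degree m + 1"
    by (simp add: exponent_degree_add exponent_degree_single)
  show ?case
  proof (cases i)
    case (Inl k)
    then show ?thesis
      using symbolic_mult[OF symbolic_gen_op step, of i] unfolding s deg
      by (simp only: ordered_monomial_simps weyl_op_simps mult.commute[of "pvar (Inl k)"] add.commute)
  next
    case (Inr k)
    then show ?thesis
      using symbolic_mult[OF step symbolic_gen_op, of i] unfolding s deg
      by (simp only: ordered_monomial_simps weyl_op_simps)
  qed
qed

text \<open>In the expansion of \<open>weyl_op a\<close> into ordered monomials, those of degree
  above \<open>d\<close> have coefficients in \<open>M\<close> and contribute null operators. Every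
  other ordered monomial has the corresponding commutative monomial as leading symbol.\<close>

lemma symbolic_weyl_op:
  assumes "weyl_symbol a \<in> low_polys (Suc d)"
  shows "symbolic d (weyl_op a) (weyl_symbol a)"
proof -
  let ?u = "weyl_symbol a"
  have "symbolic d (scal_op (Poly_Mapping.lookup ?u m) * weyl_op (ordered_monomial m))
      (Poly_Mapping.single m (Poly_Mapping.lookup ?u m))" for m
  proof (cases "exponent_degree m \<le> d")
    case True
    have c: "Poly_Mapping.lookup ?u m \<in> B"
      using coeffs_inD[OF assms, of m] True by (simp split: if_splits)
    then have "const (Poly_Mapping.lookup ?u m) \<in> low_polys (Suc 0)"
      unfolding const_def by (intro coeffs_in_single[OF additive_families(3)]) (simp add: exponent_degree_def)
    from symbolic_mult[OF symbolic_mult_op[OF this] symbolic_ordered_monomial]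
    have "symbolic (exponent_degree m) (scal_op (Poly_Mapping.lookup ?u m) * weyl_op (ordered_monomial m))
      (Poly_Mapping.single m (Poly_Mapping.lookup ?u m))"
      by (simp add: scal_op_def flip: single_eq_const_mult)
    then show ?thesis using True by (rule symbolic_mono)
  next
    case False
    then have c: "Poly_Mapping.lookup ?u m \<in> M"
      using coeffs_inD[OF assms, of m] by simp
    have "weyl_op (ordered_monomial m) \<in> int_ops"
      using symbolic_ordered_monomial by (auto simp: symbolic_def)
    then show ?thesis
      using c by (intro symbolic_null O.ideal_right scal_op_null coeffs_in_single[OF additive_families(2)])
  qed
  then have "symbolic d (weyl_op a) (\<Sum>m\<in>Poly_Mapping.keys ?u. Poly_Mapping.single m (Poly_Mapping.lookup ?u m))"
    unfolding weyl_op_expansion[of a] by (intro symbolic_sum)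
  then show ?thesis
    by (simp flip: poly_mapping_sum_single)
qed

lemma weyl_op_null:
  fixes a :: "('a, 'n::finite) weyl"
  assumes a: "weyl_symbol a \<in> null_polys"
  shows "weyl_op a \<in> null_ops"
proof -
  have "weyl_op (ordered_monomial m) \<in> int_ops" for m
    using symbolic_ordered_monomial by (auto simp: symbolic_def)
  then show ?thesis
    unfolding weyl_op_expansion[of a]
    by (intro O.ideal_sum O.ideal_right scal_op_null coeffs_inD[OF a])
qed

lemma int_polys_low: 
  fixes f :: "('a, 'v::finite) poly_alg"
  assumes "f \<in> int_polys"
  shows "\<exists>k. f \<in> low_polys k"
proof -
  obtain k where k: "\<And>m. m \<in> Poly_Mapping.keys f \<Longrightarrow> exponent_degree m < k"
    using finite_nat_set_iff_bounded[of "exponent_degree ` Poly_Mapping.keys f"] by auto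
  have "Poly_Mapping.lookup f m \<in> (if k \<le> exponent_degree m then M else B)" for m
    using coeffs_inD[OF assms, of m] k[of m] ideal_zero by (cases "m \<in> Poly_Mapping.keys f") (auto simp: in_keys_iff)
  then have "f \<in> low_polys k" by (simp only: coeffs_in_def mem_Collect_eq simp_thms)
  then show ?thesis ..
qed

lemma tracks_symbol:
  "tracks (weyl_op a) q \<Longrightarrow> weyl_symbol a \<in> int_polys"
  using P.one_mem by (auto simp: tracks_def int_ops_def weyl_symbol_def)

text \<open>
  Comparing leading symbols of \<open>p\<close>-th powers lowers the degree of \<open>weyl_symbol a - pvar k\<close>
  until only a constant remains; an additive constant \<open>c\<close> would contribute \<open>c ^ p\<close>.
\<close>

lemma tracks_pvar_symbol:
  fixes a :: "('a, 'n::finite) weyl"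
  assumes a: "tracks (weyl_op a) (pvar k)"
  shows "weyl_symbol a - pvar k \<in> null_polys"
proof -
  define u where "u = weyl_symbol a"
  define v where "v = u - pvar k"
  have u: "u \<in> int_polys"
    using tracks_symbol[OF a] by (simp add: u_def)
  then have v: "v \<in> int_polys"
    by (simp add: v_def P.diff_mem pvar_int_polys)
  have null: "weyl_op a ^ p - mult_op (pvar k ^ p) \<in> null_ops"
    using a by (simp add: tracks_def)
  \<comment> \<open>Here \<open>v\<close> has degree at most \<open>Suc d\<close>, and so has
    \<open>u\<close>, because \<open>pvar k\<close> has degree 1; for this reason the descent ends
    at degree 0. Applied to 1, the \<open>p\<close>-th power of the operator agrees modulo
    \<open>M\<close> both with \<open>u ^ p\<close> and with \<open>pvar k ^ p\<close> in degrees at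
    least \<open>p * Suc d\<close>. Taking \<open>p\<close>-th roots lowers the bound for
    \<open>v\<close>.\<close>
  have step: "v \<in> low_polys (Suc d)" if "v \<in> low_polys (Suc (Suc d))" for d
  proof -
    have "v + pvar k \<in> low_polys (Suc (Suc d))"
      by (rule coeffs_in_add[OF additive_families(3) that low_polys_mono[OF pvar_low]]) simp
    then have "weyl_symbol a \<in> low_polys (Suc (Suc d))"
      by (simp add: v_def u_def)
    from symbolic_power[OF symbolic_weyl_op[OF this], of p]
    have "\<forall>e. \<forall>f\<in>low_polys (Suc e). apply_op (weyl_op a ^ p) f - u ^ p * f \<in> low_polys (p * Suc d + e)"
      by (simp add: symbolic_def u_def)
    moreover have "(1 :: ('a, 'n) poisson) \<in> low_polys (Suc 0)"
      using P.one_mem symbolic_one unfolding symbolic_def by blast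
    ultimately have "apply_op (weyl_op a ^ p) 1 - u ^ p \<in> low_polys (p * Suc d)"
      by fastforce
    moreover have "apply_op (weyl_op a ^ p) 1 - pvar k ^ p \<in> low_polys (p * Suc d)"
      using null_low_polys[OF null_opsD[OF null]] by (simp add: apply_op_simps apply_mult_op)
    ultimately have "(apply_op (weyl_op a ^ p) 1 - pvar k ^ p) - (apply_op (weyl_op a ^ p) 1 - u ^ p) \<in> low_polys (p * Suc d)"
      by (rule coeffs_in_diff[OF additive_families(3), rotated])
    then have "u ^ p - pvar k ^ p \<in> low_polys (p * Suc d)"
      by simp
    then show ?thesis
      unfolding v_def by (rule frobenius_diff_root[OF u pvar_int_polys])
  qed
  obtain d where "v \<in> low_polys (Suc d)"
    using int_polys_low[OF v] low_polys_mono by (metis le_SucI order_refl)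
  then have v1: "v \<in> low_polys (Suc 0)"
    by (induction d) (auto intro: step)
  \<comment> \<open>The descent cannot see the constant term. The operator is now congruent to
    \<open>gen_op k + scal_op c\<close>, whose \<open>p\<close>-th power is known from
    \<open>tracks_add_commuting\<close>; comparison with \<open>pvar k ^ p\<close> isolates
    \<open>c\<close>.\<close>
  define c where "c = Poly_Mapping.lookup v 0"
  have c: "c \<in> B"
    using coeffs_inD[OF v] by (simp add: c_def)
  have vc: "v - const c \<in> null_polys"
    unfolding coeffs_in_def
  proof (intro CollectI allI)
    fix m
    show "Poly_Mapping.lookup (v - const c) m \<in> M"
    proof (cases "m = 0")
      case False
      then have "Suc 0 \<le> exponent_degree m"
        using exponent_degree_zero[of m] by linarith
      then show ?thesis
        using coeffs_inD[OF v1, of m] False by (simp add: lookup_minus const_def lookup_single when_def)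
    qed (simp add: lookup_minus const_def c_def ideal_zero)
  qed
  have "weyl_symbol (a - (wvar k + wconst c)) \<in> null_polys"
    using vc by (simp add: weyl_symbol_diff weyl_symbol_add weyl_symbol_wvar weyl_symbol_wconst v_def u_def diff_diff_eq)
  from weyl_op_null[OF this] have ac: "weyl_op a - (gen_op k + scal_op c) \<in> null_ops"
    by (simp add: weyl_op_diff weyl_op_simps)
  have gc: "tracks (gen_op k + scal_op c) (pvar k + const c)"
    by (intro tracks_add_commuting tracks_gen_op tracks_scal_op c scal_op.iota_central[symmetric])
  have "weyl_op a ^ p - (gen_op k + scal_op c) ^ p \<in> null_ops"
    using a gc ac by (intro O.ideal_power_cong) (auto simp: tracks_def)
  moreover have "(gen_op k + scal_op c) ^ p - mult_op ((pvar k + const c) ^ p) \<in> null_ops"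
    using gc by (simp add: tracks_def)
  ultimately have "weyl_op a ^ p - mult_op ((pvar k + const c) ^ p) \<in> null_ops"
    using O.ideal_add by fastforce
  from O.ideal_diff[OF null this] have "mult_op ((pvar k + const c) ^ p - pvar k ^ p) \<in> null_ops"
    by (simp add: mult_op_simps)
  \<comment> \<open>The bound \<open>p * 0\<close> expresses a congruence of all coefficients, so
    \<open>frobenius_diff_root\<close> with \<open>d = 0\<close> extracts the root modulo
    \<open>M\<close>.\<close>
  from null_opsD[OF this] have "(pvar k + const c) ^ p - pvar k ^ p \<in> low_polys (p * 0)"
    by (simp add: apply_mult_op)
  from frobenius_diff_root[OF P.add_mem[OF pvar_int_polys const_int_polys[OF c]] pvar_int_polys this]
  have "(const c :: ('a, 'n) poisson) \<in> null_polys" by simp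
  from P.ideal_add[OF vc this] show ?thesis
    by (simp add: v_def u_def)
qed

text \<open>Both \<open>q ^ p\<close> and \<open>pvar k ^ p\<close> represent the
  \<open>p\<close>-th power of the same operator, and \<open>p\<close>-th roots are unique modulo
  \<open>M\<close>.\<close>

lemma tracks_gen_op_unique:
  fixes q :: "('a, 'n::finite) poisson"
  assumes "tracks (gen_op k) q"
  shows "q - pvar k \<in> null_polys"
proof -
  have "gen_op k ^ p - mult_op (pvar k ^ p) \<in> (null_ops :: ('a, 'n) diffop set)"
    "gen_op k ^ p - mult_op (q ^ p) \<in> null_ops" "q \<in> int_polys"
    using assms tracks_gen_op[of k] by (auto simp: tracks_def)
  from O.ideal_diff[OF this(1,2)] this(3) have "mult_op (q ^ p - pvar k ^ p) \<in> null_ops" "q \<in> int_polys"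
    by (simp_all add: mult_op_simps)
  note q = this
  have "q ^ p - pvar k ^ p \<in> low_polys (p * 0)"
    using null_opsD[OF q(1)] by (simp add: apply_mult_op)
  from frobenius_diff_root[OF q(2) pvar_int_polys this] show ?thesis by simp
qed

lemma tracks_diff_int:
  assumes "tracks (weyl_op a) q"
  shows "q - pvar k \<in> int_polys" "weyl_symbol a - pvar k \<in> int_polys"
  using assms tracks_symbol[OF assms] by (auto simp: tracks_def intro!: P.diff_mem pvar_int_polys)

end

section \<open>The kernels\<close>

lemma exists_radical_reduction:
  fixes B :: "'a::field_char_0 set"
  assumes B: "unital_subring B" "prime_avoiding B" and half: "1 / 2 \<in> B" and c: "c \<in> B" "c \<noteq> 0"
  obtains M p where "radical_reduction B M p" "c \<notin> M"
proof -
  obtain M p where M: "char_p_reduction B M p" "\<forall>b\<in>B. b ^ p \<in> M \<longrightarrow> b \<in> M" "c \<notin> M"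
    using prime_avoiding_reduction[OF B c] by blast
  interpret char_p_reduction B M p by fact
  \<comment> \<open>If \<open>p\<close> were 2, the ideal would contain \<open>1 / 2 * 2 = 1\<close>
    and hence \<open>c\<close>.\<close>
  have "p \<noteq> 2"
  proof
    assume "p = 2"
    then have "1 / 2 * 2 \<in> M"
      using ideal_left[OF half p_ideal] by simp
    then show False
      using ideal_left[OF c(1), of 1] M(3) by simp
  qed
  then have "radical_reduction B M p"
    using M by unfold_locales auto
  then show ?thesis using that M(3) by blast
qed

lemma word_images_eq_iff:
  fixes w :: "((('a::field_char_0)^('n::finite + 'n)^('n + 'n)) + ('a, 'n) poly_alg set) list"
  assumes w: "w \<in> fp_words Sp polys_mod_consts"
  shows "weyl.word_images w = wvar \<longleftrightarrow> poisson.word_images w = pvar"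
proof -
  let ?y = "weyl.word_images w" and ?q = "poisson.word_images w"
  have "finite (insert (1 / 2) (\<Union>s\<in>set w. letter_coeffs s))"
    by (simp add: finite_letter_coeffs)
  from exists_prime_avoiding_subring[OF this] obtain B where B: "unital_subring B" "prime_avoiding B"
    and sub: "insert (1 / 2) (\<Union>s\<in>set w. letter_coeffs s) \<subseteq> B"
    by blast
  have mem: "1 / 2 \<in> B" "\<And>s. s \<in> set w \<Longrightarrow> letter_coeffs s \<subseteq> B"
    using sub by auto
  have tracks: "radical_reduction.tracks B M p (weyl_op (?y j)) (?q j)" if "radical_reduction B M p" for M p j
    by (rule radical_reduction.tracks_word_images[OF that w mem(2)])
  \<comment> \<open>Integrality refers to \<open>B\<close> alone, so any one reduction establishes
    it; the choice \<open>c = 1\<close> provides one.\<close>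
  obtain M p where Mp: "radical_reduction B M p"
    by (rule exists_radical_reduction[OF B mem(1) unital_subring.one_mem[OF B(1)] one_neq_zero])
  have int: "?q j - pvar j \<in> coeffs_in (\<lambda>_. B)" "weyl_symbol (?y j) - pvar j \<in> coeffs_in (\<lambda>_. B)" for j
    using radical_reduction.tracks_diff_int[OF Mp tracks[OF Mp]] by blast+
  \<comment> \<open>Every nonzero element of \<open>B\<close> is missed by the ideal of some
    reduction, so no coefficient that lies in all these ideals can be nonzero.\<close>
  have vanish: "f = 0" if f: "f \<in> coeffs_in (\<lambda>_. B)"
    and null: "\<And>M p. radical_reduction B M p \<Longrightarrow> f \<in> coeffs_in (\<lambda>_. M)" for f :: "('a, 'n) poisson"
  proof (rule ccontr)
    assume "f \<noteq> 0"
    then obtain m where m: "Poly_Mapping.lookup f m \<noteq> 0"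
      by (metis lookup_zero poly_mapping_eqI)
    obtain M p where "radical_reduction B M p" "Poly_Mapping.lookup f m \<notin> M"
      by (rule exists_radical_reduction[OF B mem(1) coeffs_inD[OF f] m])
    then show False
      using coeffs_inD[OF null] by blast
  qed
  show ?thesis
  proof
    assume y: "?y = wvar"
    have "?q j - pvar j = 0" for j
    proof (rule vanish[OF int(1)])
      fix M p assume Mp: "radical_reduction B M p"
      then show "?q j - pvar j \<in> coeffs_in (\<lambda>_. M)"
        using radical_reduction.tracks_gen_op_unique[OF Mp] tracks[OF Mp, of j] by (simp add: y weyl_op_simps)
    qed
    then show "?q = pvar" by (simp add: fun_eq_iff)
  next
    assume q: "?q = pvar"
    have "weyl_symbol (?y j) - pvar j = 0" for j
    proof (rule vanish[OF int(2)])
      fix M p assume "radical_reduction B M p"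
      then show "weyl_symbol (?y j) - pvar j \<in> coeffs_in (\<lambda>_. M)"
        using radical_reduction.tracks_pvar_symbol[of B M p] tracks[of M p j] by (simp add: q)
    qed
    then have "weyl_symbol (?y j) = weyl_symbol (wvar j)" for j
      by (simp add: weyl_symbol_wvar)
    then show "?y = wvar"
      by (metis ext ordered_weyl_symbol)
  qed
qed

theorem theorem1:
  shows "kernel (G_group :: (complex, 'n::finite) G_elem monoid) weyl_Aut rho_weyl
       = kernel (G_group :: (complex, 'n) G_elem monoid) poisson_Aut rho_poisson"
proof -
  have "rho_weyl X = id \<longleftrightarrow> rho_poisson X = id"
    if X: "X \<in> carrier (G_group :: (complex, 'n) G_elem monoid)" for X
  proof -
    obtain w :: "((complex^('n + 'n)^('n + 'n)) + (complex, 'n) poly_alg set) list"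
      where w: "w \<in> fp_words Sp polys_mod_consts" "X = fp_rel Sp polys_mod_consts `` {w}"
      using X by (auto simp: G_group_def free_product_def quotient_def)
    show ?thesis
      unfolding w(2) rho_weyl_eq rho_poisson_eq weyl.word_aut_eq_id[OF w(1)] poisson.word_aut_eq_id[OF w(1)]
      by (rule word_images_eq_iff[OF w(1)])
  qed
  then show ?thesis
    by (auto simp: kernel_def weyl_Aut_def poisson_Aut_def)
qed

end
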